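(* Let $\sigma$ be a bounded piecewise continuous function on $[0,1]^2$. For each $n$ let $\{x_{ij,n}:1\le i\le j\le n\}$ be i.i.d. random variables such that: (i) for each $k\in\mathbb N$, $\lim_{n\to\infty}n\,\mathbb E[x_{ij,n}^{2k}]=:C_{2k}<\infty$ and $\lim_{n\to\infty}n^\alpha\,\mathbb E[x_{ij,n}^{2k-1}]=0$ for every $\alpha<1$; (ii) the sequence $\{0,C_2,0,C_4,0,\dots\}$ is the cumulant sequence of a probability distribution whose moment sequence $\{\beta_k\}$ satisfies Carleman's condition $\sum_{k=1}^\infty\beta_{2k}^{-1/(2k)}=\infty$. Let $W_n$ be the symmetric $n\times n$ matrix with entries $y_{ij,n}=\sigma(i/n,j/n)\,x_{ij,n}$ for $i\le j$. Then the empirical spectral distribution of $W_n$ converges weakly almost surely to a symmetric probability measure $\nu$ whose $2k$th moment is determined by $\sigma$ and $\{C_{2m}\}_{1\le m\le 2k}$.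
   Context: The empirical spectral distribution of an $n\times n$ real symmetric random matrix with eigenvalues $\lambda_1,\dots,\lambda_n$ is the random probability measure $\frac1n\sum_{i=1}^n\delta_{\lambda_i}$. All random variables (for all $n$) live on a common probability space. *)

theory Defs
  imports
    "HOL-Probability.Probability"
    "HOL-Computational_Algebra.Formal_Power_Series"
    "Jordan_Normal_Form.Char_Poly"
begin

definition unit_square :: "(real \<times> real) set" where
  "unit_square = {0..1} \<times> {0..1}"

text \<open>
  Piecewise continuity in two variables: the square splits into finitely many pieces whose
  boundaries have Lebesgue measure zero, and the function is continuous inside each piece.
  Pieces with curved or oblique boundaries (bands, triangles) are allowed, and no one-sided
  limits at the boundaries are required.
\<close>

definition piecewise_continuous_on_square :: "(real \<times> real \<Rightarrow> real) \<Rightarrow> bool" where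
  "piecewise_continuous_on_square \<sigma> \<longleftrightarrow>
     (\<exists>\<P>. finite \<P> \<and> partition_on unit_square \<P> \<and>
          (\<forall>P\<in>\<P>. negligible (frontier P) \<and> continuous_on (interior P) \<sigma>))"

definition moment :: "real measure \<Rightarrow> nat \<Rightarrow> real" where
  "moment \<mu> k = (LINT t|\<mu>. t ^ k)"

text \<open>
  The \<open>k\<close>-th cumulant is \<open>k!\<close> times the \<open>k\<close>-th coefficient of the logarithm of the exponential
  moment generating series. The logarithm is taken formally: \<^term>\<open>fps_ln 1\<close> is the
  series of \<open>ln (1 + X)\<close>, and no convergence is assumed.
\<close>

definition cumulant :: "real measure \<Rightarrow> nat \<Rightarrow> real" where
  "cumulant \<mu> k =
     fact k * fps_nth (fps_ln 1 oo (Abs_fps (\<lambda>j. moment \<mu> j / fact j) - 1)) k"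

text \<open>
  Working in \<^typ>\<open>ennreal\<close> makes \<open>inverse 0\<close> infinite, so the Dirac measure at the origin
  satisfies the condition.
\<close>

definition carleman :: "real measure \<Rightarrow> bool" where
  "carleman \<mu> \<longleftrightarrow>
     (\<Sum>k. inverse (ennreal (root (2 * Suc k) (moment \<mu> (2 * Suc k))))) = \<infinity>"

text \<open>
  The empirical spectral distribution: each root of the characteristic polynomial has mass
  proportional to its multiplicity. For a symmetric matrix of dimension \<open>n > 0\<close> all \<open>n\<close>
  roots are real, so this is the average of the \<open>n\<close> point masses at the eigenvalues.
\<close>

definition esd :: "real mat \<Rightarrow> real measure" where
  "esd A = distr (measure_pmf (pmf_of_multiset (proots (char_poly A)))) borel (\<lambda>t. t)"

text \<open>
  The variable \<open>x n i j\<close> is the entry with row \<open>i\<close> and column \<open>j\<close>, counted from 1 with \<open>i \<le> j\<close>,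
  of the \<open>n\<close>-th array, whereas matrix indices are counted from 0.
\<close>

definition profile_matrix ::
    "(real \<times> real \<Rightarrow> real) \<Rightarrow> (nat \<Rightarrow> nat \<Rightarrow> nat \<Rightarrow> 'a \<Rightarrow> real) \<Rightarrow> nat \<Rightarrow> 'a \<Rightarrow> real mat" where
  "profile_matrix \<sigma> x n \<omega> =
     Matrix.mat n n (\<lambda>(a, b).
       let i = Suc (min a b); j = Suc (max a b)
       in \<sigma> (real i / real n, real j / real n) * x n i j \<omega>)"

text \<open>No relation is imposed between arrays with different \<open>n\<close>.\<close>

definition iid_arrays :: "'a measure \<Rightarrow> (nat \<Rightarrow> nat \<Rightarrow> nat \<Rightarrow> 'a \<Rightarrow> real) \<Rightarrow> bool" where
  "iid_arrays M x \<longleftrightarrow>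
     (\<forall>n\<ge>1.
        prob_space.indep_vars M (\<lambda>_. borel) (\<lambda>(i, j). x n i j) {(i, j). 1 \<le> i \<and> i \<le> j \<and> j \<le> n} \<and>
        (\<forall>i j. 1 \<le> i \<and> i \<le> j \<and> j \<le> n \<longrightarrow> distr M borel (x n i j) = distr M borel (x n 1 1)))"

text \<open>
  The Bochner integral is 0 for non-integrable functions, so existence of the moments is stated
  separately; it is only needed for large \<open>n\<close>, as is implicit in the limits being finite.
\<close>

definition moment_condition ::
    "'a measure \<Rightarrow> (nat \<Rightarrow> nat \<Rightarrow> nat \<Rightarrow> 'a \<Rightarrow> real) \<Rightarrow> (nat \<Rightarrow> real) \<Rightarrow> bool" where
  "moment_condition M x C \<longleftrightarrow>
     (\<forall>i j k. 1 \<le> i \<and> i \<le> j \<and> 1 \<le> k \<longrightarrow>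
        (\<forall>\<^sub>F n in sequentially. integrable M (\<lambda>\<omega>. x n i j \<omega> ^ k)) \<and>
        (\<lambda>n. real n * (LINT \<omega>|M. x n i j \<omega> ^ (2 * k))) \<longlonglongrightarrow> C (2 * k) \<and>
        (\<forall>\<alpha><1. (\<lambda>n. real n powr \<alpha> * (LINT \<omega>|M. x n i j \<omega> ^ (2 * k - 1))) \<longlonglongrightarrow> 0))"

definition cumulant_condition :: "(nat \<Rightarrow> real) \<Rightarrow> bool" where
  "cumulant_condition C \<longleftrightarrow>
     (\<exists>\<mu>. real_distribution \<mu> \<and> (\<forall>k. integrable \<mu> (\<lambda>t. t ^ k)) \<and>
          (\<forall>k\<ge>1. cumulant \<mu> k = (if even k then C k else 0)) \<and>
          carleman \<mu>)"

definition profile_model ::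
    "'a measure \<Rightarrow> (real \<times> real \<Rightarrow> real) \<Rightarrow> (nat \<Rightarrow> nat \<Rightarrow> nat \<Rightarrow> 'a \<Rightarrow> real) \<Rightarrow> (nat \<Rightarrow> real) \<Rightarrow> bool"
  where
  "profile_model M \<sigma> x C \<longleftrightarrow>
     prob_space M \<and>
     bounded (\<sigma> ` unit_square) \<and> piecewise_continuous_on_square \<sigma> \<and>
     iid_arrays M x \<and> moment_condition M x C \<and> cumulant_condition C"

definition esd_converges_as ::
    "'a measure \<Rightarrow> (real \<times> real \<Rightarrow> real) \<Rightarrow> (nat \<Rightarrow> nat \<Rightarrow> nat \<Rightarrow> 'a \<Rightarrow> real) \<Rightarrow> real measure \<Rightarrow> bool"
  where
  "esd_converges_as M \<sigma> x \<nu> \<longleftrightarrow>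
     (AE \<omega> in M. weak_conv_m (\<lambda>n. esd (profile_matrix \<sigma> x n \<omega>)) \<nu>)"

text \<open>
  The moment of order \<open>2k\<close> of the limit \<open>\<nu>\<close> is determined by \<open>\<sigma>\<close> and the numbers \<open>C (2m)\<close>,
  \<open>1 \<le> m \<le> 2k\<close>: any other model, on any probability space over the type \<open>'b\<close>, whose profile
  agrees with \<open>\<sigma>\<close> on the square and whose constants agree with \<open>C\<close> at those indices has a limit
  with the same moment of order \<open>2k\<close>.
\<close>

definition even_moments_determined ::
    "'b itself \<Rightarrow> (real \<times> real \<Rightarrow> real) \<Rightarrow> (nat \<Rightarrow> real) \<Rightarrow> real measure \<Rightarrow> bool" where
  "even_moments_determined _ \<sigma> C \<nu> \<longleftrightarrow>
     (\<forall>k (M' :: 'b measure) \<sigma>' x' C' \<nu>'.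
        profile_model M' \<sigma>' x' C' \<and> (\<forall>p\<in>unit_square. \<sigma>' p = \<sigma> p) \<and>
        (\<forall>m\<in>{1..2*k}. C' (2 * m) = C (2 * m)) \<and>
        real_distribution \<nu>' \<and> esd_converges_as M' \<sigma>' x' \<nu>' \<longrightarrow>
        moment \<nu>' (2 * k) = moment \<nu> (2 * k))"

end

(* The k-th moment of the spectral distribution is a normalised sum over closed walks of length k
   on {1..n}. Grouping walks by which of their vertices coincide, a walk with v vertices and e edges
   contributes about n^(v-1-e), and v <= e+1, so in expectation only walks along trees survive. These
   traverse every edge an even number of times; their contribution is a product of constants C(2m)
   times a Riemann sum of the profile. The fourth centred moment only sees quadruples of walks in
   which every walk shares an edge with another one; their union has v <= e+2, which gives a summable
   bound and almost sure convergence of every moment. A tree walk is determined by the partition of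
   its steps by edges, so the limit moments are dominated by a geometric sequence times the
   moment-cumulant sum over partitions. Hence Carleman's condition is inherited by the limit, which is
   therefore determined by its moments, and convergence of moments gives weak convergence. *)
theory Submission
  imports Defs "Jordan_Normal_Form.Schur_Decomposition"
begin

text \<open>Two walks sharing an edge have v \<le> e+1 in their union, so the variance of the
  normalised trace is only bounded by about 1/n, which is not summable. Arrays of different size are
  unrelated, so almost sure convergence has to come from summability alone; four walks in at most
  two components give n^(-2) up to a small power. That small power arises because odd moments of an
  entry are only known to be o(n^(-\<alpha>)) for \<alpha> < 1: every moment is estimated by
  n^(-1+\<epsilon>), with \<epsilon> small compared to the walk length. Determinacy under Carleman's
  condition is proved through quasi-analyticity. The difference of two characteristic functions with
  equal moments has a zero of infinite order at 0, and Bang's argument spreads this zero over the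
  whole line. The limit law is not constructed in advance. It is a subsequential limit along one
  sample point, and determinacy makes the same law serve for almost every other point.\<close>

section \<open>Carleman's determinacy criterion\<close>

text \<open>Polya's argument: the arithmetic-geometric mean inequality is applied to the weighted
  terms \<open>c k * a k\<close>, since without weights the exchange of sums would leave a divergent
  harmonic sum.\<close>

lemma carleman_inequality_partial:
  fixes a :: "nat \<Rightarrow> real"
  assumes a: "\<And>k. 0 \<le> a k"
  shows "(\<Sum>n<N. (\<Prod>k\<le>n. a k) powr (1 / real (Suc n))) \<le> exp 1 * (\<Sum>k<N. a k)"
proof -
  \<comment> \<open>The weights telescope: the product of the first n+1 of them is (n+2)^(n+1),
    whose root is n+2, while \<open>c k / (k+1)\<close> is (1 + 1/(k+1))^(k+1), which never exceeds
    e.\<close>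
  define c where "c k = real (k+2) ^ (k+1) / real (k+1) ^ k" for k
  have c0: "0 < c k" for k by (auto simp: c_def)
  have pc: "(\<Prod>k\<le>n. c k) = real (n+2) ^ (n+1)" for n
  proof (induction n)
    case (Suc n)
    then show ?case by (simp add: c_def del: of_nat_Suc)
  qed (simp add: c_def)
  have ce: "c k \<le> exp 1 * real (k+1)" for k
  proof -
    have "(1 + 1 / real (Suc k)) ^ Suc k \<le> exp 1"
      by (rule exp_ge_one_plus_x_over_n_power_n) auto
    moreover have "c k = (1 + 1 / real (Suc k)) ^ Suc k * (k+1)"
    proof -
      have "1 + 1 / real (Suc k) = real (k+2) / real (k+1)" by (simp add: field_simps)
      then show ?thesis by (simp add: c_def power_divide)
    qed
    ultimately show ?thesis by (simp only: mult_right_mono of_nat_0_le_iff)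
  qed
  \<comment> \<open>The root n+2 of the weights and the n+1 of the mean combine to 1/((n+1)(n+2)),
    written as a difference so that the sum over n telescopes.\<close>
  have gm: "(\<Prod>k\<le>n. a k) powr (1 / real (Suc n)) \<le> (\<Sum>k\<le>n. c k * a k) * (1 / real (n+1) - 1 / real (n+2))" for n
  proof -
    have "(\<Prod>k\<le>n. c k * a k) powr (1 / card {..n}) \<le> (\<Sum>k\<le>n. c k * a k / card {..n})"
      by (rule arith_geom_mean) (use a c0 in \<open>auto intro!: mult_nonneg_nonneg intro: less_imp_le\<close>)
    moreover have "(\<Prod>k\<le>n. c k * a k) powr (1 / card {..n}) = real (n+2) * (\<Prod>k\<le>n. a k) powr (1 / real (Suc n))"
    proof -
      have "(\<Prod>k\<le>n. c k * a k) = real (n+2) powr real (Suc n) * (\<Prod>k\<le>n. a k)"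
        by (subst powr_realpow) (auto simp: prod.distrib pc)
      moreover have "(real (n+2) powr real (Suc n)) powr (1 / real (Suc n)) = real (n+2)"
        unfolding powr_powr by simp
      ultimately show ?thesis
        using powr_mult[of "real (n+2) powr real (Suc n)" "\<Prod>k\<le>n. a k" "1 / real (Suc n)"]
        by (simp only: card_atMost prod_nonneg a powr_ge_zero)
    qed
    ultimately have "real (n+2) * (\<Prod>k\<le>n. a k) powr (1 / real (Suc n)) \<le> (\<Sum>k\<le>n. c k * a k) / real (n+1)"
      by (simp add: sum_divide_distrib)
    then have "(\<Prod>k\<le>n. a k) powr (1 / real (Suc n)) \<le> (\<Sum>k\<le>n. c k * a k) / real (n+1) / real (n+2)"
      by (subst pos_le_divide_eq) (auto simp: mult.commute simp del: of_nat_add of_nat_Suc)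
    then show ?thesis by (simp add: field_simps)
  qed
  have tel: "(\<Sum>n=k..<N. 1 / real (n+1) - 1 / real (n+2)) = 1 / real (k+1) - 1 / real (N+1)" if "k \<le> N" for k
    using sum_Suc_diff'[of k N "\<lambda>n. - 1 / real (n+1)"] that by simp
  have "(\<Sum>n<N. (\<Prod>k\<le>n. a k) powr (1 / real (Suc n))) \<le>
     (\<Sum>n<N. \<Sum>k\<le>n. c k * a k * (1 / real (n+1) - 1 / real (n+2)))"
    by (intro sum_mono order_trans[OF gm]) (simp add: sum_distrib_right)
  also have "\<dots> = (\<Sum>k<N. \<Sum>n=k..<N. c k * a k * (1 / real (n+1) - 1 / real (n+2)))"
    unfolding sum.Sigma[OF finite_lessThan ballI, OF finite_atMost] sum.Sigma[OF finite_lessThan ballI, OF finite_atLeastLessThan]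
    by (rule sum.reindex_bij_witness[where i="\<lambda>(a,b). (b,a)" and j="\<lambda>(a,b). (b,a)"]) auto
  also have "\<dots> = (\<Sum>k<N. c k * a k * (1 / real (k+1) - 1 / real (N+1)))"
    unfolding sum_distrib_left[symmetric] by (rule sum.cong) (auto simp only: tel less_imp_le lessThan_iff)
  also have "\<dots> \<le> (\<Sum>k<N. exp 1 * a k)"
  proof (rule sum_mono)
    fix k
    have "c k * (1 / real (k+1) - 1 / real (N+1)) \<le> c k * (1 / real (k+1))"
      using c0[of k] by (intro mult_left_mono) auto
    also have "\<dots> \<le> exp 1 * (k+1) * (1 / real (k+1))" by (intro mult_right_mono ce) auto
    also have "\<dots> = exp 1" by simp
    finally show "c k * a k * (1 / real (k+1) - 1 / real (N+1)) \<le> exp 1 * a k"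
      using mult_right_mono[OF _ a[of k]] by (metis mult.assoc mult.commute)
  qed
  finally show ?thesis by (simp add: sum_distrib_left)
qed

text \<open>Products of the ratios telescope, so by \<open>M0\<close> their geometric means dominate
  the terms in \<open>ns\<close>; Carleman's inequality then bounds the sum of those terms by e
  times the sum of the ratios.\<close>

lemma log_convex_not_summable_ratio:
  fixes M :: "nat \<Rightarrow> real"
  assumes pos: "\<And>n. 0 < M n"
    and ns: "\<not> summable (\<lambda>n. M (Suc n) powr - (1 / real (Suc n)))"
    and M0: "1 \<le> M 0"
  shows "\<not> summable (\<lambda>k. M k / M (Suc k))"
proof
  assume s: "summable (\<lambda>k. M k / M (Suc k))"
  let ?a = "\<lambda>k. M k / M (Suc k)"
  have a: "0 \<le> ?a k" for k using pos by (simp add: less_imp_le)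
  have p: "(\<Prod>k\<le>n. ?a k) = M 0 / M (Suc n)" for n
  proof (induction n)
    case (Suc n)
    then show ?case using pos[of "Suc n"] by simp
  qed simp
  have b: "M (Suc n) powr - (1 / real (Suc n)) \<le> (\<Prod>k\<le>n. ?a k) powr (1 / real (Suc n))" for n
  proof -
    have "M (Suc n) powr - (1 / real (Suc n)) = (1 / M (Suc n)) powr (1 / real (Suc n))"
      using pos[of "Suc n"] by (simp add: powr_minus powr_divide inverse_eq_divide)
    also have "\<dots> \<le> (M 0 / M (Suc n)) powr (1 / real (Suc n))"
      using M0 pos[of "Suc n"] by (intro powr_mono2 divide_right_mono) auto
    finally show ?thesis by (simp only: p)
  qed
  have "summable (\<lambda>n. M (Suc n) powr - (1 / real (Suc n)))"
  proof (rule summableI_nonneg_bounded[where x="exp 1 * (\<Sum>k. ?a k)"])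
    fix N
    have "(\<Sum>n<N. M (Suc n) powr - (1 / real (Suc n))) \<le> (\<Sum>n<N. (\<Prod>k\<le>n. ?a k) powr (1 / real (Suc n)))"
      by (intro sum_mono b)
    also have "\<dots> \<le> exp 1 * (\<Sum>k<N. ?a k)" by (rule carleman_inequality_partial[OF a])
    also have "\<dots> \<le> exp 1 * (\<Sum>k. ?a k)" by (intro mult_left_mono sum_le_suminf s) (auto simp: a)
    finally show "(\<Sum>n<N. M (Suc n) powr - (1 / real (Suc n))) \<le> exp 1 * (\<Sum>k. ?a k)" .
  qed simp
  with ns show False by simp
qed

text \<open>Bang's argument: if the first \<open>N\<close> derivatives at a point are as small as \<open>e ^ (n - N) * M n\<close>,
  then the Taylor formula keeps the first \<open>N - 1\<close> of them at most \<open>e ^ (n - (N - 1)) * M n\<close> within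
  distance \<open>M (N - 1) / (e * M N)\<close>. Starting from a zero of infinite order, these distances add up
  to infinity.\<close>

lemma quasi_analytic_zero:
  fixes f :: "nat \<Rightarrow> real \<Rightarrow> complex" and M :: "nat \<Rightarrow> real"
  assumes pos: "\<And>n. 0 < M n"
    and lc: "\<And>n. M (Suc n) ^ 2 \<le> M n * M (Suc (Suc n))"
    and taylor: "\<And>n m t h. cmod (f n (t + h) - (\<Sum>i<m. of_real (h ^ i / fact i) * f (n + i) t))
                   \<le> \<bar>h\<bar> ^ m / fact m * M (n + m)"
    and zero: "\<And>n. f n 0 = 0"
    and ns: "\<not> summable (\<lambda>k. M k / M (Suc k))"
  shows "f 0 t = 0"
proof -
  \<comment> \<open>\<open>f n\<close> stands for the n-th derivative of \<open>f 0\<close>, known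
    only through Taylor's formula. Log-convexity of \<open>M\<close> says that \<rho> increases, so
    up to index N+1 the sequence grows by a factor of at most \<open>\<rho> N\<close> per
    step.\<close>
  define \<rho> where "\<rho> k = M (Suc k) / M k" for k
  have \<rho>0: "0 < \<rho> k" for k using pos by (simp add: \<rho>_def)
  have \<rho>mono: "\<rho> k \<le> \<rho> l" if "k \<le> l" for k l
  proof (rule lift_Suc_mono_le[OF _ that])
    fix k show "\<rho> k \<le> \<rho> (Suc k)"
      using lc[of k] pos[of k] pos[of "Suc k"] by (simp add: \<rho>_def field_simps power2_eq_square)
  qed
  have Mr: "M (n + i) \<le> M n * \<rho> N ^ i" if "n + i \<le> Suc N" for n i N
    using that
  proof (induction i)
    case (Suc i)
    have "M (n + Suc i) = M (n + i) * \<rho> (n + i)" using pos[of "n+i"] by (simp add: \<rho>_def)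
    also have "\<dots> \<le> (M n * \<rho> N ^ i) * \<rho> N"
      using Suc pos \<rho>0 by (intro mult_mono \<rho>mono) (auto intro: less_imp_le mult_nonneg_nonneg zero_le_power)
    finally show ?case by (simp add: mult_ac)
  qed simp
  define P where "P N x \<longleftrightarrow> (\<forall>n\<le>N. cmod (f n x) \<le> exp (real n - real N) * M n)" for N x
  define d where "d k = M k / (exp 1 * M (Suc k))" for k
  have d0: "0 < d k" for k using pos by (simp add: d_def)
  have bang_step: "P N (x + h)" if P: "P (Suc N) x" and h: "\<bar>h\<bar> \<le> d N" for N x h
    unfolding P_def
  proof (intro allI impI)
    fix n assume n: "n \<le> N"
    define m where "m = Suc N - n"
    have m: "n + m = Suc N" using n by (simp add: m_def)
    \<comment> \<open>The i-th Taylor term is at most a constant times r^i / i!. The step length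
      \<open>d N\<close> is exactly what keeps r \<le> 1, so the sum costs a factor e, which is one
      level of \<open>P\<close>.\<close>
    define r where "r = exp 1 * \<bar>h\<bar> * \<rho> N"
    have r0: "0 \<le> r" using \<rho>0[of N] by (simp add: r_def)
    have r1: "r \<le> 1"
    proof -
      have "exp 1 * \<bar>h\<bar> * \<rho> N \<le> exp 1 * d N * \<rho> N" using h \<rho>0[of N] by (intro mult_mono) auto
      also have "\<dots> = 1" using pos[of N] pos[of "Suc N"] by (simp add: d_def \<rho>_def)
      finally show ?thesis by (simp add: r_def)
    qed
    let ?K = "exp (real n - real (Suc N)) * M n"
    have term_le: "\<bar>h\<bar> ^ i / fact i * (exp (real (n+i) - real (Suc N)) * M (n + i)) \<le> ?K * (r ^ i / fact i)"
      if "i \<le> m" for i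
    proof -
      have "M (n + i) \<le> M n * \<rho> N ^ i" using that m by (intro Mr) auto
      then have "\<bar>h\<bar> ^ i / fact i * (exp (real (n+i) - real (Suc N)) * M (n + i)) \<le>
            \<bar>h\<bar> ^ i / fact i * (exp (real (n+i) - real (Suc N)) * (M n * \<rho> N ^ i))"
        by (intro mult_left_mono) auto
      also have "\<dots> = ?K * (r ^ i / fact i)"
      proof -
        have "exp (real (n+i) - real (Suc N)) = exp (real n - real (Suc N)) * exp 1 ^ i"
          by (simp add: exp_of_nat_mult[symmetric] exp_add[symmetric] algebra_simps)
        then show ?thesis by (simp add: r_def power_mult_distrib)
      qed
      finally show ?thesis .
    qed
    have "cmod (f n (x + h)) \<le> cmod (\<Sum>i<m. of_real (h ^ i / fact i) * f (n + i) x) + \<bar>h\<bar> ^ m / fact m * M (n + m)"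
      using taylor[of n x h m] norm_triangle_sub[of "f n (x+h)" "(\<Sum>i<m. of_real (h ^ i / fact i) * f (n + i) x)"]
      by linarith
    also have "\<dots> \<le> (\<Sum>i<m. \<bar>h\<bar> ^ i / fact i * (exp (real (n+i) - real (Suc N)) * M (n + i))) + \<bar>h\<bar> ^ m / fact m * M (n + m)"
    proof (intro add_right_mono order_trans[OF norm_sum] sum_mono)
      fix i assume i: "i \<in> {..<m}"
      have "cmod (f (n+i) x) \<le> exp (real (n+i) - real (Suc N)) * M (n + i)"
        using P[unfolded P_def, rule_format, of "n + i"] m i by simp
      then have "\<bar>h\<bar> ^ i / fact i * cmod (f (n+i) x) \<le> \<bar>h\<bar> ^ i / fact i * (exp (real (n+i) - real (Suc N)) * M (n + i))"
        by (intro mult_left_mono) auto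
      then show "cmod (of_real (h ^ i / fact i) * f (n + i) x) \<le> \<bar>h\<bar> ^ i / fact i * (exp (real (n+i) - real (Suc N)) * M (n + i))"
        by (simp add: norm_mult norm_divide norm_power)
    qed
    also have "\<dots> = (\<Sum>i\<in>{..m}. \<bar>h\<bar> ^ i / fact i * (exp (real (n+i) - real (Suc N)) * M (n + i)))"
      unfolding lessThan_Suc_atMost[symmetric] by (simp add: m del: of_nat_Suc of_nat_add)
    also have "\<dots> \<le> (\<Sum>i\<in>{..m}. ?K * (r ^ i / fact i))" by (intro sum_mono term_le) auto
    also have "\<dots> = ?K * (\<Sum>i\<in>{..m}. r ^ i / fact i)" by (simp add: sum_distrib_left)
    also have "\<dots> \<le> ?K * exp 1"
    proof (intro mult_left_mono)
      have "(\<Sum>i\<in>{..m}. r ^ i / fact i) \<le> (\<Sum>i. r ^ i /\<^sub>R fact i)"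
        using sum_le_suminf[OF summable_exp_generic[of r], of "{..m}"] r0 by (simp add: divide_inverse mult.commute)
      also have "\<dots> = exp r" by (simp add: exp_def)
      also have "\<dots> \<le> exp 1" using r1 by simp
      finally show "(\<Sum>i\<in>{..m}. r ^ i / fact i) \<le> exp 1" .
    qed (use pos[of n] in auto)
    also have "\<dots> = exp (real n - real N) * M n" by (simp add: exp_diff exp_add)
    finally show "cmod (f n (x + h)) \<le> exp (real n - real N) * M n" by simp
  qed
  \<comment> \<open>Induction from N down to N0: \<open>P N\<close> holds at 0 for every N, and each
    level given up buys the distance \<open>d\<close>.\<close>
  have reach: "\<forall>x. \<bar>x\<bar> \<le> (\<Sum>k=N0..<N. d k) \<longrightarrow> P N0 x" if "N0 \<le> N" for N0 N
    using that
  proof (induction N0 rule: inc_induct)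
    case base
    show ?case using pos by (auto simp: P_def zero less_imp_le)
  next
    case (step n)
    show ?case
    proof (intro allI impI)
      fix x assume x: "\<bar>x\<bar> \<le> (\<Sum>k=n..<N. d k)"
      \<comment> \<open>A step towards x from a point nearer to 0, of length \<open>d n\<close>
        unless x itself is closer to 0 than that.\<close>
      define h where "h = sgn x * min \<bar>x\<bar> (d n)"
      have h: "\<bar>h\<bar> \<le> d n" using d0[of n] by (auto simp: h_def abs_mult sgn_if)
      have nn: "0 \<le> (\<Sum>k=Suc n..<N. d k)" by (intro sum_nonneg less_imp_le d0)
      have "\<bar>x - h\<bar> \<le> (\<Sum>k=Suc n..<N. d k)"
        using x step.hyps nn by (auto simp: h_def sgn_if sum.atLeast_Suc_lessThan min_def)
      then have "P (Suc n) (x - h)" using step.IH by auto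
      from bang_step[OF this h] show "P n x" by simp
    qed
  qed
  have all: "P N0 x" for N0 x
  proof -
    have "\<not> summable d"
    proof
      assume "summable d"
      then have "summable (\<lambda>k. exp 1 * d k)" by (rule summable_mult)
      also have "(\<lambda>k. exp 1 * d k) = (\<lambda>k. M k / M (Suc k))" by (auto simp: d_def)
      finally show False using ns by simp
    qed
    then have "\<not> (\<forall>n. (\<Sum>k<n. d k) \<le> \<bar>x\<bar> + (\<Sum>k<N0. d k))"
      using summableI_nonneg_bounded[of d] d0 less_imp_le by blast
    then obtain n where n: "\<bar>x\<bar> + (\<Sum>k<N0. d k) < (\<Sum>k<n. d k)" by (auto simp: not_le)
    have "(\<Sum>k<n. d k) \<le> (\<Sum>k<max n N0. d k)" by (intro sum_mono2) (auto simp: less_imp_le d0)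
    also have "\<dots> = (\<Sum>k<N0. d k) + (\<Sum>k=N0..<max n N0. d k)"
      by (subst sum.union_disjoint[symmetric]) (auto intro: sum.cong)
    finally show ?thesis using reach[of N0 "max n N0"] n by auto
  qed
  \<comment> \<open>\<open>P N t\<close> holds for every N, so its case n = 0 bounds
    \<open>f 0 t\<close> by a null sequence.\<close>
  have lim: "(\<lambda>N. exp (- real N) * M 0) \<longlonglongrightarrow> 0"
    by (rule tendsto_mult_left_zero, rule filterlim_compose[OF exp_at_bot])
       (auto simp: filterlim_uminus_at_bot filterlim_real_sequentially)
  have "cmod (f 0 t) \<le> 0"
    by (rule tendsto_lowerbound[OF lim]) (use all[unfolded P_def, rule_format, of 0 _ t] in auto)
  then show ?thesis by simp
qed

section \<open>Derivatives of the characteristic function, written as integrals\<close>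

definition char_deriv :: "real measure \<Rightarrow> nat \<Rightarrow> real \<Rightarrow> complex" where
  "char_deriv \<mu> n t = (CLINT x|\<mu>. (\<i> * of_real x) ^ n * iexp (t * x))"

lemma iexp_approx_lessThan: "cmod (iexp x - (\<Sum>k<m. (\<i> * of_real x)^k / fact k)) \<le> \<bar>x\<bar>^m / fact m"
proof (cases m)
  case (Suc n)
  then show ?thesis using iexp_approx1[of x n] by (simp add: lessThan_Suc_atMost)
qed simp

lemma integrable_abs_power:
  fixes \<mu> :: "real measure"
  assumes "real_distribution \<mu>" "\<And>k. integrable \<mu> (\<lambda>t. t ^ k)"
  shows "integrable \<mu> (\<lambda>t. \<bar>t\<bar> ^ k)"
  using integrable_abs[OF assms(2)[of k]] by (simp add: power_abs)

lemma integrable_char_deriv: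
  assumes d: "real_distribution \<mu>" and i: "\<And>k. integrable \<mu> (\<lambda>t. t ^ k)"
  shows "integrable \<mu> (\<lambda>x. (\<i> * of_real x) ^ n * iexp (t * x))"
proof -
  interpret real_distribution \<mu> by fact
  show ?thesis
    by (rule Bochner_Integration.integrable_bound[OF integrable_abs_power[OF d i, of n]])
       (auto simp: norm_mult norm_power)
qed

text \<open>The remainder of the exponential series at h x is integrated against |x|^n. This yields
  the Taylor hypothesis of \<open>quasi_analytic_zero\<close> without differentiating under the
  integral.\<close>

lemma char_deriv_taylor:
  assumes d: "real_distribution \<mu>" and i: "\<And>k. integrable \<mu> (\<lambda>t. t ^ k)"
  shows "cmod (char_deriv \<mu> n (t + h) - (\<Sum>i<m. of_real (h ^ i / fact i) * char_deriv \<mu> (n + i) t))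
           \<le> \<bar>h\<bar> ^ m / fact m * (LINT x|\<mu>. \<bar>x\<bar> ^ (n + m))"
proof -
  interpret real_distribution \<mu> by fact
  note int = integrable_char_deriv[OF d i]
  let ?g = "\<lambda>x. (\<i> * of_real x) ^ n * iexp ((t + h) * x)
       - (\<Sum>i<m. of_real (h ^ i / fact i) * ((\<i> * of_real x) ^ (n + i) * iexp (t * x)))"
  have "char_deriv \<mu> n (t + h) - (\<Sum>i<m. of_real (h ^ i / fact i) * char_deriv \<mu> (n + i) t)
      = (CLINT x|\<mu>. ?g x)"
    unfolding char_deriv_def
    by (subst Bochner_Integration.integral_diff, rule int,
          intro int Bochner_Integration.integrable_sum integrable_mult_right,
          subst Bochner_Integration.integral_sum, intro int integrable_mult_right)
       (simp only: integral_mult_right_zero)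
  moreover have "cmod (CLINT x|\<mu>. ?g x) \<le> (LINT x|\<mu>. \<bar>h\<bar> ^ m / fact m * \<bar>x\<bar> ^ (n + m))"
  proof (rule Bochner_Integration.integral_norm_bound_integral)
    show "integrable \<mu> ?g"
      by (intro Bochner_Integration.integrable_diff int Bochner_Integration.integrable_sum integrable_mult_right)
    show "integrable \<mu> (\<lambda>x. \<bar>h\<bar> ^ m / fact m * \<bar>x\<bar> ^ (n + m))"
      by (intro integrable_mult_right integrable_abs_power[OF d i])
    fix x :: real
    have "?g x = (\<i> * of_real x) ^ n * iexp (t * x) * (iexp (h * x) - (\<Sum>k<m. (\<i> * of_real (h * x))^k / fact k))"
      by (simp add: right_diff_distrib sum_distrib_left exp_add[symmetric] distrib_left distrib_right
            power_add power_mult_distrib mult_ac) (simp add: add.commute)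
    also have "cmod \<dots> = \<bar>x\<bar> ^ n * cmod (iexp (h * x) - (\<Sum>k<m. (\<i> * of_real (h * x))^k / fact k))"
      by (simp add: norm_mult norm_power)
    also have "\<dots> \<le> \<bar>x\<bar> ^ n * (\<bar>h * x\<bar> ^ m / fact m)"
      by (intro mult_left_mono iexp_approx_lessThan) auto
    also have "\<dots> = \<bar>h\<bar> ^ m / fact m * \<bar>x\<bar> ^ (n + m)"
      by (simp add: abs_mult power_mult_distrib power_add)
    finally show "cmod (?g x) \<le> \<bar>h\<bar> ^ m / fact m * \<bar>x\<bar> ^ (n + m)" .
  qed
  ultimately show ?thesis by simp
qed

lemma integral_quadratic:
  fixes f g h :: "'a \<Rightarrow> real"
  assumes "integrable M f" "integrable M g" "integrable M h"
  shows "(LINT x|M. f x - c * g x + d * h x) = (LINT x|M. f x) - c * (LINT x|M. g x) + d * (LINT x|M. h x)"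
  using assms by simp

text \<open>Equal moments make all derivatives of the two characteristic functions agree at 0. The
  term 2 m + 1 in \<open>ns\<close> is the value at an even index of the majorant \<open>M\<close>,
  to which both measures contribute their absolute moments.\<close>

theorem carleman_determinate:
  assumes \<mu>: "real_distribution \<mu>" "\<And>k. integrable \<mu> (\<lambda>t. t ^ k)"
    and \<nu>: "real_distribution \<nu>" "\<And>k. integrable \<nu> (\<lambda>t. t ^ k)"
    and eq: "\<And>k. moment \<mu> k = moment \<nu> k"
    and ns: "\<not> summable (\<lambda>k. (2 * moment \<mu> (2 * Suc k) + 1) powr - (1 / real (2 * Suc k)))"
  shows "\<mu> = \<nu>"
proof (rule Levy_uniqueness[OF \<mu>(1) \<nu>(1)], rule ext)
  interpret m: real_distribution \<mu> by fact
  interpret n: real_distribution \<nu> by fact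
  note im = integrable_abs_power[OF \<mu>] and i'n = integrable_abs_power[OF \<nu>]
  fix t
  define A where "A n = (LINT x|\<mu>. \<bar>x\<bar> ^ n)" for n
  define B where "B n = (LINT x|\<nu>. \<bar>x\<bar> ^ n)" for n
  \<comment> \<open>Adding 1 makes the majorant positive and \<open>M 0\<close> at least 1, and it
    preserves log-convexity.\<close>
  define M where "M n = A n + B n + 1" for n
  have A0: "0 \<le> A n" and B0: "0 \<le> B n" for n unfolding A_def B_def by (simp_all add: integral_nonneg_AE)
  have pos: "0 < M n" for n using A0[of n] B0[of n] by (simp add: M_def)
  \<comment> \<open>The integral of |x|^n (|x| - s)^2 is nonnegative for every s, and the added 1
    contributes (1 - s)^2. The choice s = M (n+1) / M n turns this into log-convexity.\<close>
  have quad: "0 \<le> M (n+2) - 2 * s * M (n+1) + s^2 * M n" for n s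
  proof -
    have e: "\<bar>x\<bar> ^ n * (\<bar>x\<bar> - s)^2 = abs x ^ (n+2) - 2 * s * abs x ^ (n+1) + s^2 * abs x ^ n" for x :: real
      by (simp add: power2_eq_square algebra_simps power_add)
    have "0 \<le> (LINT x|\<mu>. \<bar>x\<bar> ^ n * (\<bar>x\<bar> - s)^2)" by (simp add: integral_nonneg_AE)
    also have "\<dots> = A (n+2) - 2 * s * A (n+1) + s^2 * A n"
      unfolding e A_def by (rule integral_quadratic[OF im im im])
    finally have 1: "0 \<le> A (n+2) - 2 * s * A (n+1) + s^2 * A n" .
    have "0 \<le> (LINT x|\<nu>. \<bar>x\<bar> ^ n * (\<bar>x\<bar> - s)^2)" by (simp add: integral_nonneg_AE)
    also have "\<dots> = B (n+2) - 2 * s * B (n+1) + s^2 * B n"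
      unfolding e B_def by (rule integral_quadratic[OF i'n i'n i'n])
    finally have 2: "0 \<le> B (n+2) - 2 * s * B (n+1) + s^2 * B n" .
    have 3: "0 \<le> 1 - 2 * s + s^2" using zero_le_power2[of "1-s"] by (simp add: power2_eq_square algebra_simps)
    have "M (n+2) - 2 * s * M (n+1) + s^2 * M n = (A (n+2) - 2 * s * A (n+1) + s^2 * A n) +
       (B (n+2) - 2 * s * B (n+1) + s^2 * B n) + (1 - 2 * s + s^2)"
      by (simp add: M_def algebra_simps)
    with 1 2 3 show ?thesis by linarith
  qed
  have "char_deriv \<mu> 0 t - char_deriv \<nu> 0 t = 0"
  proof (rule quasi_analytic_zero[where M = M and f = "\<lambda>n t. char_deriv \<mu> n t - char_deriv \<nu> n t"])
    show "M (Suc n) ^ 2 \<le> M n * M (Suc (Suc n))" for n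
      using quad[of n "M (Suc n) / M n"] pos[of n] by (simp add: field_simps power2_eq_square)
    show "char_deriv \<mu> n 0 - char_deriv \<nu> n 0 = 0" for n
    proof -
      have "char_deriv \<mu> n 0 = \<i> ^ n * of_real (moment \<mu> n)"
        unfolding char_deriv_def moment_def
        by (simp add: power_mult_distrib integral_complex_of_real flip: of_real_power)
      moreover have "char_deriv \<nu> n 0 = \<i> ^ n * of_real (moment \<nu> n)"
        unfolding char_deriv_def moment_def
        by (simp add: power_mult_distrib integral_complex_of_real flip: of_real_power)
      ultimately show ?thesis by (simp add: eq)
    qed
    show "cmod (char_deriv \<mu> n (t + h) - char_deriv \<nu> n (t + h) -
             (\<Sum>i<m. of_real (h ^ i / fact i) * (char_deriv \<mu> (n + i) t - char_deriv \<nu> (n + i) t)))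
          \<le> \<bar>h\<bar> ^ m / fact m * M (n + m)" for n m t h
    proof -
      let ?D = "\<lambda>\<mu>. char_deriv \<mu> n (t + h) - (\<Sum>i<m. of_real (h ^ i / fact i) * char_deriv \<mu> (n + i) t)"
      have "char_deriv \<mu> n (t + h) - char_deriv \<nu> n (t + h) -
             (\<Sum>i<m. of_real (h ^ i / fact i) * (char_deriv \<mu> (n + i) t - char_deriv \<nu> (n + i) t)) = ?D \<mu> - ?D \<nu>"
        by (simp add: right_diff_distrib sum_subtractf)
      also have "cmod \<dots> \<le> cmod (?D \<mu>) + cmod (?D \<nu>)" by (rule norm_triangle_ineq4)
      also have "\<dots> \<le> \<bar>h\<bar> ^ m / fact m * A (n + m) + \<bar>h\<bar> ^ m / fact m * B (n + m)"
        unfolding A_def B_def by (intro add_mono char_deriv_taylor \<mu> \<nu>)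
      also have "\<dots> \<le> \<bar>h\<bar> ^ m / fact m * M (n + m)"
        unfolding distrib_left[symmetric] by (intro mult_left_mono) (auto simp: M_def)
      finally show ?thesis .
    qed
    show "\<not> summable (\<lambda>k. M k / M (Suc k))"
    proof (rule log_convex_not_summable_ratio[OF pos])
      show "1 \<le> M 0" using A0[of 0] B0[of 0] by (simp add: M_def)
      have M2: "M (2 * k) = 2 * moment \<mu> (2 * k) + 1" for k
      proof -
        have "A (2*k) = moment \<mu> (2*k)" "B (2*k) = moment \<nu> (2*k)"
          by (simp_all add: A_def B_def moment_def power_mult)
        then show ?thesis by (simp add: M_def eq)
      qed
      show "\<not> summable (\<lambda>n. M (Suc n) powr - (1 / real (Suc n)))"
      proof
        assume "summable (\<lambda>n. M (Suc n) powr - (1 / real (Suc n)))"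
        \<comment> \<open>Even absolute moments are moments; because of the shift by
          \<open>Suc\<close> they sit at the odd positions 2k+1.\<close>
        then have "summable ((\<lambda>n. M (Suc n) powr - (1 / real (Suc n))) \<circ> (\<lambda>k. 2 * k + 1))"
          by (intro summable_reindex) (auto simp: inj_def)
        moreover have "((\<lambda>n. M (Suc n) powr - (1 / real (Suc n))) \<circ> (\<lambda>k. 2 * k + 1)) =
           (\<lambda>k. (2 * moment \<mu> (2 * Suc k) + 1) powr - (1 / real (2 * Suc k)))"
          using M2[of "Suc _"] by (auto simp: fun_eq_iff)
        ultimately show False using ns by simp
      qed
    qed
  qed (rule pos)
  then show "char \<mu> t = char \<nu> t" by (simp add: char_deriv_def char_def)
qed

section \<open>The method of moments\<close>

text \<open>Powers are unbounded test functions, so weak convergence is applied to the clamped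
  variable. The error is controlled by the moment of order 2k, which stays bounded along a sequence
  whose moments converge.\<close>

lemma clamp_power_error:
  fixes t K :: real
  assumes "0 < K"
  shows "\<bar>t ^ k - (max (- K) (min t K)) ^ k\<bar> \<le> t ^ (2 * k) / K ^ k"
proof (cases "\<bar>t\<bar> \<le> K")
  case True
  then have "max (- K) (min t K) = t" by auto
  then show ?thesis using assms by (simp add: power_mult)
next
  case False
  define s where "s = (if t < 0 then -1 else (1::real))"
  have "max (- K) (min t K) = s * K" "t = s * \<bar>t\<bar>" using False assms by (auto simp: s_def)
  then have "t ^ k - (max (- K) (min t K)) ^ k = s ^ k * (\<bar>t\<bar> ^ k - K ^ k)"
    by (metis power_mult_distrib right_diff_distrib)
  moreover have "\<bar>s ^ k\<bar> = 1" by (simp add: s_def power_abs)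
  ultimately have "\<bar>t ^ k - (max (- K) (min t K)) ^ k\<bar> = \<bar>\<bar>t\<bar> ^ k - K ^ k\<bar>" by (simp add: abs_mult)
  also have "\<dots> \<le> \<bar>t\<bar> ^ k" using False assms power_mono[of K "\<bar>t\<bar>" k] by simp
  also have "\<dots> \<le> \<bar>t\<bar> ^ k * (\<bar>t\<bar> ^ k / K ^ k)"
  proof -
    have "1 \<le> \<bar>t\<bar> ^ k / K ^ k" using False assms power_mono[of K "\<bar>t\<bar>" k] by simp
    then show ?thesis using mult_left_mono[of 1 "\<bar>t\<bar> ^ k / K ^ k" "\<bar>t\<bar> ^ k"] by simp
  qed
  also have "\<dots> = t ^ (2 * k) / K ^ k" by (simp add: power_mult power_even_abs flip: power_add mult_2)
  finally show ?thesis .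
qed

text \<open>Bounded moments of order 2k make t^k uniformly integrable. The limit is taken first in n
  at a fixed clamping level K, then in K.\<close>

lemma weak_conv_moment_limit:
  assumes \<mu>: "\<And>n. real_distribution (\<mu> n)" "\<And>n k. integrable (\<mu> n) (\<lambda>t. t ^ k)"
    and \<nu>: "real_distribution \<nu>" and w: "weak_conv_m \<mu> \<nu>"
    and lim: "\<And>k. (\<lambda>n. moment (\<mu> n) k) \<longlonglongrightarrow> m k"
  shows "integrable \<nu> (\<lambda>t. t ^ k) \<and> moment \<nu> k = m k"
proof -
  interpret m: real_distribution "\<mu> n" for n by fact
  interpret n: real_distribution \<nu> by fact
  define g where "g K t = max (- K) (min t K)" for K t :: real
  have g_le: "\<bar>g K t ^ k\<bar> \<le> K ^ k" if "0 < K" for K t k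
    unfolding power_abs by (rule power_mono) (use that in \<open>auto simp: g_def\<close>)
  have g_meas[measurable]: "(\<lambda>t. g K t ^ k) \<in> borel_measurable borel" for K k
    unfolding g_def by measurable
  have ig: "integrable (\<mu> n) (\<lambda>t. g K t ^ k)" "integrable \<nu> (\<lambda>t. g K t ^ k)" if "0 < K" for n K k
    using g_le[OF that, of _ k]
    by (auto intro!: m.integrable_const_bound[where B="K^k"] n.integrable_const_bound[where B="K^k"])
  have gconv: "(\<lambda>n. LINT t|\<mu> n. g K t ^ k) \<longlonglongrightarrow> (LINT t|\<nu>. g K t ^ k)" if "0 < K" for K k
  proof (rule weak_conv_imp_integral_bdd_continuous_conv[OF \<mu>(1) \<nu> w])
    show "isCont (\<lambda>t. g K t ^ k) x" for x unfolding g_def by (intro continuous_intros)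
    show "norm (g K x ^ k) \<le> K ^ k" for x using g_le[OF that, of x k] by simp
  qed
  have "\<exists>S. \<forall>n. moment (\<mu> n) (2 * k) \<le> S"
    using convergent_imp_Bseq[OF convergentI[OF lim[of "2*k"]]] unfolding Bseq_def
    by (metis abs_le_D1 real_norm_def)
  then obtain S where S: "\<And>n. moment (\<mu> n) (2 * k) \<le> S" by blast
  have g_even: "g K t ^ (2 * k) \<le> t ^ (2 * k)" if "0 < K" for K t
  proof -
    have "\<bar>g K t\<bar> \<le> \<bar>t\<bar>" using that by (auto simp: g_def)
    then have "\<bar>g K t\<bar> ^ (2 * k) \<le> \<bar>t\<bar> ^ (2 * k)" by (rule power_mono) auto
    then show ?thesis by (simp add: power_even_abs)
  qed
  have gS: "(LINT t|\<nu>. g K t ^ (2 * k)) \<le> S" if "0 < K" for K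
  proof (rule LIMSEQ_le_const2[OF gconv[OF that]], intro exI allI impI)
    fix n
    have "(LINT t|\<mu> n. g K t ^ (2 * k)) \<le> moment (\<mu> n) (2 * k)"
      unfolding moment_def by (intro integral_mono ig that \<mu>(2) g_even)
    with S[of n] show "(LINT t|\<mu> n. g K t ^ (2 * k)) \<le> S" by linarith
  qed
  \<comment> \<open>Integrability under \<nu> comes from monotone convergence: even powers of the
    clamped variable increase with the level, while their integrals stay below S.\<close>
  have inc: "g (real (Suc i)) t ^ (2 * k) \<le> g (real (Suc j)) t ^ (2 * k)" if "i \<le> j" for i j t
  proof -
    have "\<bar>g (real (Suc i)) t\<bar> \<le> \<bar>g (real (Suc j)) t\<bar>" using that by (auto simp: g_def)
    then have "\<bar>g (real (Suc i)) t\<bar> ^ (2 * k) \<le> \<bar>g (real (Suc j)) t\<bar> ^ (2 * k)" by (rule power_mono) auto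
    then show ?thesis by (simp add: power_even_abs)
  qed
  have glim: "(\<lambda>i. g (real (Suc i)) t ^ (2 * k)) \<longlonglongrightarrow> t ^ (2 * k)" for t
  proof (rule tendsto_eventually)
    obtain N where "\<bar>t\<bar> \<le> real N" using real_arch_simple by blast
    then show "\<forall>\<^sub>F i in sequentially. g (real (Suc i)) t ^ (2 * k) = t ^ (2 * k)"
      by (intro eventually_sequentiallyI[of N]) (auto simp: g_def max_def min_def)
  qed
  have "incseq (\<lambda>i. LINT t|\<nu>. g (real (Suc i)) t ^ (2 * k))"
    by (intro incseq_SucI integral_mono ig inc) auto
  then obtain L where L: "(\<lambda>i. LINT t|\<nu>. g (real (Suc i)) t ^ (2 * k)) \<longlonglongrightarrow> L"
    using incseq_convergent[of _ S] gS by (metis of_nat_0_less_iff zero_less_Suc)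
  have i2: "integrable \<nu> (\<lambda>t. t ^ (2 * k))"
    by (rule integrable_monotone_convergence[OF _ _ _ L])
       (use inc glim in \<open>auto intro!: ig AE_I2 monoI\<close>)
  have e2: "(LINT t|\<nu>. t ^ (2 * k)) = L"
    by (rule integral_monotone_convergence[OF _ _ _ L])
       (use inc glim in \<open>auto intro!: ig AE_I2 monoI\<close>)
  have LS: "L \<le> S" by (rule LIMSEQ_le_const2[OF L]) (auto intro!: gS)
  have i1: "integrable \<nu> (\<lambda>t. t ^ k)"
  proof (rule Bochner_Integration.integrable_bound[where f="\<lambda>t. 1 + t ^ (2 * k)"])
    show "integrable \<nu> (\<lambda>t. 1 + t ^ (2 * k))" using i2 by auto
    have "\<bar>t ^ k\<bar> \<le> 1 + t ^ (2 * k)" for t :: real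
    proof -
      have "0 \<le> (\<bar>t ^ k\<bar> - 1)\<^sup>2 + (t ^ k)\<^sup>2" by simp
      then have "2 * \<bar>t ^ k\<bar> \<le> 1 + 2 * (t ^ k)\<^sup>2" by (simp add: power2_eq_square algebra_simps)
      moreover have "(t ^ k)\<^sup>2 = t ^ (2 * k)" by (simp add: power_mult mult.commute flip: power_mult)
      moreover have "0 \<le> (t ^ k)\<^sup>2" by simp
      ultimately show ?thesis by linarith
    qed
    then show "AE t in \<nu>. norm (t ^ k) \<le> norm (1 + t ^ (2 * k))"
      by (intro AE_I2) (auto intro: order_trans[OF _ abs_ge_self])
  qed auto
  have err: "\<bar>(LINT t|\<rho>. t ^ k) - (LINT t|\<rho>. g K t ^ k)\<bar> \<le> S / K ^ k"
    if r: "integrable \<rho> (\<lambda>t. t ^ k)" "integrable \<rho> (\<lambda>t. t ^ (2 * k))" "integrable \<rho> (\<lambda>t. g K t ^ k)"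
      and b: "(LINT t|\<rho>. t ^ (2 * k)) \<le> S" and K: "0 < K" for \<rho> K
  proof -
    have "\<bar>LINT t|\<rho>. t ^ k - g K t ^ k\<bar> \<le> (LINT t|\<rho>. \<bar>t ^ k - g K t ^ k\<bar>)"
      by (rule integral_abs_bound)
    also have "\<dots> \<le> (LINT t|\<rho>. t ^ (2 * k) / K ^ k)"
      using r clamp_power_error[OF K] unfolding g_def
      by (intro integral_mono) auto
    also have "\<dots> \<le> S / K ^ k" using b K by (simp add: divide_right_mono)
    finally show ?thesis using r by simp
  qed
  have main: "\<bar>m k - moment \<nu> k\<bar> \<le> 2 * S / K ^ k" if K: "0 < K" for K
  proof -
    have "(\<lambda>n. \<bar>moment (\<mu> n) k - (LINT t|\<mu> n. g K t ^ k)\<bar>) \<longlonglongrightarrow> \<bar>m k - (LINT t|\<nu>. g K t ^ k)\<bar>"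
      by (intro tendsto_intros lim gconv K)
    then have "\<bar>m k - (LINT t|\<nu>. g K t ^ k)\<bar> \<le> S / K ^ k"
      by (rule LIMSEQ_le_const2) (use S in \<open>auto intro!: err \<mu> ig K simp: moment_def\<close>)
    moreover have "\<bar>moment \<nu> k - (LINT t|\<nu>. g K t ^ k)\<bar> \<le> S / K ^ k"
      unfolding moment_def using LS e2 by (intro err i1 i2 ig K) auto
    ultimately show ?thesis by simp
  qed
  have "moment \<nu> k = m k"
  \<comment> \<open>At k = 0 the bound 2 S / K^k does not tend to 0; there both sides are total
    masses.\<close>
  proof (cases "k = 0")
    case True
    have "(\<lambda>n. moment (\<mu> n) k) = (\<lambda>n. 1)" using True m.prob_space by (simp add: moment_def)
    then have "m k = 1" using lim[of k] by (simp add: LIMSEQ_const_iff)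
    then show ?thesis using True n.prob_space by (simp add: moment_def)
  next
    case False
    have "(\<lambda>K. 2 * S * inverse (real (Suc K)) ^ k) \<longlonglongrightarrow> 2 * S * 0 ^ k"
      by (intro tendsto_intros LIMSEQ_inverse_real_of_nat)
    then have "(\<lambda>K. 2 * S / real (Suc K) ^ k) \<longlonglongrightarrow> 0"
      using False by (simp add: divide_inverse power_inverse power_0_left del: of_nat_Suc)
    then have "\<bar>m k - moment \<nu> k\<bar> \<le> 0"
      by (rule LIMSEQ_le_const) (use main in \<open>auto simp del: of_nat_Suc\<close>)
    then show ?thesis by simp
  qed
  with i1 show ?thesis by blast
qed

lemma tight_bounded_second_moment:
  assumes \<mu>: "\<And>n. real_distribution (\<mu> n)" "\<And>n k. integrable (\<mu> n) (\<lambda>t. t ^ k)"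
    and S: "\<And>n. moment (\<mu> n) 2 \<le> S"
  shows "tight \<mu>"
  unfolding tight_def
proof (intro conjI allI impI \<mu>(1))
  fix \<epsilon> :: real assume e: "0 < \<epsilon>"
  \<comment> \<open>With this K, Chebyshev's bound S / K^2 lies below \<epsilon>; the 1 added to |S|
    makes the inequality strict.\<close>
  define K where "K = sqrt ((\<bar>S\<bar> + 1) / \<epsilon>) + 1"
  have K0: "0 < K" using e by (auto simp: K_def intro: add_nonneg_pos)
  have "(\<bar>S\<bar> + 1) / \<epsilon> = (sqrt ((\<bar>S\<bar> + 1) / \<epsilon>))\<^sup>2" using e by (subst real_sqrt_pow2) auto
  also have "\<dots> \<le> K\<^sup>2" unfolding K_def by (intro power_mono) (use e in auto)
  finally have K2: "(\<bar>S\<bar> + 1) \<le> \<epsilon> * K\<^sup>2" using e by (simp add: field_simps)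
  have "1 - \<epsilon> < measure (\<mu> n) {- K - 1 <.. K}" for n
  proof -
    interpret real_distribution "\<mu> n" by fact
    have "prob {x \<in> space (\<mu> n). K\<^sup>2 \<le> x\<^sup>2} \<le> (LINT x|\<mu> n. x\<^sup>2) / K\<^sup>2"
      by (rule integral_Markov_inequality_measure[where A="{}"]) (use \<mu>(2)[of n 2] K0 in auto)
    also have "\<dots> \<le> S / K\<^sup>2" using S[of n] K0 by (simp add: moment_def divide_right_mono)
    also have "\<dots> < \<epsilon>" using K2 K0 by (simp add: divide_less_eq)
    finally have "prob {x \<in> space (\<mu> n). K\<^sup>2 \<le> x\<^sup>2} < \<epsilon>" .
    moreover have "prob (space (\<mu> n) - {- K - 1 <.. K}) \<le> prob {x \<in> space (\<mu> n). K\<^sup>2 \<le> x\<^sup>2}"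
    proof (rule finite_measure_mono)
      show "space (\<mu> n) - {- K - 1 <.. K} \<subseteq> {x \<in> space (\<mu> n). K\<^sup>2 \<le> x\<^sup>2}"
      proof (auto simp: not_le)
        fix x assume "\<not> - K - 1 < x" then show "K\<^sup>2 \<le> x\<^sup>2"
          using K0 power_mono[of K "- x" 2] by simp
      next
        fix x assume "K < x" then show "K\<^sup>2 \<le> x\<^sup>2" using K0 by (intro power_mono) auto
      qed
    qed auto
    ultimately show ?thesis using prob_compl[of "{- K - 1 <.. K}"] by auto
  qed
  then show "\<exists>a b. a < b \<and> (\<forall>n. 1 - \<epsilon> < measure (\<mu> n) {a<..b})"
    using K0 by (intro exI[of _ "- K - 1"] exI[of _ K]) auto
qed

lemma moment_bounded_imp_tight:
  assumes \<mu>: "\<And>n. real_distribution (\<mu> n)" "\<And>n k. integrable (\<mu> n) (\<lambda>t. t ^ k)"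
    and lim: "\<And>k. (\<lambda>n. moment (\<mu> n) k) \<longlonglongrightarrow> m k"
  shows "tight \<mu>"
proof -
  obtain S where "\<And>n. moment (\<mu> n) 2 \<le> S"
    using convergent_imp_Bseq[OF convergentI[OF lim[of 2]]] unfolding Bseq_def
    by (metis abs_le_D1 real_norm_def)
  from tight_bounded_second_moment[OF \<mu> this] show ?thesis .
qed

theorem method_of_moments_exists:
  assumes \<mu>: "\<And>n. real_distribution (\<mu> n)" "\<And>n k. integrable (\<mu> n) (\<lambda>t. t ^ k)"
    and lim: "\<And>k. (\<lambda>n. moment (\<mu> n) k) \<longlonglongrightarrow> m k"
  obtains \<nu> where "real_distribution \<nu>" "\<And>k. integrable \<nu> (\<lambda>t. t ^ k)" "\<And>k. moment \<nu> k = m k"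
proof -
  have "tight \<mu>" by (rule moment_bounded_imp_tight[OF \<mu> lim])
  from tight_imp_convergent_subsubsequence[OF this strict_mono_id] obtain r \<nu>
    where r: "strict_mono r" and \<nu>: "real_distribution \<nu>" "weak_conv_m (\<mu> \<circ> r) \<nu>" by auto
  have "(\<lambda>n. moment ((\<mu> \<circ> r) n) k) \<longlonglongrightarrow> m k" for k
    using LIMSEQ_subseq_LIMSEQ[OF lim r] by (simp add: comp_def)
  then have "integrable \<nu> (\<lambda>t. t ^ k) \<and> moment \<nu> k = m k" for k
    by (intro weak_conv_moment_limit[OF _ _ \<nu>]) (auto intro: \<mu>)
  then show thesis using \<nu>(1) by (intro that[of \<nu>]) auto
qed

text \<open>By tightness only weak limits of subsequences have to be identified; each of them has
  the moments \<open>m\<close>, and \<open>det\<close> applies.\<close>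

theorem method_of_moments_weak_conv:
  assumes \<mu>: "\<And>n. real_distribution (\<mu> n)" "\<And>n k. integrable (\<mu> n) (\<lambda>t. t ^ k)"
    and lim: "\<And>k. (\<lambda>n. moment (\<mu> n) k) \<longlonglongrightarrow> m k"
    and \<nu>: "real_distribution \<nu>"
    and det: "\<And>\<rho>. real_distribution \<rho> \<Longrightarrow> (\<And>k. integrable \<rho> (\<lambda>t. t ^ k)) \<Longrightarrow> (\<And>k. moment \<rho> k = m k) \<Longrightarrow> \<rho> = \<nu>"
  shows "weak_conv_m \<mu> \<nu>"
proof (rule tight_subseq_weak_converge[OF \<mu>(1) \<nu> moment_bounded_imp_tight[OF \<mu> lim]])
  fix s \<rho> assume s: "strict_mono s" "real_distribution \<rho>" "weak_conv_m (\<mu> \<circ> s) \<rho>"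
  have "(\<lambda>n. moment ((\<mu> \<circ> s) n) k) \<longlonglongrightarrow> m k" for k
    using LIMSEQ_subseq_LIMSEQ[OF lim s(1)] by (simp add: comp_def)
  then have "integrable \<rho> (\<lambda>t. t ^ k) \<and> moment \<rho> k = m k" for k
    by (intro weak_conv_moment_limit[OF _ _ s(2,3)]) (auto intro: \<mu>)
  then have "\<rho> = \<nu>" by (intro det s(2)) auto
  with s(3) show "weak_conv_m (\<mu> \<circ> s) \<nu>" by simp
qed

section \<open>Moments of the spectral distribution\<close>

text \<open>The Hermitian form \<open>S\<close> at an eigenvector is its own conjugate by symmetry,
  and it equals e times a nonzero squared norm.\<close>

lemma symmetric_complex_eigenvalue_real:
  fixes A :: "real mat"
  assumes A: "A \<in> carrier_mat n n" and sym: "\<And>i j. i < n \<Longrightarrow> j < n \<Longrightarrow> A $$ (i, j) = A $$ (j, i)"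
    and ev: "eigenvalue (map_mat complex_of_real A) e"
  shows "e \<in> \<real>"
proof -
  from ev A obtain v where v: "v \<in> carrier_vec n" "v \<noteq> 0\<^sub>v n"
    and Av: "map_mat complex_of_real A *\<^sub>v v = e \<cdot>\<^sub>v v"
    by (auto simp: eigenvalue_def eigenvector_def)
  define S where "S = (\<Sum>i<n. \<Sum>j<n. of_real (A $$ (i,j)) * v $ j * cnj (v $ i))"
  have row: "(\<Sum>j<n. of_real (A $$ (i,j)) * v $ j) = e * v $ i" if "i < n" for i
  proof -
    have "(map_mat complex_of_real A *\<^sub>v v) $ i = e * v $ i" using that v by (simp add: Av)
    then show ?thesis using that v A by (simp add: scalar_prod_def lessThan_atLeast0)
  qed
  have "S = (\<Sum>i<n. e * v $ i * cnj (v $ i))"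
    unfolding S_def by (intro sum.cong refl) (simp add: row flip: sum_distrib_right)
  also have "\<dots> = e * of_real (\<Sum>i<n. (cmod (v $ i))\<^sup>2)"
    by (simp add: sum_distrib_left mult.assoc complex_norm_square flip: of_real_power)
  finally have S1: "S = e * of_real (\<Sum>i<n. (cmod (v $ i))\<^sup>2)" .
  have "cnj S = (\<Sum>i<n. \<Sum>j<n. of_real (A $$ (j,i)) * cnj (v $ j) * v $ i)"
    unfolding S_def using sym by (auto intro!: sum.cong)
  also have "\<dots> = S" unfolding S_def by (subst sum.swap) (auto intro!: sum.cong)
  finally have "S \<in> \<real>" by (simp add: Reals_cnj_iff)
  moreover have "(\<Sum>i<n. (cmod (v $ i))\<^sup>2) \<noteq> 0"
  proof
    assume "(\<Sum>i<n. (cmod (v $ i))\<^sup>2) = 0"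
    then have "\<forall>i<n. v $ i = 0" by (subst (asm) sum_nonneg_eq_0_iff) auto
    then show False using v by (auto intro: eq_vecI)
  qed
  ultimately show ?thesis
    using S1 by (metis Reals_divide Reals_of_real nonzero_eq_divide_eq of_real_eq_0_iff)
qed

text \<open>The factorisation exists over the complex numbers; its roots are real, and it descends
  because the embedding of coefficients is injective.\<close>

lemma symmetric_char_poly_splits:
  fixes A :: "real mat"
  assumes A: "A \<in> carrier_mat n n" and sym: "\<And>i j. i < n \<Longrightarrow> j < n \<Longrightarrow> A $$ (i, j) = A $$ (j, i)"
  obtains es where "char_poly A = (\<Prod>e\<leftarrow>es. [:- e, 1:])" "length es = n"
proof -
  let ?A = "map_mat complex_of_real A"
  have A': "?A \<in> carrier_mat n n" using A by simp
  from char_poly_factorized[OF A'] obtain as where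
    as: "char_poly ?A = (\<Prod>a\<leftarrow>as. [:- a, 1:])" "length as = n" by auto
  have "a \<in> \<real>" if "a \<in> set as" for a
  proof (rule symmetric_complex_eigenvalue_real[OF A sym])
    show "eigenvalue ?A a"
      unfolding eigenvalue_root_char_poly[OF A'] as(1) poly_prod_list
      using that by (auto simp: prod_list_zero_iff)
  qed
  then have "map (\<lambda>a. complex_of_real (Re a)) as = as"
    by (intro map_idI) (auto elim: Reals_cases)
  then have es: "as = map complex_of_real (map Re as)" by (simp add: comp_def)
  define es where "es = map Re as"
  have es: "as = map complex_of_real es" unfolding es_def by (rule es)
  interpret cpoly: map_poly_inj_comm_ring_hom complex_of_real ..
  have "map_poly complex_of_real (char_poly A) = char_poly ?A"
    by (rule of_real_hom.char_poly_hom[OF A, symmetric])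
  also have "\<dots> = map_poly complex_of_real (\<Prod>e\<leftarrow>es. [:- e, 1:])"
    unfolding as(1) es cpoly.hom_prod_list map_map by (simp add: comp_def)
  finally have "char_poly A = (\<Prod>e\<leftarrow>es. [:- e, 1:])" by simp
  with as(2) es show thesis by (intro that[of es]) auto
qed

section \<open>Traces of powers and the moments of the spectral distribution\<close>

definition trace_mat :: "'a::comm_ring_1 mat \<Rightarrow> 'a" where
  "trace_mat A = (\<Sum>i<dim_row A. A $$ (i, i))"

lemma trace_mat_mult_commute:
  assumes "A \<in> carrier_mat n m" "B \<in> carrier_mat m n"
  shows "trace_mat (A * B) = trace_mat (B * A)"
proof -
  have "trace_mat (A * B) = (\<Sum>i<n. \<Sum>j<m. A $$ (i,j) * B $$ (j,i))"
    using assms by (auto simp: trace_mat_def scalar_prod_def lessThan_atLeast0 intro!: sum.cong)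
  also have "\<dots> = (\<Sum>j<m. \<Sum>i<n. B $$ (j,i) * A $$ (i,j))" by (subst sum.swap) (simp add: mult.commute)
  also have "\<dots> = trace_mat (B * A)"
    using assms by (auto simp: trace_mat_def scalar_prod_def lessThan_atLeast0 intro!: sum.cong)
  finally show ?thesis .
qed

lemma upper_triangular_pow:
  fixes B :: "'a::comm_ring_1 mat"
  assumes B: "B \<in> carrier_mat n n" and u: "upper_triangular B"
  shows "(\<forall>i<n. (B ^\<^sub>m k) $$ (i, i) = (B $$ (i, i)) ^ k) \<and> (\<forall>i<n. \<forall>j<i. (B ^\<^sub>m k) $$ (i, j) = 0)"
proof (induction k)
  case 0
  then show ?case using B by auto
next
  case (Suc k)
  have Bk: "B ^\<^sub>m k \<in> carrier_mat n n" using B by simp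
  have e: "(B ^\<^sub>m Suc k) $$ (i, j) = (\<Sum>l<n. (B ^\<^sub>m k) $$ (i, l) * B $$ (l, j))" if "i < n" "j < n" for i j
    using that B Bk by (simp add: scalar_prod_def lessThan_atLeast0)
  have u': "B $$ (l, j) = 0" if "j < l" "l < n" for l j using u that B by auto
  show ?case
  proof (intro conjI allI impI)
    fix i assume i: "i < n"
    have "(B ^\<^sub>m Suc k) $$ (i, i) = (\<Sum>l<n. if l = i then (B ^\<^sub>m k) $$ (i, i) * B $$ (i, i) else 0)"
      unfolding e[OF i i]
    proof (intro sum.cong refl)
      fix l assume "l \<in> {..<n}"
      then show "(B ^\<^sub>m k) $$ (i, l) * B $$ (l, i) = (if l = i then (B ^\<^sub>m k) $$ (i, i) * B $$ (i, i) else 0)"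
        using Suc i u'[of i l] by (cases l i rule: linorder_cases) auto
    qed
    also have "\<dots> = B $$ (i, i) ^ Suc k" using Suc i by (simp add: mult.commute)
    finally show "(B ^\<^sub>m Suc k) $$ (i, i) = B $$ (i, i) ^ Suc k" .
  next
    fix i j assume i: "i < n" "j < i"
    show "(B ^\<^sub>m Suc k) $$ (i, j) = 0"
      unfolding e[OF i(1) less_trans[OF i(2,1)]]
    proof (intro sum.neutral ballI)
      fix l assume "l \<in> {..<n}"
      then show "(B ^\<^sub>m k) $$ (i, l) * B $$ (l, j) = 0"
        using Suc i u'[of j l] by (cases "l < i") auto
    qed
  qed
qed

text \<open>Schur triangularisation gives a similar triangular matrix with the roots on its
  diagonal, multiplicities included, and the trace is invariant under similarity.\<close>

lemma trace_pow_eq_sum_list: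
  fixes A :: "real mat"
  assumes A: "A \<in> carrier_mat n n" and c: "char_poly A = (\<Prod>e\<leftarrow>es. [:- e, 1:])"
  shows "trace_mat (A ^\<^sub>m k) = (\<Sum>e\<leftarrow>es. e ^ k)"
proof -
  obtain B P Q where s: "schur_decomposition A es = (B, P, Q)" by (cases "schur_decomposition A es") auto
  from schur_decomposition[OF A c s] have w: "similar_mat_wit A B P Q" and u: "upper_triangular B"
    and d: "diag_mat B = es" by auto
  from similar_mat_witD2[OF A w] have PQ: "Q * P = 1\<^sub>m n" "P \<in> carrier_mat n n" "Q \<in> carrier_mat n n"
    and B: "B \<in> carrier_mat n n" by auto
  have Bk: "B ^\<^sub>m k \<in> carrier_mat n n" using B by simp
  have "trace_mat (A ^\<^sub>m k) = trace_mat (P * B ^\<^sub>m k * Q)" by (simp add: similar_mat_wit_pow_id[OF w])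
  also have "\<dots> = trace_mat (Q * (P * B ^\<^sub>m k))" using PQ Bk by (intro trace_mat_mult_commute[of _ n n]) auto
  also have "Q * (P * B ^\<^sub>m k) = B ^\<^sub>m k"
    using assoc_mult_mat[OF PQ(3,2) Bk] left_mult_one_mat[OF Bk] PQ(1) by simp
  also have "trace_mat (B ^\<^sub>m k) = (\<Sum>i<n. B $$ (i, i) ^ k)"
    unfolding trace_mat_def using upper_triangular_pow[OF B u, of k] B Bk by auto
  also have "\<dots> = (\<Sum>e\<leftarrow>es. e ^ k)"
    unfolding d[symmetric] diag_mat_def using B by (simp add: comp_def interv_sum_list_conv_sum_set_nat lessThan_atLeast0)
  finally show ?thesis .
qed

text \<open>Free of hypotheses on purpose: for n = 0 there are no roots and the law is unspecified,
  but it is still a probability law, and facts about weak limits quantify over all n.\<close>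

lemma real_distribution_esd [simp, intro]: "real_distribution (esd A)"
  unfolding esd_def by (intro real_distribution.intro prob_space.prob_space_distr)
     (auto simp: real_distribution_axioms_def measure_pmf.prob_space_axioms)

lemma sum_count_list_superset:
  fixes f :: "'a \<Rightarrow> real"
  assumes "finite S" "set xs \<subseteq> S"
  shows "(\<Sum>a\<in>S. f a * real (count_list xs a)) = (\<Sum>x\<leftarrow>xs. f x)"
  using assms(2)
proof (induction xs)
  case (Cons x xs)
  have "(\<Sum>a\<in>S. f a * real (count_list (x # xs) a)) =
        (\<Sum>a\<in>S. (if a = x then f a else 0) + f a * real (count_list xs a))"
    by (intro sum.cong) (auto simp: algebra_simps)
  also have "\<dots> = f x + (\<Sum>y\<leftarrow>xs. f y)"
    using Cons assms(1) by (simp add: sum.distrib)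
  finally show ?case by simp
qed simp

lemma esd_moment:
  fixes A :: "real mat"
  assumes A: "A \<in> carrier_mat n n" and sym: "\<And>i j. i < n \<Longrightarrow> j < n \<Longrightarrow> A $$ (i, j) = A $$ (j, i)"
    and n: "0 < n"
  shows "moment (esd A) k = trace_mat (A ^\<^sub>m k) / real n"
    and "integrable (esd A) (\<lambda>t. t ^ k)"
proof -
  from symmetric_char_poly_splits[OF A sym] obtain es where
    c: "char_poly A = (\<Prod>e\<leftarrow>es. [:- e, 1:])" and l: "length es = n" by blast
  have "proots (\<Prod>e\<leftarrow>es. [:- e, 1:]) = mset es"
  proof (induction es)
    case (Cons a es)
    have "proots ([:- a, 1:] * (\<Prod>e\<leftarrow>es. [:- e, 1:])) = proots [:- a, 1:] + proots (\<Prod>e\<leftarrow>es. [:- e, 1:])"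
      by (rule proots_mult) (auto simp: prod_list_zero_iff)
    then show ?case using Cons by (simp del: mult_pCons_left)
  qed simp
  then have r: "proots (char_poly A) = mset es" by (simp add: c)
  have ne: "mset es \<noteq> {#}" using l n by auto
  let ?p = "pmf_of_multiset (mset es)"
  have fin: "finite (set_pmf ?p)" using ne by simp
  show "integrable (esd A) (\<lambda>t. t ^ k)"
    unfolding esd_def r by (subst integrable_distr_eq) (auto intro!: integrable_measure_pmf_finite fin)
  have "moment (esd A) k = measure_pmf.expectation ?p (\<lambda>t. t ^ k)"
    unfolding moment_def esd_def r by (subst integral_distr) auto
  also have "\<dots> = (\<Sum>a\<in>set es. a ^ k * pmf ?p a)"
    by (rule integral_measure_pmf_real) (use ne in auto)
  also have "\<dots> = (\<Sum>a\<in>set es. a ^ k * count (mset es) a) / n"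
    using ne l by (simp add: sum_divide_distrib)
  also have "(\<Sum>a\<in>set es. a ^ k * count (mset es) a) = (\<Sum>e\<leftarrow>es. e ^ k)"
    by (simp add: sum_count_list_superset count_mset)
  also have "\<dots> = trace_mat (A ^\<^sub>m k)" by (rule trace_pow_eq_sum_list[OF A c, symmetric])
  finally show "moment (esd A) k = trace_mat (A ^\<^sub>m k) / real n" .
qed

section \<open>Powers of matrices as sums over walks\<close>

abbreviation words :: "nat \<Rightarrow> nat \<Rightarrow> (nat \<Rightarrow> nat) set" where
  "words p n \<equiv> {..<p} \<rightarrow>\<^sub>E {..<n}"

text \<open>The last step stays outside the product, so a word records only the p+1 vertices that
  the walk leaves. For closed walks the return to \<open>w 0\<close> then needs no letter.\<close>

lemma mat_pow_eq_sum_walks: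
  fixes A :: "'a::comm_ring_1 mat"
  assumes A: "A \<in> carrier_mat n n" and "i < n" "j < n"
  shows "(A ^\<^sub>m Suc p) $$ (i, j) =
    (\<Sum>w | w \<in> {..<Suc p} \<rightarrow>\<^sub>E {..<n} \<and> w 0 = i. (\<Prod>t<p. A $$ (w t, w (Suc t))) * A $$ (w p, j))"
  using assms(3)
proof (induction p arbitrary: j)
  case 0
  have "{w. w \<in> {..<Suc 0} \<rightarrow>\<^sub>E {..<n} \<and> w 0 = i} = {\<lambda>t\<in>{..<Suc 0}. i}"
    using assms(2) by (auto simp: PiE_def extensional_def fun_eq_iff)
  then show ?case using A by simp
next
  case (Suc p)
  let ?W = "\<lambda>p. {w. w \<in> {..<Suc p} \<rightarrow>\<^sub>E {..<n} \<and> w 0 = i}"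
  have Ap: "A ^\<^sub>m Suc p \<in> carrier_mat n n" by (rule pow_carrier_mat[OF A])
  have "(A ^\<^sub>m Suc (Suc p)) $$ (i, j) = (\<Sum>l<n. (A ^\<^sub>m Suc p) $$ (i, l) * A $$ (l, j))"
    using A Ap assms(2) Suc.prems by (subst pow_mat.simps) (simp add: scalar_prod_def lessThan_atLeast0 del: pow_mat.simps)
  also have "\<dots> = (\<Sum>l<n. \<Sum>w\<in>?W p. (\<Prod>t<p. A $$ (w t, w (Suc t))) * A $$ (w p, l) * A $$ (l, j))"
    by (intro sum.cong refl) (simp only: Suc.IH lessThan_iff sum_distrib_right)
  also have "\<dots> = (\<Sum>(l,w)\<in>{..<n} \<times> ?W p. (\<Prod>t<p. A $$ (w t, w (Suc t))) * A $$ (w p, l) * A $$ (l, j))"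
    by (rule sum.cartesian_product)
  also have "\<dots> = (\<Sum>w\<in>?W (Suc p). (\<Prod>t<Suc p. A $$ (w t, w (Suc t))) * A $$ (w (Suc p), j))"
  proof (rule sum.reindex_bij_witness[where j="\<lambda>(l,w). w(Suc p := l)" and i="\<lambda>w. (w (Suc p), restrict w {..<Suc p})"], goal_cases)
    case (1 a)
    then show ?case by (auto simp: PiE_def extensional_def fun_eq_iff less_Suc_eq)
  next
    case (2 a)
    then show ?case by (auto simp: PiE_def extensional_def Pi_def less_Suc_eq)
  next
    case (3 b)
    then show ?case by (auto simp: PiE_def extensional_def fun_eq_iff less_Suc_eq)
  next
    case (4 b)
    then show ?case by (auto simp: PiE_def Pi_def)
  next
    case (5 a)
    then obtain l w where a: "a = (l, w)" "l < n" "w \<in> ?W p" by auto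
    have "(\<Prod>t<p. A $$ ((w(Suc p := l)) t, (w(Suc p := l)) (Suc t))) = (\<Prod>t<p. A $$ (w t, w (Suc t)))"
      by (intro prod.cong) auto
    then show ?case by (simp add: a)
  qed
  finally show ?case .
qed

lemma trace_pow_eq_sum_closed_walks:
  fixes A :: "'a::comm_ring_1 mat"
  assumes A: "A \<in> carrier_mat n n" and p: "0 < p"
  shows "trace_mat (A ^\<^sub>m p) = (\<Sum>w\<in>words p n. \<Prod>t<p. A $$ (w t, w (Suc t mod p)))"
proof -
  from p obtain q where q: "p = Suc q" by (cases p) auto
  let ?f = "\<lambda>w. \<Prod>t<p. A $$ (w t, w (Suc t mod p))"
  have fin: "finite (words p n)" by (intro finite_PiE) auto
  have "trace_mat (A ^\<^sub>m p) = (\<Sum>i<n. (A ^\<^sub>m Suc q) $$ (i, i))"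
    using A by (simp add: trace_mat_def q)
  also have "\<dots> = (\<Sum>i<n. \<Sum>w | w \<in> words p n \<and> w 0 = i. ?f w)"
  proof (intro sum.cong refl)
    fix i assume i: "i \<in> {..<n}"
    have "?f w = (\<Prod>t<q. A $$ (w t, w (Suc t))) * A $$ (w q, w 0)" for w
      by (simp add: q)
    then show "(A ^\<^sub>m Suc q) $$ (i, i) = (\<Sum>w | w \<in> words p n \<and> w 0 = i. ?f w)"
      using i by (subst mat_pow_eq_sum_walks[OF A]) (auto simp: q simp del: pow_mat.simps intro!: sum.cong)
  qed
  also have "\<dots> = (\<Sum>w\<in>words p n. ?f w)"
    by (rule sum.group[OF fin]) (use p in auto)
  finally show ?thesis .
qed

section \<open>Closed walks\<close>

text \<open>An unordered pair in increasing order: shifted by one, it is the index of the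
  corresponding variable in the upper triangular array. Loops are allowed.\<close>

definition edge :: "nat \<Rightarrow> nat \<Rightarrow> nat \<times> nat" where
  "edge a b = (min a b, max a b)"

lemma edge_eq_iff: "edge a b = edge c d \<longleftrightarrow> {a, b} = {c, d}"
  by (auto simp: edge_def min_def max_def doubleton_eq_iff)

lemma edge_endpoints: "{fst (edge a b), snd (edge a b)} = {a, b}"
  by (auto simp: edge_def min_def max_def)

abbreviation walk_edge :: "(nat \<Rightarrow> nat) \<Rightarrow> nat \<Rightarrow> nat \<times> nat" where
  "walk_edge u t \<equiv> edge (u t) (u (Suc t))"

abbreviation walk_edges :: "(nat \<Rightarrow> nat) \<Rightarrow> nat \<Rightarrow> (nat \<times> nat) set" where
  "walk_edges u m \<equiv> walk_edge u ` {..<m}"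

text \<open>A step to a new vertex uses an edge with an end outside everything seen so far, hence a
  new edge, so vertices never gain on edges. Starting from an arbitrary graph allows several walks
  to be glued together.\<close>

lemma walk_excess:
  assumes "finite V" "finite E" and E: "\<And>a b. (a, b) \<in> E \<Longrightarrow> a \<in> V \<and> b \<in> V"
    and u0: "u 0 \<in> V"
  shows "card (V \<union> u ` {..m}) + card E \<le> card V + card (E \<union> walk_edges u m)"
proof (induction m)
  case 0
  then show ?case using u0 by (simp add: insert_absorb)
next
  case (Suc m)
  let ?V = "V \<union> u ` {..m}" and ?E = "E \<union> walk_edges u m"
  have fin: "finite ?V" "finite ?E" using assms by auto
  have V: "V \<union> u ` {..Suc m} = insert (u (Suc m)) ?V" by (auto simp: atMost_Suc)
  have E': "E \<union> walk_edges u (Suc m) = insert (walk_edge u m) ?E" by (auto simp: lessThan_Suc)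
  show ?case
  proof (cases "u (Suc m) \<in> ?V")
    case True
    then have V': "insert (u (Suc m)) ?V = ?V" by (rule insert_absorb)
    show ?thesis unfolding V V' E' using Suc card_insert_le[of ?E "walk_edge u m"] by linarith
  next
    case False
    have "walk_edge u m \<notin> ?E"
    proof
      assume "walk_edge u m \<in> ?E"
      then have "{fst (walk_edge u m), snd (walk_edge u m)} \<subseteq> ?V"
      proof
        assume "walk_edge u m \<in> E"
        then show ?thesis using E[of "fst (walk_edge u m)" "snd (walk_edge u m)"] by auto
      next
        assume "walk_edge u m \<in> walk_edges u m"
        then obtain s where "s < m" "walk_edge u m = walk_edge u s" by auto
        then show ?thesis using edge_endpoints[of "u s" "u (Suc s)"] by auto
      qed
      then show False using False unfolding edge_endpoints by auto
    qed
    then show ?thesis unfolding V E' using Suc False fin by simp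
  qed
qed

text \<open>Equality in \<open>walk_card_le\<close>. The graph traced by a walk is connected, and
  for connected graphs this count characterises trees.\<close>

definition walk_tree :: "(nat \<Rightarrow> nat) \<Rightarrow> nat \<Rightarrow> bool" where
  "walk_tree u m \<longleftrightarrow> card (u ` {..m}) = card (walk_edges u m) + 1"

lemma walk_card_le: "card (u ` {..m}) \<le> card (walk_edges u m) + 1"
proof -
  have "{u 0} \<union> u ` {..m} = u ` {..m}" by auto
  then show ?thesis using walk_excess[of "{u 0}" "{}" u m] by simp
qed

lemma walk_edge_new:
  assumes "u (Suc m) \<notin> u ` {..m}" "t < m"
  shows "walk_edge u t \<noteq> walk_edge u m"
proof
  assume "walk_edge u t = walk_edge u m"
  then have "u (Suc m) \<in> {u t, u (Suc t)}" by (auto simp: edge_eq_iff doubleton_eq_iff)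
  then show False using assms by auto
qed

text \<open>A step changes v - e only when it reaches an old vertex along a new edge, and that loss
  can never be made up. In a tree walk, vertices and edges are therefore new at the same
  steps.\<close>

lemma walk_tree_Suc:
  assumes "walk_tree u (Suc m)"
  shows "walk_tree u m" and "u (Suc m) \<in> u ` {..m} \<longleftrightarrow> walk_edge u m \<in> walk_edges u m"
proof -
  have V: "u ` {..Suc m} = insert (u (Suc m)) (u ` {..m})" by (auto simp: atMost_Suc)
  have E: "walk_edges u (Suc m) = insert (walk_edge u m) (walk_edges u m)" by (auto simp: lessThan_Suc)
  \<comment> \<open>\<open>P\<close> and \<open>Q\<close> say that the vertex and the edge are old;
    the case of an old vertex with a new edge would force a = b + 2.\<close>
  have key: "a = b + 1 \<and> (P \<longleftrightarrow> Q)"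
    if "(if P then a else Suc a) = (if Q then b else Suc b) + 1" "a \<le> b + 1" "\<not> P \<Longrightarrow> \<not> Q" for P Q and a b :: nat
    using that by (cases P; cases Q) auto
  have "card (u ` {..m}) = card (walk_edges u m) + 1 \<and>
      (u (Suc m) \<in> u ` {..m} \<longleftrightarrow> walk_edge u m \<in> walk_edges u m)"
  proof (rule key)
    show "(if u (Suc m) \<in> u ` {..m} then card (u ` {..m}) else Suc (card (u ` {..m}))) =
      (if walk_edge u m \<in> walk_edges u m then card (walk_edges u m)
        else Suc (card (walk_edges u m))) + 1"
      using assms unfolding walk_tree_def V E
        card_insert_if[OF finite_imageI[OF finite_atMost]] card_insert_if[OF finite_imageI[OF finite_lessThan]] .
    show "card (u ` {..m}) \<le> card (walk_edges u m) + 1" by (rule walk_card_le)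
    show "walk_edge u m \<notin> walk_edges u m" if "u (Suc m) \<notin> u ` {..m}"
    proof (rule notI, elim imageE)
      fix t assume "walk_edge u m = walk_edge u t" "t \<in> {..<m}"
      then show False using walk_edge_new[OF that, of t] by simp
    qed
  qed
  then show "walk_tree u m" "u (Suc m) \<in> u ` {..m} \<longleftrightarrow> walk_edge u m \<in> walk_edges u m"
    unfolding walk_tree_def by (rule conjunct1, rule conjunct2)
qed

text \<open>Deleting an edge of a tree disconnects it; \<open>g\<close> colours the two sides.\<close>

lemma walk_tree_cut:
  assumes "walk_tree u m" "e \<in> walk_edges u m"
  shows "\<exists>g::nat \<Rightarrow> bool. \<forall>t<m. g (u t) \<noteq> g (u (Suc t)) \<longleftrightarrow> walk_edge u t = e"
  using assms
proof (induction m)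
  case (Suc m)
  note tree = walk_tree_Suc[OF Suc.prems(1)]
  show ?case
  proof (cases "u (Suc m) \<in> u ` {..m}")
    case True
    then obtain s where s: "s < m" "walk_edge u m = walk_edge u s" using tree by auto
    then have "e \<in> walk_edges u m" using Suc.prems(2) by (auto simp: lessThan_Suc)
    with Suc.IH tree obtain g :: "nat \<Rightarrow> bool" where g: "\<forall>t<m. g (u t) \<noteq> g (u (Suc t)) \<longleftrightarrow> walk_edge u t = e" by blast
    have "g (u m) \<noteq> g (u (Suc m)) \<longleftrightarrow> g (u s) \<noteq> g (u (Suc s))"
      using s(2) by (auto simp: edge_eq_iff doubleton_eq_iff)
    then show ?thesis using g s by (intro exI[of _ g]) (auto simp: less_Suc_eq)
  next
    case False
    have inV: "u t \<noteq> u (Suc m)" if "t \<le> m" for t using False that by (metis atMost_iff imageI)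
    show ?thesis
    proof (cases "e = walk_edge u m")
      case True
      then show ?thesis using inV walk_edge_new[OF False]
        by (intro exI[of _ "\<lambda>v. v = u (Suc m)"]) (auto simp: less_Suc_eq)
    next
      case ne: False
      then have "e \<in> walk_edges u m" using Suc.prems(2) by (auto simp: lessThan_Suc)
      with Suc.IH tree obtain g :: "nat \<Rightarrow> bool" where g: "\<forall>t<m. g (u t) \<noteq> g (u (Suc t)) \<longleftrightarrow> walk_edge u t = e" by blast
      \<comment> \<open>A new leaf attached by another edge takes the colour of its neighbour, so
        its own edge is not cut.\<close>
      let ?g = "g(u (Suc m) := g (u m))"
      have "?g (u t) = g (u t)" if "t \<le> m" for t using inV[OF that] by simp
      then show ?thesis using g ne inV[of m] by (intro exI[of _ ?g]) (auto simp: less_Suc_eq)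
    qed
  qed
qed simp

lemma even_colour_changes:
  fixes g :: "nat \<Rightarrow> bool"
  shows "even (card {t. t < m \<and> g (u t) \<noteq> g (u (Suc t))}) \<longleftrightarrow> g (u 0) = g (u m)"
proof (induction m)
  case (Suc m)
  have "{t. t < Suc m \<and> g (u t) \<noteq> g (u (Suc t))} =
     (if g (u m) \<noteq> g (u (Suc m)) then insert m else id) {t. t < m \<and> g (u t) \<noteq> g (u (Suc t))}"
    by (auto simp: less_Suc_eq)
  then show ?case using Suc by auto
qed simp

text \<open>Each traversal of \<open>e\<close> crosses the cut given by
  \<open>walk_tree_cut\<close>, and a closed walk must end on the side where it began.\<close>

lemma closed_walk_tree_even:
  assumes "walk_tree u m" "u m = u 0"
  shows "even (card {t. t < m \<and> walk_edge u t = e})"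
proof (cases "e \<in> walk_edges u m")
  case True
  from walk_tree_cut[OF assms(1) True] obtain g :: "nat \<Rightarrow> bool"
    where g: "\<forall>t<m. g (u t) \<noteq> g (u (Suc t)) \<longleftrightarrow> walk_edge u t = e" by blast
  have eq: "{t. t < m \<and> walk_edge u t = e} = {t. t < m \<and> g (u t) \<noteq> g (u (Suc t))}"
    by (rule Collect_cong) (use g in blast)
  show ?thesis unfolding eq even_colour_changes assms(2) ..
next
  case False
  then have eq: "{t. t < m \<and> walk_edge u t = e} = {}" by blast
  show ?thesis unfolding eq by simp
qed

text \<open>The cut colouring for the edge at step t gives its two ends different colours.\<close>

lemma walk_tree_no_loop:
  assumes "walk_tree u m" "t < m"
  shows "u t \<noteq> u (Suc t)"
proof -
  obtain g :: "nat \<Rightarrow> bool" where "\<forall>s<m. g (u s) \<noteq> g (u (Suc s)) \<longleftrightarrow> walk_edge u s = walk_edge u t"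
    using walk_tree_cut[OF assms(1), of "walk_edge u t"] assms(2) by blast
  with assms(2) show ?thesis by metis
qed

lemma doubleton_eq_other:
  assumes "{a, b} = {c, d}"
  shows "a = c \<Longrightarrow> b = d" and "a \<noteq> c \<Longrightarrow> b = c"
  using assms by (auto simp: doubleton_eq_iff)

text \<open>A new edge leads to a new vertex. A repeated edge leads to whichever of its old ends the
  walk is not at, and which one that is follows from earlier coincidences. So the coincidences among
  edges determine those among vertices.\<close>

lemma walk_tree_kernel:
  assumes "walk_tree u m" "walk_tree v m"
    and "\<And>s t. s < m \<Longrightarrow> t < m \<Longrightarrow> walk_edge u s = walk_edge u t \<longleftrightarrow> walk_edge v s = walk_edge v t"
    and "s \<le> m" "t \<le> m"
  shows "u s = u t \<longleftrightarrow> v s = v t"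
  using assms
proof (induction m arbitrary: s t)
  case (Suc m)
  note tu = walk_tree_Suc[OF Suc.prems(1)] and tv = walk_tree_Suc[OF Suc.prems(2)]
  have IH: "u s = u t \<longleftrightarrow> v s = v t" if "s \<le> m" "t \<le> m" for s t
    using Suc.IH[OF tu(1) tv(1) Suc.prems(3)] that by simp
  have new: "u (Suc m) = u s \<longleftrightarrow> v (Suc m) = v s" if s: "s \<le> m" for s
  proof (cases "walk_edge u m \<in> walk_edges u m")
    case True
    then obtain r where r: "r < m" "walk_edge u m = walk_edge u r" by auto
    then have "walk_edge v m = walk_edge v r" using Suc.prems(3)[of m r] by simp
    then have ev: "{v m, v (Suc m)} = {v r, v (Suc r)}" and eu: "{u m, u (Suc m)} = {u r, u (Suc r)}"
      using r(2) by (auto simp: edge_eq_iff)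
    show ?thesis
    proof (cases "u m = u r")
      case True
      then have "v m = v r" using IH[of m r] r by simp
      with True have "u (Suc m) = u (Suc r)" "v (Suc m) = v (Suc r)"
        using doubleton_eq_other(1)[OF eu] doubleton_eq_other(1)[OF ev] by simp_all
      then show ?thesis using IH[of "Suc r" s] r s by auto
    next
      case False
      then have "v m \<noteq> v r" using IH[of m r] r by simp
      with False have "u (Suc m) = u r" "v (Suc m) = v r"
        using doubleton_eq_other(2)[OF eu] doubleton_eq_other(2)[OF ev] by simp_all
      then show ?thesis using IH[of r s] r s by auto
    qed
  next
    case False
    have "walk_edge v m \<notin> walk_edges v m"
    proof
      assume "walk_edge v m \<in> walk_edges v m"
      then obtain r where "r < m" "walk_edge v m = walk_edge v r" by auto
      then have "walk_edge u m = walk_edge u r" using Suc.prems(3)[of m r] by simp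
      with \<open>r < m\<close> False show False by auto
    qed
    with False tu(2) tv(2) have "u (Suc m) \<notin> u ` {..m}" "v (Suc m) \<notin> v ` {..m}" by auto
    with s show ?thesis by (metis atMost_iff imageI)
  qed
  consider "s \<le> m" "t \<le> m" | "s = Suc m" "t \<le> m" | "s \<le> m" "t = Suc m" | "s = t"
    using Suc.prems(4,5) by linarith
  then show ?case
  proof cases
    case 3
    then show ?thesis using new[of s] by metis
  qed (use IH new in auto)
qed simp

section \<open>Closed walks as cyclic words, and unions of several of them\<close>

definition cyc_edge :: "nat \<Rightarrow> (nat \<Rightarrow> nat) \<Rightarrow> nat \<Rightarrow> nat \<times> nat" where
  "cyc_edge p w t = edge (w t) (w (Suc t mod p))"

abbreviation cyc_edges :: "nat \<Rightarrow> (nat \<Rightarrow> nat) \<Rightarrow> (nat \<times> nat) set" where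
  "cyc_edges p w \<equiv> cyc_edge p w ` {..<p}"

lemma cyc_edge_eq_walk_edge:
  assumes "t < p"
  shows "cyc_edge p w t = walk_edge (\<lambda>t. w (t mod p)) t"
  using assms by (simp add: cyc_edge_def)

lemma cyc_image:
  assumes "0 < (p::nat)"
  shows "(\<lambda>t. w (t mod p)) ` {..p} = w ` {..<p}"
proof
  show "(\<lambda>t. w (t mod p)) ` {..p} \<subseteq> w ` {..<p}" using assms by auto
  show "w ` {..<p} \<subseteq> (\<lambda>t. w (t mod p)) ` {..p}"
  proof
    fix v assume "v \<in> w ` {..<p}"
    then obtain t where "t < p" "v = w t" by auto
    then show "v \<in> (\<lambda>t. w (t mod p)) ` {..p}" by (intro image_eqI[of _ _ t]) auto
  qed
qed

text \<open>A closed walk may be rotated so as to start at its vertex in \<open>V\<close>, where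
  \<open>walk_excess\<close> applies.\<close>

lemma closed_walk_excess:
  assumes "finite V" "finite E" and E: "\<And>a b. (a, b) \<in> E \<Longrightarrow> a \<in> V \<and> b \<in> V"
    and t0: "t0 < p" "w t0 \<in> V"
  shows "card (V \<union> w ` {..<p}) + card E \<le> card V + card (E \<union> cyc_edges p w)"
proof -
  define u where "u t = w ((t0 + t) mod p)" for t
  have p: "0 < p" using t0 by simp
  have "w ` {..<p} \<subseteq> u ` {..p}"
  proof
    fix v assume "v \<in> w ` {..<p}"
    then obtain t where t: "t < p" "v = w t" by auto
    show "v \<in> u ` {..p}"
    proof (cases "t0 \<le> t")
      case True
      then show ?thesis using t by (intro image_eqI[of _ _ "t - t0"]) (auto simp: u_def)
    next
      case False
      then show ?thesis using t t0 by (intro image_eqI[of _ _ "t + p - t0"]) (auto simp: u_def)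
    qed
  qed
  moreover have "u ` {..p} \<subseteq> w ` {..<p}" using p by (auto simp: u_def)
  ultimately have 1: "u ` {..p} = w ` {..<p}" by blast
  have 2: "walk_edges u p \<subseteq> cyc_edges p w"
  proof
    fix e assume "e \<in> walk_edges u p"
    then obtain t where "e = walk_edge u t" by auto
    then have "e = cyc_edge p w ((t0 + t) mod p)" by (simp add: u_def cyc_edge_def mod_Suc_eq)
    then show "e \<in> cyc_edges p w" using p by auto
  qed
  have "card (V \<union> u ` {..p}) + card E \<le> card V + card (E \<union> walk_edges u p)"
    using t0 by (intro walk_excess assms) (auto simp: u_def)
  also have "card (E \<union> walk_edges u p) \<le> card (E \<union> cyc_edges p w)"
    using 2 assms(2) by (intro card_mono) auto
  finally show ?thesis using 1 by simp
qed

text \<open>The number \<open>k\<close> plays the role of a bound on the number of components, which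
  v - e never exceeds. A walk that meets the graph keeps \<open>k\<close>; an arbitrary walk raises
  it by one.\<close>

definition excess_le :: "nat \<Rightarrow> nat set \<Rightarrow> (nat \<times> nat) set \<Rightarrow> bool" where
  "excess_le k V E \<longleftrightarrow> finite V \<and> finite E \<and> (\<forall>(a, b)\<in>E. a \<in> V \<and> b \<in> V) \<and> card V \<le> card E + k"

lemma cyc_edge_endpoints:
  assumes "t < p" "cyc_edge p w t = (a, b)"
  shows "a \<in> w ` {..<p}" "b \<in> w ` {..<p}"
proof -
  have "Suc t mod p < p" using assms(1) by simp
  moreover have "{a, b} = {w t, w (Suc t mod p)}"
    using edge_endpoints[of "w t" "w (Suc t mod p)"] assms(2) by (simp add: cyc_edge_def)
  ultimately show "a \<in> w ` {..<p}" "b \<in> w ` {..<p}" using assms(1) by (auto simp: doubleton_eq_iff)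
qed

lemma excess_le_attach:
  assumes "excess_le k V E" "w ` {..<p} \<inter> V \<noteq> {}"
  shows "excess_le k (V \<union> w ` {..<p}) (E \<union> cyc_edges p w)"
proof -
  obtain t0 where "t0 < p" "w t0 \<in> V" using assms(2) by auto
  then have "card (V \<union> w ` {..<p}) + card E \<le> card V + card (E \<union> cyc_edges p w)"
    using assms(1) by (intro closed_walk_excess) (auto simp: excess_le_def)
  moreover have "a \<in> V \<union> w ` {..<p} \<and> b \<in> V \<union> w ` {..<p}" if "(a, b) \<in> E \<union> cyc_edges p w" for a b
  proof (cases "(a, b) \<in> E")
    case True
    then show ?thesis using assms(1) by (auto simp: excess_le_def)
  next
    case False
    with that have "(a, b) \<in> cyc_edges p w" by blast
    then obtain t where "t < p" "cyc_edge p w t = (a, b)" by (metis imageE lessThan_iff)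
    then show ?thesis using cyc_edge_endpoints by blast
  qed
  ultimately show ?thesis using assms(1) unfolding excess_le_def by auto
qed

lemma excess_le_new:
  assumes "excess_le k V E" "0 < p"
  shows "excess_le (Suc k) (V \<union> w ` {..<p}) (E \<union> cyc_edges p w)"
proof -
  \<comment> \<open>Adding the starting vertex alone costs at most one; from then on the walk meets
    the graph.\<close>
  have "excess_le (Suc k) (insert (w 0) V) E"
    using assms by (auto simp: excess_le_def card_insert_if)
  moreover have "w 0 \<in> w ` {..<p}" using assms(2) by auto
  ultimately have "excess_le (Suc k) (insert (w 0) V \<union> w ` {..<p}) (E \<union> cyc_edges p w)"
    by (intro excess_le_attach) auto
  then show ?thesis using \<open>w 0 \<in> w ` {..<p}\<close> by (simp add: insert_absorb)
qed

lemma cyc_edges_meet_imp_vertices_meet: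
  assumes "cyc_edges p v \<inter> cyc_edges p w \<noteq> {}"
  shows "v ` {..<p} \<inter> w ` {..<p} \<noteq> {}"
proof -
  from assms obtain e where e: "e \<in> cyc_edges p v" "e \<in> cyc_edges p w" by blast
  then obtain s t where "s < p" "e = cyc_edge p v s" "t < p" "e = cyc_edge p w t" by (auto simp only: image_iff lessThan_iff)
  then have st: "s < p" "t < p" "cyc_edge p v s = cyc_edge p w t" by simp_all
  obtain a b where "cyc_edge p v s = (a, b)" by (cases "cyc_edge p v s")
  with st cyc_edge_endpoints(1) have "a \<in> v ` {..<p}" "a \<in> w ` {..<p}" by metis+
  then show ?thesis by blast
qed

text \<open>Walk 0 and a partner \<open>a\<close> form one component. If one of the other two meets
  it, the last walk meets one of those three; if neither does, the other two meet each other and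
  form a second component.\<close>

lemma four_walks_excess:
  fixes f :: "nat \<Rightarrow> nat \<Rightarrow> nat"
  assumes p: "0 < p"
    and share: "\<And>s. s < 4 \<Longrightarrow> \<exists>r<4. r \<noteq> s \<and> cyc_edges p (f s) \<inter> cyc_edges p (f r) \<noteq> {}"
  shows "card (\<Union>s<4. f s ` {..<p}) \<le> card (\<Union>s<4. cyc_edges p (f s)) + 2"
proof -
  define V where "V s = f s ` {..<p}" for s
  define E where "E s = cyc_edges p (f s)" for s
  have share': "\<exists>r<4. r \<noteq> s \<and> V s \<inter> V r \<noteq> {}" if "s < 4" for s
    using share[OF that] cyc_edges_meet_imp_vertices_meet[of p "f s"] unfolding V_def by blast
  have attach: "excess_le k (W \<union> V s) (F \<union> E s)" if "excess_le k W F" "V s \<inter> W \<noteq> {}" for k W F s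
    using excess_le_attach[of k W F "f s" p] that by (simp add: V_def E_def)
  have new: "excess_le (Suc k) (W \<union> V s) (F \<union> E s)" if "excess_le k W F" for k W F s
    using excess_le_new[OF that p, of "f s"] by (simp add: V_def E_def)
  have mono: "excess_le 2 W F" if "excess_le 1 W F" for W F using that by (auto simp: excess_le_def)
  have "excess_le 0 {} {}" by (simp add: excess_le_def)
  from new[OF this, of 0] have g0: "excess_le 1 (V 0) (E 0)" by simp
  obtain a where a: "a < 4" "a \<noteq> 0" "V 0 \<inter> V a \<noteq> {}" using share'[of 0] by auto
  obtain b d where bd: "{0, a, b, d} = {..<4::nat}" "b \<noteq> d" "b \<notin> {0, a}" "d \<notin> {0, a}"
  proof -
    have 4: "{..<4::nat} = {0,1,2,3}" by auto
    consider "a = 1" | "a = 2" | "a = 3" using a by linarith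
    then show thesis
    proof cases
      case 1 show ?thesis by (rule that[of 2 3]) (auto simp: 4 1)
    next
      case 2 show ?thesis by (rule that[of 1 3]) (auto simp: 4 2)
    next
      case 3 show ?thesis by (rule that[of 1 2]) (auto simp: 4 3)
    qed
  qed
  have partner: "\<exists>r\<in>{0, a, b, d}. r \<noteq> s \<and> V s \<inter> V r \<noteq> {}" if "s \<in> {0, a, b, d}" for s
    using share'[of s] that unfolding bd(1) by auto
  have ga: "excess_le 1 (V 0 \<union> V a) (E 0 \<union> E a)" using attach[OF g0, of a] a by auto
  have "excess_le 2 (V 0 \<union> V a \<union> V b \<union> V d) (E 0 \<union> E a \<union> E b \<union> E d)"
  proof -
    consider "V b \<inter> (V 0 \<union> V a) \<noteq> {}" | "V d \<inter> (V 0 \<union> V a) \<noteq> {}"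
      | "V b \<inter> (V 0 \<union> V a) = {}" "V d \<inter> (V 0 \<union> V a) = {}" by blast
    then show ?thesis
    proof cases
      case 1
      have "V d \<inter> (V 0 \<union> V a \<union> V b) \<noteq> {}" using partner[of d] by auto
      from mono[OF attach[OF attach[OF ga 1] this]] show ?thesis .
    next
      case 2
      have "V b \<inter> (V 0 \<union> V a \<union> V d) \<noteq> {}" using partner[of b] by auto
      from mono[OF attach[OF attach[OF ga 2] this]] show ?thesis
        unfolding Un_assoc Un_commute[of "V b" "V d"] Un_commute[of "E b" "E d"] .
    next
      case 3
      then have "V d \<inter> V b \<noteq> {}" using partner[of b] by auto
      then have "V d \<inter> (V 0 \<union> V a \<union> V b) \<noteq> {}" by auto
      from attach[OF new[OF ga, of b] this] show ?thesis by (simp add: numeral_2_eq_2)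
    qed
  qed
  moreover have "V 0 \<union> V a \<union> V b \<union> V d = (\<Union>s\<in>{0, a, b, d}. V s)" "E 0 \<union> E a \<union> E b \<union> E d = (\<Union>s\<in>{0, a, b, d}. E s)"
    by auto
  ultimately have "excess_le 2 (\<Union>s<4. V s) (\<Union>s<4. E s)" by (simp only: bd(1))
  then show ?thesis unfolding V_def E_def excess_le_def by blast
qed

section \<open>Partitions and cumulants\<close>

definition partition_sum :: "(nat \<Rightarrow> real) \<Rightarrow> 'a set \<Rightarrow> real" where
  "partition_sum \<kappa> S = (\<Sum>\<pi> | partition_on S \<pi>. \<Prod>B\<in>\<pi>. \<kappa> (card B))"

lemma finite_partitions: "finite S \<Longrightarrow> finite {\<pi>. partition_on S \<pi>}"
  by (rule finite_subset[of _ "Pow (Pow S)"]) (auto simp: partition_on_def)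

lemma partition_sum_empty: "partition_sum \<kappa> {} = 1"
proof -
  have e: "{\<pi>. partition_on {} \<pi>} = {{}}" by (auto simp: partition_on_def)
  show ?thesis unfolding partition_sum_def e by simp
qed

text \<open>Partitions are classified by the block that contains \<open>a\<close>; removing this
  block leaves a partition of the rest.\<close>

lemma partition_sum_rec:
  assumes S: "finite S" and a: "a \<in> S"
  shows "partition_sum \<kappa> S = (\<Sum>B | B \<subseteq> S \<and> a \<in> B. \<kappa> (card B) * partition_sum \<kappa> (S - B))"
proof -
  let ?Bs = "{B. B \<subseteq> S \<and> a \<in> B}"
  let ?Ps = "\<lambda>S. {\<pi>. partition_on S \<pi>}"
  have fB: "finite ?Bs" using S by auto
  have notin: "B \<notin> \<pi>" if "B \<in> ?Bs" "partition_on (S - B) \<pi>" for B \<pi>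
    using that by (auto simp: partition_on_def)
  have "(\<Sum>B\<in>?Bs. \<kappa> (card B) * partition_sum \<kappa> (S - B)) =
        (\<Sum>B\<in>?Bs. \<Sum>\<pi>\<in>?Ps (S - B). \<kappa> (card B) * (\<Prod>B\<in>\<pi>. \<kappa> (card B)))"
    by (simp add: partition_sum_def sum_distrib_left)
  also have "\<dots> = (\<Sum>(B,\<pi>)\<in>(SIGMA B:?Bs. ?Ps (S - B)). \<kappa> (card B) * (\<Prod>B\<in>\<pi>. \<kappa> (card B)))"
    using S by (intro sum.Sigma fB) (auto intro!: finite_partitions)
  also have "\<dots> = (\<Sum>\<pi>\<in>?Ps S. \<Prod>B\<in>\<pi>. \<kappa> (card B))"
  proof (rule sum.reindex_bij_witness[where
        j = "\<lambda>(B, \<pi>). insert B \<pi>" and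
        i = "\<lambda>\<pi>. (THE B. B \<in> \<pi> \<and> a \<in> B, \<pi> - {THE B. B \<in> \<pi> \<and> a \<in> B})"], goal_cases)
    case (1 x)
    then obtain B \<pi> where x: "x = (B, \<pi>)" "B \<in> ?Bs" "partition_on (S - B) \<pi>" by auto
    have "(THE C. C \<in> insert B \<pi> \<and> a \<in> C) = B"
      using x by (intro the_equality) (auto simp: partition_on_def)
    then show ?case using notin[OF x(2,3)] by (simp add: x(1))
  next
    case (2 x)
    then obtain B \<pi> where x: "x = (B, \<pi>)" "B \<in> ?Bs" "partition_on (S - B) \<pi>" by auto
    then show ?case by (auto simp: partition_on_def disjoint_def)
  next
    case (3 \<pi>)
    then have \<pi>: "partition_on S \<pi>" by simp
    then obtain B where B: "B \<in> \<pi>" "a \<in> B" using a by (auto simp: partition_on_def)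
    have "(THE C. C \<in> \<pi> \<and> a \<in> C) = B"
      using B \<pi> by (intro the_equality) (auto simp: partition_on_def disjoint_def)
    with B show ?case by auto
  next
    case (4 \<pi>)
    then have \<pi>: "partition_on S \<pi>" by simp
    then obtain B where B: "B \<in> \<pi>" "a \<in> B" using a by (auto simp: partition_on_def)
    have the: "(THE C. C \<in> \<pi> \<and> a \<in> C) = B"
      using B \<pi> by (intro the_equality) (auto simp: partition_on_def disjoint_def)
    have "partition_on (S - B) (\<pi> - {B})"
      using \<pi> B by (auto simp: partition_on_def disjoint_def)
    then show ?case using B \<pi> by (auto simp: the partition_on_def)
  next
    case (5 x)
    then obtain B \<pi> where x: "x = (B, \<pi>)" "B \<in> ?Bs" "partition_on (S - B) \<pi>" by auto
    have "finite \<pi>" using x(3) S by (auto intro: finite_elements)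
    then show ?case using notin[OF x(2,3)] by (simp add: x(1))
  qed
  finally show ?thesis by (simp add: partition_sum_def)
qed

lemma sum_subsets_containing:
  fixes g :: "nat \<Rightarrow> real"
  assumes S: "finite S" and a: "a \<in> S" and n: "card S = Suc n"
  shows "(\<Sum>B | B \<subseteq> S \<and> a \<in> B. g (card B)) = (\<Sum>j\<le>n. real (n choose j) * g (Suc j))"
proof -
  let ?T = "S - {a}"
  have T: "finite ?T" "card ?T = n" using S a n by auto
  have "(\<Sum>B | B \<subseteq> S \<and> a \<in> B. g (card B)) = (\<Sum>B\<in>Pow ?T. g (Suc (card B)))"
  proof (rule sum.reindex_bij_witness[where i="insert a" and j="\<lambda>B. B - {a}"])
    fix B assume B: "B \<in> {B. B \<subseteq> S \<and> a \<in> B}"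
    then have "finite B" using S by (auto intro: finite_subset)
    with B have "Suc (card (B - {a})) = card B" by (intro card_Suc_Diff1) auto
    then show "g (Suc (card (B - {a}))) = g (card B)" by simp
  qed (use a in auto)
  also have "\<dots> = (\<Sum>j\<le>n. \<Sum>B | B \<in> Pow ?T \<and> card B = j. g (Suc (card B)))"
    using T by (intro sum.group[symmetric]) (auto intro: card_mono)
  also have "\<dots> = (\<Sum>j\<le>n. real (n choose j) * g (Suc j))"
    using T n_subsets[OF T(1)] by (intro sum.cong refl) simp
  finally show ?thesis .
qed

text \<open>With F the exponential moment series and K = log F, one has F' = K' F; the recursion
  compares the coefficients of order n.\<close>

lemma moment_cumulant_recursion:
  assumes \<mu>: "prob_space \<mu>"
  shows "moment \<mu> (Suc n) = (\<Sum>j\<le>n. real (n choose j) * (cumulant \<mu> (Suc j) * moment \<mu> (n - j)))"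
proof -
  define F where "F = Abs_fps (\<lambda>j. moment \<mu> j / fact j)"
  define K where "K = fps_ln 1 oo (F - 1)"
  have F0: "fps_nth F 0 = 1" using prob_space.prob_space[OF \<mu>] by (simp add: F_def moment_def)
  have "(1 + fps_X) oo (F - 1) = F" by (simp add: fps_compose_add_distrib F0)
  then have "inverse (1 + fps_X) oo (F - 1) = inverse F"
    by (subst fps_inverse_compose) (simp_all add: F0)
  then have "fps_deriv K = inverse F * fps_deriv F"
    unfolding K_def by (subst fps_compose_deriv) (simp_all add: F0 fps_ln_deriv)
  then have d: "fps_deriv F = fps_deriv K * F"
    using inverse_mult_eq_1[of F] F0 by (simp add: mult_ac)
  have c: "cumulant \<mu> k = fact k * fps_nth K k" for k by (simp add: cumulant_def K_def F_def)
  have "moment \<mu> (Suc n) = fact n * fps_nth (fps_deriv F) n"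
    by (simp add: F_def fps_deriv_nth fact_Suc del: of_nat_Suc)
  also have "\<dots> = fact n * (\<Sum>j\<le>n. fps_nth (fps_deriv K) j * fps_nth F (n - j))"
    by (simp add: d fps_mult_nth atMost_atLeast0)
  also have "\<dots> = (\<Sum>j\<le>n. real (n choose j) * (cumulant \<mu> (Suc j) * moment \<mu> (n - j)))"
    unfolding sum_distrib_left
  proof (intro sum.cong refl)
    fix j assume "j \<in> {..n}"
    then have "j \<le> n" by simp
    then have "real (n choose j) = fact n / (fact j * fact (n - j))" by (simp add: binomial_fact)
    then show "fact n * (fps_nth (fps_deriv K) j * fps_nth F (n - j)) =
      real (n choose j) * (cumulant \<mu> (Suc j) * moment \<mu> (n - j))"
      by (simp add: c F_def fps_deriv_nth fact_Suc field_simps del: of_nat_Suc)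
  qed
  finally show ?thesis .
qed

text \<open>Grouping the blocks that contain a fixed point by their size turns
  \<open>partition_sum_rec\<close> into the recursion for moments, so both sides agree by
  induction.\<close>

lemma partition_sum_cumulant:
  assumes \<mu>: "prob_space \<mu>" and \<kappa>: "\<And>k. 1 \<le> k \<Longrightarrow> \<kappa> k = cumulant \<mu> k" and "finite S"
  shows "partition_sum \<kappa> S = moment \<mu> (card S)"
  using assms(3)
proof (induction "card S" arbitrary: S rule: less_induct)
  case less
  show ?case
  proof (cases "card S")
    case 0
    then show ?thesis using less.prems prob_space.prob_space[OF \<mu>]
      by (simp add: partition_sum_empty moment_def)
  next
    case (Suc n)
    then obtain a where a: "a \<in> S" by fastforce
    have "partition_sum \<kappa> S = (\<Sum>B | B \<subseteq> S \<and> a \<in> B. \<kappa> (card B) * partition_sum \<kappa> (S - B))"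
      by (rule partition_sum_rec[OF less.prems a])
    also have "\<dots> = (\<Sum>B | B \<subseteq> S \<and> a \<in> B. cumulant \<mu> (card B) * moment \<mu> (card S - card B))"
    proof (intro sum.cong refl)
      fix B assume "B \<in> {B. B \<subseteq> S \<and> a \<in> B}"
      then have B: "B \<subseteq> S" "a \<in> B" by auto
      have fB: "finite B" using B less.prems by (auto intro: finite_subset)
      then have "1 \<le> card B" using B by (auto simp: Suc_le_eq card_gt_0_iff)
      moreover have cS: "card (S - B) = card S - card B" using B fB by (simp add: card_Diff_subset)
      moreover have "card (S - B) < card S" using B less.prems by (intro psubset_card_mono) auto
      ultimately show "\<kappa> (card B) * partition_sum \<kappa> (S - B) = cumulant \<mu> (card B) * moment \<mu> (card S - card B)"
        using less.hyps[of "S - B"] less.prems \<kappa> by simp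
    qed
    also have "\<dots> = (\<Sum>j\<le>n. real (n choose j) * (cumulant \<mu> (Suc j) * moment \<mu> (card S - Suc j)))"
      by (rule sum_subsets_containing[OF less.prems a Suc])
    also have "\<dots> = moment \<mu> (card S)"
      using moment_cumulant_recursion[OF \<mu>, of n] by (simp add: Suc)
    finally show ?thesis .
  qed
qed

section \<open>The partition of a set into the fibres of a function\<close>

definition blocks :: "('a \<Rightarrow> 'b) \<Rightarrow> 'a set \<Rightarrow> 'a set set" where
  "blocks h T = (\<lambda>s. {t\<in>T. h t = h s}) ` T"

lemma blocks_cong:
  assumes "\<And>s t. s \<in> T \<Longrightarrow> t \<in> T \<Longrightarrow> h s = h t \<longleftrightarrow> h' s = h' t"
  shows "blocks h T = blocks h' T"
  unfolding blocks_def using assms by (intro image_cong refl) blast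

lemma partition_on_blocks: "partition_on T (blocks h T)"
  by (auto simp: partition_on_def blocks_def disjoint_def)

lemma blocks_eqD:
  assumes "blocks h T = blocks h' T" "s \<in> T" "t \<in> T"
  shows "h s = h t \<longleftrightarrow> h' s = h' t"
proof -
  let ?B = "{r\<in>T. h r = h s}" and ?B' = "{r\<in>T. h' r = h' s}"
  have "?B' \<in> blocks h' T" using assms(2) by (auto simp: blocks_def)
  then have B: "?B \<in> blocks h T" "?B' \<in> blocks h T" using assms(2) unfolding assms(1)[symmetric] by (simp_all add: blocks_def)
  have "a = b" if "a \<in> blocks h T" "b \<in> blocks h T" "s \<in> a" "s \<in> b" for a b
    using partition_onD2[OF partition_on_blocks[of T h]] that unfolding disjoint_def by blast
  from this[OF B] have "?B = ?B'" using assms(2) by simp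
  then have "t \<in> ?B \<longleftrightarrow> t \<in> ?B'" by (simp only:)
  then show ?thesis using assms(2,3) by auto
qed

lemma blocks_eq_fibres: "blocks h T = (\<lambda>e. {t\<in>T. h t = e}) ` h ` T"
  by (simp add: blocks_def image_image)

lemma inj_on_fibres: "inj_on (\<lambda>e. {t\<in>T. h t = e}) (h ` T)"
  by (auto simp: inj_on_def)

lemma card_blocks: "card (blocks h T) = card (h ` T)"
  unfolding blocks_eq_fibres by (rule card_image[OF inj_on_fibres])

lemma finite_blocks: "finite T \<Longrightarrow> finite (blocks h T)"
  by (simp add: blocks_def)

lemma prod_blocks:
  "(\<Prod>B\<in>blocks h T. f B) = (\<Prod>e\<in>h ` T. f {t\<in>T. h t = e})"
  unfolding blocks_eq_fibres by (subst prod.reindex[OF inj_on_fibres]) simp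

section \<open>Riemann sums of the profile\<close>

text \<open>The interval is half-open so that the cells [k/n, (k+1)/n) partition it exactly.\<close>

definition unif :: "real measure" where
  "unif = density lborel (indicator {0..<1})"

lemma sets_unif [simp, measurable_cong]: "sets unif = sets borel" by (simp add: unif_def)
lemma space_unif [simp]: "space unif = UNIV" by (simp add: unif_def)

lemma emeasure_unif: "A \<in> sets borel \<Longrightarrow> emeasure unif A = emeasure lborel ({0..<1} \<inter> A)"
  unfolding unif_def by (subst emeasure_density) (auto simp: nn_integral_indicator[symmetric]
      indicator_inter_arith[symmetric] simp del: nn_integral_indicator)

lemma prob_space_unif: "prob_space unif"
  by (rule prob_spaceI) (simp add: emeasure_unif)

lemma AE_unif: "AE x in unif. x \<in> {0..<1}"
  unfolding unif_def by (subst AE_density) (auto simp: indicator_def)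

definition cell :: "nat \<Rightarrow> real \<Rightarrow> nat" where
  "cell n y = nat \<lfloor>real n * y\<rfloor>"

lemma cell_measurable [measurable]: "cell n \<in> borel \<rightarrow>\<^sub>M count_space UNIV"
  unfolding cell_def by measurable

lemma cell_less: "0 < n \<Longrightarrow> y \<in> {0..<1} \<Longrightarrow> cell n y < n"
  by (simp add: cell_def nat_less_iff floor_less_iff)

lemma cell_bounds:
  assumes "y \<in> {0..<1}" "0 < n"
  shows "real (cell n y) \<le> real n * y" "real n * y < real (cell n y) + 1"
proof -
  have "0 \<le> \<lfloor>real n * y\<rfloor>" using assms by simp
  then have "real (cell n y) = of_int \<lfloor>real n * y\<rfloor>" by (simp add: cell_def)
  then show "real (cell n y) \<le> real n * y" "real n * y < real (cell n y) + 1" by linarith+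
qed

lemma emeasure_unif_cell:
  assumes "k < n"
  shows "emeasure unif {y. cell n y = k} = ennreal (1 / real n)"
proof -
  have n: "0 < n" using assms by simp
  have "{0..<1} \<inter> {y. cell n y = k} = {real k / real n..<real (Suc k) / real n}"
  proof (rule equalityI; rule subsetI)
    fix y assume y: "y \<in> {0..<1} \<inter> {y. cell n y = k}"
    then have "real k \<le> real n * y" "real n * y < real k + 1"
      using cell_bounds[of y n] n by auto
    then show "y \<in> {real k / real n..<real (Suc k) / real n}"
      using n by (auto simp: field_simps)
  next
    fix y assume y: "y \<in> {real k / real n..<real (Suc k) / real n}"
    then have b: "real k \<le> real n * y" "real n * y < real k + 1" using n by (auto simp: field_simps)
    then have "\<lfloor>real n * y\<rfloor> = int k" by (intro floor_unique) auto
    moreover have "0 \<le> y" using y by (auto intro: order_trans[rotated])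
    moreover have "real n * y < real n" using b assms by linarith
    ultimately show "y \<in> {0..<1} \<inter> {y. cell n y = k}" using n by (auto simp: cell_def)
  qed
  moreover have "{y. cell n y = k} \<in> sets borel"
    using measurable_sets[OF cell_measurable, of "{k}" n] by (simp add: vimage_def)
  ultimately show ?thesis
    using n by (simp add: emeasure_unif field_simps flip: diff_divide_distrib)
qed

abbreviation unif_prod :: "nat set \<Rightarrow> (nat \<Rightarrow> real) measure" where
  "unif_prod V \<equiv> Pi\<^sub>M V (\<lambda>_. unif)"

lemma prob_space_unif_prod: "prob_space (unif_prod V)"
  by (intro prob_space_PiM prob_space_unif)

lemma emeasure_unif_prod:
  assumes "finite V" "\<And>v. v \<in> V \<Longrightarrow> A v \<in> sets borel"
  shows "emeasure (unif_prod V) (Pi\<^sub>E V A) = (\<Prod>v\<in>V. emeasure unif (A v))"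
proof -
  interpret product_sigma_finite "\<lambda>_::nat. unif"
    by (auto simp: product_sigma_finite_def intro: prob_space_imp_sigma_finite prob_space_unif)
  show ?thesis using assms by (subst emeasure_PiM) auto
qed

text \<open>Through this joint law, a Lebesgue null set of the plane is almost surely avoided by any
  pair of distinct coordinates.\<close>

lemma distr_unif_prod_pair:
  assumes V: "finite V" and v: "v \<in> V" "v' \<in> V" "v \<noteq> v'"
  shows "distr (unif_prod V) (borel \<Otimes>\<^sub>M borel) (\<lambda>x. (x v, x v')) = unif \<Otimes>\<^sub>M unif"
proof (rule pair_measure_eqI[symmetric])
  show "sigma_finite_measure unif" "sigma_finite_measure unif"
    by (auto intro: prob_space_imp_sigma_finite prob_space_unif)
  show "sets (unif \<Otimes>\<^sub>M unif) = sets (distr (unif_prod V) (borel \<Otimes>\<^sub>M borel) (\<lambda>x. (x v, x v')))"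
    by (simp cong: sets_pair_measure_cong)
  fix A B assume AB: "A \<in> sets unif" "B \<in> sets unif"
  have m: "(\<lambda>x. (x v, x v')) \<in> unif_prod V \<rightarrow>\<^sub>M borel \<Otimes>\<^sub>M borel"
    using v by (intro measurable_Pair) (auto intro!: measurable_component_singleton simp: measurable_cong_sets[OF refl sets_unif[symmetric]])
  let ?F = "\<lambda>u. if u = v then A else if u = v' then B else UNIV"
  have "emeasure (distr (unif_prod V) (borel \<Otimes>\<^sub>M borel) (\<lambda>x. (x v, x v'))) (A \<times> B) =
        emeasure (unif_prod V) ((\<lambda>x. (x v, x v')) -` (A \<times> B) \<inter> space (unif_prod V))"
    using AB by (intro emeasure_distr m) auto
  also have "(\<lambda>x. (x v, x v')) -` (A \<times> B) \<inter> space (unif_prod V) = Pi\<^sub>E V ?F"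
    using v by (auto simp: space_PiM PiE_def Pi_def split: if_splits)
  also have "emeasure (unif_prod V) (Pi\<^sub>E V ?F) = (\<Prod>u\<in>V. emeasure unif (?F u))"
    using AB by (intro emeasure_unif_prod V) auto
  also have "\<dots> = (\<Prod>u\<in>V. if u = v then emeasure unif A else if u = v' then emeasure unif B else 1)"
    using prob_space.emeasure_space_1[OF prob_space_unif] by (intro prod.cong) auto
  also have "\<dots> = emeasure unif A * emeasure unif B"
  proof -
    have V': "V = insert v (insert v' (V - {v, v'}))" using v by auto
    show ?thesis using V v by (subst V') (simp add: prod.If_cases Int_absorb1)
  qed
  finally show "emeasure unif A * emeasure unif B =
      emeasure (distr (unif_prod V) (borel \<Otimes>\<^sub>M borel) (\<lambda>x. (x v, x v'))) (A \<times> B)" by simp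
qed

lemma AE_unif_prod_pair:
  assumes V: "finite V" and v: "v \<in> V" "v' \<in> V" "v \<noteq> v'"
    and N: "N \<in> null_sets (lborel :: (real \<times> real) measure)"
  shows "AE x in unif_prod V. (x v, x v') \<notin> N"
proof -
  have sf: "sigma_finite_measure (density lborel (indicator {0..<1} :: real \<Rightarrow> ennreal))"
    using prob_space_imp_sigma_finite[OF prob_space_unif] by (simp add: unif_def)
  have e: "unif \<Otimes>\<^sub>M unif = density (lborel \<Otimes>\<^sub>M lborel) (\<lambda>(x, y). indicator {0..<1} x * indicator {0..<1} y)"
    unfolding unif_def by (intro pair_measure_density sf lborel.sigma_finite_measure_axioms) auto
  have N': "AE z in lborel \<Otimes>\<^sub>M lborel. z \<notin> N"
    unfolding lborel_prod by (rule AE_not_in[OF N])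
  have m: "(\<lambda>(x, y). indicator {0..<1::real} x * indicator {0..<1::real} y :: ennreal) \<in> borel_measurable (lborel \<Otimes>\<^sub>M lborel)"
    by measurable
  have "AE z in unif \<Otimes>\<^sub>M unif. z \<notin> N"
    unfolding e AE_density[OF m] using N' by eventually_elim simp
  then have AE: "AE z in distr (unif_prod V) (borel \<Otimes>\<^sub>M borel) (\<lambda>x. (x v, x v')). z \<notin> N"
    by (simp only: distr_unif_prod_pair[OF V v])
  have "(\<lambda>x. (x v, x v')) \<in> unif_prod V \<rightarrow>\<^sub>M borel \<Otimes>\<^sub>M borel"
    using v by (intro measurable_Pair) (auto intro!: measurable_component_singleton simp: measurable_cong_sets[OF refl sets_unif[symmetric]])
  from AE_distrD[OF this AE] show ?thesis .
qed

text \<open>The diagonal is included even where \<sigma> is continuous: avoiding it makes the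
  coordinates of a point distinct, so that labelling by cells is eventually injective.\<close>

definition discontinuity_cover :: "(real \<times> real) set set \<Rightarrow> (real \<times> real) set" where
  "discontinuity_cover \<P> = {z. fst z = snd z} \<union> (\<Union>P\<in>\<P>. frontier P)"

lemma discontinuity_cover_null:
  assumes "finite \<P>" "\<And>P. P \<in> \<P> \<Longrightarrow> negligible (frontier P)"
  shows "discontinuity_cover \<P> \<in> null_sets lborel"
proof -
  have d: "{z :: real \<times> real. fst z = snd z} = {z. (1, -1) \<bullet> z = 0}"
    by (auto simp: inner_prod_def)
  have "negligible {z :: real \<times> real. (1, -1) \<bullet> z = 0}"
    by (rule negligible_hyperplane) (simp add: zero_prod_def)
  then have "negligible (discontinuity_cover \<P>)"
    unfolding discontinuity_cover_def d using assms
    by (intro negligible_Un negligible_Union) auto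
  \<comment> \<open>Negligibility refers to the completed measure; closedness supplies Borel
    measurability.\<close>
  moreover have "closed (discontinuity_cover \<P>)"
    unfolding discontinuity_cover_def d using assms(1)
    by (intro closed_Un closed_UN closed_hyperplane) auto
  then have "discontinuity_cover \<P> \<in> sets lborel" by (simp add: borel_closed)
  ultimately show ?thesis
    by (simp add: negligible_iff_null_sets null_sets_completion_iff)
qed

lemma piecewise_isCont:
  assumes "partition_on unit_square \<P>" "\<And>P. P \<in> \<P> \<Longrightarrow> continuous_on (interior P) \<sigma>"
    and "z \<in> unit_square" "z \<notin> discontinuity_cover \<P>"
  shows "isCont \<sigma> z"
proof -
  obtain P where P: "P \<in> \<P>" "z \<in> P" using assms(1,3) by (auto simp: partition_on_def)
  then have "z \<notin> frontier P" using assms(4) by (auto simp: discontinuity_cover_def)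
  then have "z \<in> interior P" using P closure_subset by (auto simp: frontier_def)
  then show ?thesis
    using assms(2)[OF P(1)] by (simp add: continuous_on_eq_continuous_at)
qed

definition profile_entry :: "(real \<times> real \<Rightarrow> real) \<Rightarrow> nat \<Rightarrow> nat \<Rightarrow> nat \<Rightarrow> real" where
  "profile_entry \<sigma> n a b = \<sigma> (real (Suc (min a b)) / real n, real (Suc (max a b)) / real n)"

abbreviation labellings :: "nat set \<Rightarrow> nat \<Rightarrow> (nat \<Rightarrow> nat) set" where
  "labellings V n \<equiv> {j \<in> V \<rightarrow>\<^sub>E {..<n}. inj_on j V}"

text \<open>The word \<open>c\<close> is a pattern whose letters name vertices, and \<open>j\<close>
  assigns matrix indices to them. Division by the number of all labellings makes this a Riemann sum
  of an integral over a cube with one coordinate per vertex.\<close>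

definition profile_sum :: "(real \<times> real \<Rightarrow> real) \<Rightarrow> nat \<Rightarrow> (nat \<Rightarrow> nat) \<Rightarrow> nat \<Rightarrow> real" where
  "profile_sum \<sigma> p c n = (\<Sum>j\<in>labellings (c ` {..<p}) n.
     \<Prod>t<p. profile_entry \<sigma> n (j (c t)) (j (c (Suc t mod p)))) / real n ^ card (c ` {..<p})"

lemma profile_entry_bound:
  assumes "\<And>z. z \<in> unit_square \<Longrightarrow> \<bar>\<sigma> z\<bar> \<le> B" "a < n" "b < n"
  shows "\<bar>profile_entry \<sigma> n a b\<bar> \<le> B"
  unfolding profile_entry_def using assms(2,3)
  by (intro assms(1)) (auto simp: unit_square_def)

lemma abs_profile_prod_le:
  assumes B: "\<And>z. z \<in> unit_square \<Longrightarrow> \<bar>\<sigma> z\<bar> \<le> B"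
    and w: "\<And>t. t < p \<Longrightarrow> w t < n"
  shows "\<bar>\<Prod>t<p. profile_entry \<sigma> n (w t) (w (Suc t mod p))\<bar> \<le> B ^ p"
proof -
  have "\<bar>\<Prod>t<p. profile_entry \<sigma> n (w t) (w (Suc t mod p))\<bar> = (\<Prod>t<p. \<bar>profile_entry \<sigma> n (w t) (w (Suc t mod p))\<bar>)"
    by (rule abs_prod)
  also have "\<dots> \<le> (\<Prod>t<p. B)"
    by (intro prod_mono conjI profile_entry_bound B w) auto
  finally show ?thesis by simp
qed

lemma profile_sum_bound:
  assumes B: "\<And>z. z \<in> unit_square \<Longrightarrow> \<bar>\<sigma> z\<bar> \<le> B" and B0: "0 \<le> B"
  shows "\<bar>profile_sum \<sigma> p c n\<bar> \<le> B ^ p"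
proof -
  let ?V = "c ` {..<p}"
  let ?J = "labellings ?V n"
  have fin: "finite (?V \<rightarrow>\<^sub>E {..<n})" by (intro finite_PiE) auto
  have "\<bar>\<Sum>j\<in>?J. \<Prod>t<p. profile_entry \<sigma> n (j (c t)) (j (c (Suc t mod p)))\<bar> \<le>
        (\<Sum>j\<in>?J. B ^ p)"
  proof (intro order_trans[OF sum_abs] sum_mono)
    fix j assume "j \<in> ?J"
    then show "\<bar>\<Prod>t<p. profile_entry \<sigma> n (j (c t)) (j (c (Suc t mod p)))\<bar> \<le> B ^ p"
      by (intro abs_profile_prod_le[where w = "\<lambda>t. j (c t)"] B) (auto simp: PiE_def Pi_def)
  qed
  also have "\<dots> = real (card ?J) * B ^ p" by simp
  also have "\<dots> \<le> real (card (?V \<rightarrow>\<^sub>E {..<n})) * B ^ p"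
    using B0 by (intro mult_right_mono of_nat_mono card_mono fin) auto
  also have "card (?V \<rightarrow>\<^sub>E {..<n}) = n ^ card ?V" by (simp add: card_PiE)
  finally have le: "\<bar>\<Sum>j\<in>?J. \<Prod>t<p. profile_entry \<sigma> n (j (c t)) (j (c (Suc t mod p)))\<bar> \<le> real n ^ card ?V * B ^ p"
    by simp
  show ?thesis
  proof (cases "real n ^ card ?V = 0")
    \<comment> \<open>Here n = 0, and the quotient is 0 by the convention for division by
      zero.\<close>
    case True
    show ?thesis unfolding profile_sum_def True using B0 by simp
  next
    case False
    moreover have "0 \<le> real n ^ card ?V" by simp
    ultimately have "0 < real n ^ card ?V" by linarith
    then show ?thesis using le by (simp add: profile_sum_def abs_divide divide_le_eq mult.commute)
  qed
qed

lemma profile_sum_cong: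
  assumes "\<And>z. z \<in> unit_square \<Longrightarrow> \<sigma> z = \<sigma>' z"
  shows "profile_sum \<sigma> p c n = profile_sum \<sigma>' p c n"
  unfolding profile_sum_def profile_entry_def
proof (intro arg_cong2[where f="(/)"] sum.cong prod.cong refl)
  fix j t assume j: "j \<in> labellings (c ` {..<p}) n" and t: "t \<in> {..<p}"
  then have "Suc t mod p < p" by simp
  with j t have "j (c t) < n" "j (c (Suc t mod p)) < n" by (auto simp: PiE_def Pi_def)
  then show "\<sigma> (real (Suc (min (j (c t)) (j (c (Suc t mod p))))) / real n, real (Suc (max (j (c t)) (j (c (Suc t mod p))))) / real n) =
      \<sigma>' (real (Suc (min (j (c t)) (j (c (Suc t mod p))))) / real n, real (Suc (max (j (c t)) (j (c (Suc t mod p))))) / real n)"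
    by (intro assms) (auto simp: unit_square_def)
qed

lemma cell_lim:
  assumes "y \<in> {0..<1}"
  shows "(\<lambda>n. real (Suc (cell n y)) / real n) \<longlonglongrightarrow> y"
proof (rule tendsto_sandwich[of "\<lambda>_. y" _ sequentially "\<lambda>n. y + 1 / real n"])
  show "\<forall>\<^sub>F n in sequentially. y \<le> real (Suc (cell n y)) / real n"
    using cell_bounds[OF assms] by (intro eventually_sequentiallyI[of 1]) (auto simp: field_simps intro: less_imp_le)
  show "\<forall>\<^sub>F n in sequentially. real (Suc (cell n y)) / real n \<le> y + 1 / real n"
    using cell_bounds[OF assms] by (intro eventually_sequentiallyI[of 1]) (auto simp: field_simps)
  have "(\<lambda>n. y + 1 / real n) \<longlonglongrightarrow> y + 0" by (intro tendsto_intros lim_1_over_n)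
  then show "(\<lambda>n. y + 1 / real n) \<longlonglongrightarrow> y" by simp
qed simp

lemma profile_entry_cell_lim:
  assumes y: "y \<in> {0..<1}" "y' \<in> {0..<1}" and c: "isCont \<sigma> (min y y', max y y')"
  shows "(\<lambda>n. profile_entry \<sigma> n (cell n y) (cell n y')) \<longlonglongrightarrow> \<sigma> (min y y', max y y')"
proof -
  have "real (Suc (min a b)) / real n = min (real (Suc a) / real n) (real (Suc b) / real n)"
    "real (Suc (max a b)) / real n = max (real (Suc a) / real n) (real (Suc b) / real n)" for a b n
    by (auto simp: min_def max_def divide_right_mono antisym)
  then have "(\<lambda>n. (real (Suc (min (cell n y) (cell n y'))) / real n, real (Suc (max (cell n y) (cell n y'))) / real n))
      \<longlonglongrightarrow> (min y y', max y y')"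
    using cell_lim[OF y(1)] cell_lim[OF y(2)] by (simp only:) (intro tendsto_intros)
  then show ?thesis unfolding profile_entry_def by (rule isCont_tendsto_compose[OF c])
qed

text \<open>A Riemann sum over injective labellings is the integral of a step function in the point
  of \<open>[0,1)^V\<close>; almost every point has distinct coordinates and avoids the discontinuities of
  \<open>\<sigma>\<close>, so the step functions converge almost everywhere. Only pairs of distinct coordinates can be
  controlled, which is why the closed walk \<open>c\<close> must have no loops.\<close>

lemma profile_sum_convergent:
  assumes bdd: "bounded (\<sigma> ` unit_square)" and pc: "piecewise_continuous_on_square \<sigma>"
    and p: "0 < p" and nl: "\<And>t. t < p \<Longrightarrow> c t \<noteq> c (Suc t mod p)"
  shows "convergent (profile_sum \<sigma> p c)"
proof -
  let ?V = "c ` {..<p}"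
  have fV: "finite ?V" by simp
  obtain B where B: "\<And>z. z \<in> unit_square \<Longrightarrow> \<bar>\<sigma> z\<bar> \<le> B"
    using bdd by (auto simp: bounded_iff)
  obtain \<P> where \<P>: "finite \<P>" "partition_on unit_square \<P>"
    "\<And>P. P \<in> \<P> \<Longrightarrow> negligible (frontier P)" "\<And>P. P \<in> \<P> \<Longrightarrow> continuous_on (interior P) \<sigma>"
    using pc unfolding piecewise_continuous_on_square_def by blast
  let ?N = "discontinuity_cover \<P>"
  have N: "?N \<in> null_sets lborel" by (rule discontinuity_cover_null[OF \<P>(1,3)])
  let ?P = "unif_prod ?V"
  interpret prob_space ?P by (rule prob_space_unif_prod)
  define H where "H n j = (if inj_on j ?V then \<Prod>t<p. profile_entry \<sigma> n (j (c t)) (j (c (Suc t mod p))) else 0)" for n j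
  define Box where "Box n j = Pi\<^sub>E ?V (\<lambda>v. {y. cell n y = j v})" for n j
  \<comment> \<open>The step function that is constant on the grid boxes of side 1/n; its integral
    is the Riemann sum.\<close>
  define f where "f n x = (\<Sum>j\<in>?V \<rightarrow>\<^sub>E {..<n}. H n j * indicator (Box n j) x)" for n x
  have fin: "finite (?V \<rightarrow>\<^sub>E {..<n})" for n :: nat by (rule finite_PiE) auto
  have cb: "{y. cell n y = k} \<in> sets borel" for n k
    using measurable_sets[OF cell_measurable, of "{k}" n] by (simp add: vimage_def)
  have Boxs [measurable]: "Box n j \<in> sets ?P" for n j
    unfolding Box_def by (intro sets_PiM_I_finite fV) (auto simp: cb)
  have f_meas [measurable]: "f n \<in> borel_measurable ?P" for n unfolding f_def by measurable
  have f_int: "(LINT x|?P. f n x) = profile_sum \<sigma> p c n" for n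
  proof -
    have pB: "measure ?P (Box n j) = 1 / real n ^ card ?V" if j: "j \<in> ?V \<rightarrow>\<^sub>E {..<n}" for j
    proof -
      have "emeasure ?P (Box n j) = (\<Prod>v\<in>?V. emeasure unif {y. cell n y = j v})"
        unfolding Box_def by (intro emeasure_unif_prod fV cb)
      also have "\<dots> = (\<Prod>v\<in>?V. ennreal (1 / real n))"
        by (intro prod.cong refl emeasure_unif_cell) (use j in auto)
      also have "\<dots> = ennreal (1 / real n ^ card ?V)"
        by (simp add: ennreal_power power_one_over)
      finally show ?thesis by (simp add: measure_def)
    qed
    have "(LINT x|?P. f n x) = (\<Sum>j\<in>?V \<rightarrow>\<^sub>E {..<n}. H n j * measure ?P (Box n j))"
    proof -
      have i: "integrable ?P (\<lambda>x. H n j * indicator (Box n j) x)" for j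
        by (intro integrable_mult_right integrable_real_indicator Boxs) (simp add: emeasure_eq_measure)
      show ?thesis
        unfolding f_def Bochner_Integration.integral_sum[OF i]
        by (intro sum.cong refl) (simp add: Boxs sets.sets_into_space Int_absorb2)
    qed
    also have "\<dots> = (\<Sum>j\<in>?V \<rightarrow>\<^sub>E {..<n}. H n j) / real n ^ card ?V"
      using pB by (simp add: sum_divide_distrib)
    also have "(\<Sum>j\<in>?V \<rightarrow>\<^sub>E {..<n}. H n j) = (\<Sum>j\<in>labellings ?V n.
       \<Prod>t<p. profile_entry \<sigma> n (j (c t)) (j (c (Suc t mod p))))"
      unfolding H_def by (simp add: sum.inter_filter[OF fin])
    finally show ?thesis by (simp add: profile_sum_def)
  qed
  define good where "good x \<longleftrightarrow> x \<in> ?V \<rightarrow>\<^sub>E {0..<1} \<and> (\<forall>v\<in>?V. \<forall>v'\<in>?V. v \<noteq> v' \<longrightarrow> (x v, x v') \<notin> ?N)" for x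
  have good01: "x v \<in> {0..<1}" if "good x" "v \<in> ?V" for x v
    using that unfolding good_def by (blast dest: PiE_mem)
  have good_pair: "(x v, x v') \<notin> ?N" if "good x" "v \<in> ?V" "v' \<in> ?V" "v \<noteq> v'" for x v v'
    using conjunct2[OF that(1)[unfolded good_def]] that(2-) by (simp only: Ball_def simp_thms)
  have AE_good: "AE x in ?P. good x"
  proof -
    have "AE x in ?P. x v \<in> {0..<1}" if "v \<in> ?V" for v
      by (rule AE_PiM_component[where M="\<lambda>_. unif"]) (use that AE_unif prob_space_unif in auto)
    then have 1: "AE x in ?P. \<forall>v\<in>?V. x v \<in> {0..<1}" by (intro AE_finite_allI fV)
    have 2: "AE x in ?P. \<forall>v\<in>?V. \<forall>v'\<in>?V. v \<noteq> v' \<longrightarrow> (x v, x v') \<notin> ?N"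
    proof (intro AE_finite_allI fV)
      fix v v' assume "v \<in> ?V" "v' \<in> ?V"
      then show "AE x in ?P. v \<noteq> v' \<longrightarrow> (x v, x v') \<notin> ?N"
        using AE_unif_prod_pair[OF fV _ _ _ N, of v v'] by (cases "v = v'") auto
    qed
    show ?thesis using 1 2 AE_space
    proof eventually_elim
      case (elim x)
      then show ?case by (simp only: good_def space_PiM PiE_iff)
    qed
  qed
  have f_eq: "f n x = H n (\<lambda>v\<in>?V. cell n (x v))" if x: "good x" and n: "0 < n" for n x
  proof -
    let ?j = "\<lambda>v\<in>?V. cell n (x v)"
    have j: "?j \<in> ?V \<rightarrow>\<^sub>E {..<n}" using good01[OF x] cell_less[OF n] by (intro restrict_PiE_iff[THEN iffD2] ballI) simp
    have "indicator (Box n j) x = (if j = ?j then 1 else (0::real))" if "j \<in> ?V \<rightarrow>\<^sub>E {..<n}" for j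
    proof -
      have "x \<in> Box n j \<longleftrightarrow> (\<forall>v\<in>?V. cell n (x v) = j v)"
        using x unfolding Box_def good_def by (auto simp only: PiE_iff mem_Collect_eq)
      also have "\<dots> \<longleftrightarrow> j = ?j"
      proof
        assume a: "\<forall>v\<in>?V. cell n (x v) = j v"
        have "j = restrict j ?V" using that by (simp add: PiE_restrict)
        also have "\<dots> = ?j" by (rule restrict_ext, rule bspec[OF a, symmetric])
        finally show "j = ?j" .
      next
        assume "j = ?j"
        then show "\<forall>v\<in>?V. cell n (x v) = j v" by simp
      qed
      finally show ?thesis by (simp add: indicator_def)
    qed
    then have "f n x = (\<Sum>j\<in>?V \<rightarrow>\<^sub>E {..<n}. if j = ?j then H n ?j else 0)"
      unfolding f_def by (intro sum.cong) auto
    also have "\<dots> = H n ?j" using j fin by simp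
    finally show ?thesis .
  qed
  have f_bound: "norm (f n x) \<le> max 0 (B ^ p)" if "good x" for n x
  proof (cases "n = 0")
    case True
    have "?V \<rightarrow>\<^sub>E {..<n} = {}" using True p by (auto simp: PiE_eq_empty_iff)
    then show ?thesis by (simp add: f_def)
  next
    case False
    then have "(\<lambda>v\<in>?V. cell n (x v)) (c t) < n" if "t < p" for t
      using good01[OF \<open>good x\<close>, of "c t"] that \<open>n \<noteq> 0\<close> cell_less[of n "x (c t)"] by simp
    then have "\<bar>\<Prod>t<p. profile_entry \<sigma> n ((\<lambda>v\<in>?V. cell n (x v)) (c t)) ((\<lambda>v\<in>?V. cell n (x v)) (c (Suc t mod p)))\<bar> \<le> B ^ p"
      by (intro abs_profile_prod_le[where w="\<lambda>t. (\<lambda>v\<in>?V. cell n (x v)) (c t)"] B)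
    then have "\<bar>H n (\<lambda>v\<in>?V. cell n (x v))\<bar> \<le> max 0 (B ^ p)"
      unfolding H_def by (cases "inj_on (\<lambda>v\<in>?V. cell n (x v)) ?V") (simp_all only: if_True if_False abs_zero max.cobounded1 le_max_iff_disj simp_thms)
    then show ?thesis using f_eq[OF that] False by simp
  qed
  have f_lim: "(\<lambda>n. f n x) \<longlonglongrightarrow> (\<Prod>t<p. \<sigma> (min (x (c t)) (x (c (Suc t mod p))), max (x (c t)) (x (c (Suc t mod p)))))"
    if x: "good x" for x
  proof -
    note x01 = good01[OF x]
    \<comment> \<open>Distinct coordinates lie in distinct cells for large n, so the restriction to
      injective labellings disappears in the limit.\<close>
    have "eventually (\<lambda>n. cell n (x v) \<noteq> cell n (x v')) sequentially" if "v \<in> ?V" "v' \<in> ?V" "v \<noteq> v'" for v v'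
    proof -
      have "x v \<noteq> x v'" using x that by (auto simp: good_def discontinuity_cover_def)
      then have "(\<lambda>n. real (Suc (cell n (x v))) / real n - real (Suc (cell n (x v'))) / real n) \<longlonglongrightarrow> x v - x v'" "x v - x v' \<noteq> 0"
        using that by (auto intro!: tendsto_diff cell_lim x01 simp del: of_nat_Suc)
      from tendsto_imp_eventually_ne[OF this] show ?thesis by eventually_elim auto
    qed
    then have "eventually (\<lambda>n. v \<noteq> v' \<longrightarrow> cell n (x v) \<noteq> cell n (x v')) sequentially" if "v \<in> ?V" "v' \<in> ?V" for v v'
      using that by (cases "v = v'") simp_all
    then have "eventually (\<lambda>n. \<forall>v\<in>?V. \<forall>v'\<in>?V. v \<noteq> v' \<longrightarrow> cell n (x v) \<noteq> cell n (x v')) sequentially"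
      by (intro eventually_ball_finite fV ballI)
    then have ev: "eventually (\<lambda>n. (\<Prod>t<p. profile_entry \<sigma> n (cell n (x (c t))) (cell n (x (c (Suc t mod p))))) = f n x) sequentially"
      using eventually_gt_at_top[of 0]
    proof eventually_elim
      case (elim n)
      then have "inj_on (\<lambda>v\<in>?V. cell n (x v)) ?V" by (auto simp: inj_on_def)
      moreover have "c (Suc t mod p) \<in> ?V" if "t < p" for t using that by auto
      ultimately have "H n (\<lambda>v\<in>?V. cell n (x v)) = (\<Prod>t<p. profile_entry \<sigma> n (cell n (x (c t))) (cell n (x (c (Suc t mod p)))))"
        unfolding H_def by (simp only: if_True) (rule prod.cong, simp_all)
      then show ?case using f_eq[OF x] elim by simp
    qed
    have "(\<lambda>n. \<Prod>t<p. profile_entry \<sigma> n (cell n (x (c t))) (cell n (x (c (Suc t mod p))))) \<longlonglongrightarrow>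
       (\<Prod>t<p. \<sigma> (min (x (c t)) (x (c (Suc t mod p))), max (x (c t)) (x (c (Suc t mod p)))))"
    proof (intro tendsto_prod profile_entry_cell_lim)
      fix t assume t: "t \<in> {..<p}"
      have V: "c t \<in> ?V" "c (Suc t mod p) \<in> ?V" using t by auto
      show 01: "x (c t) \<in> {0..<1}" "x (c (Suc t mod p)) \<in> {0..<1}" using x01 V by auto
      show "isCont \<sigma> (min (x (c t)) (x (c (Suc t mod p))), max (x (c t)) (x (c (Suc t mod p))))"
      proof (rule piecewise_isCont[OF \<P>(2,4)])
        show "(min (x (c t)) (x (c (Suc t mod p))), max (x (c t)) (x (c (Suc t mod p)))) \<in> unit_square"
          using 01 by (auto simp: unit_square_def)
        have "c t \<noteq> c (Suc t mod p)" using nl t by auto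
        \<comment> \<open>Both orders are required, because min and max may swap the two
          coordinates.\<close>
        then have "(x (c t), x (c (Suc t mod p))) \<notin> ?N" "(x (c (Suc t mod p)), x (c t)) \<notin> ?N"
          using good_pair[OF x V] good_pair[OF x V(2,1)] by metis+
        then show "(min (x (c t)) (x (c (Suc t mod p))), max (x (c t)) (x (c (Suc t mod p)))) \<notin> ?N"
          by (simp add: min_def max_def)
      qed
    qed
    then show ?thesis by (rule Lim_transform_eventually[OF _ ev])
  qed
  \<comment> \<open>Using \<open>lim\<close> gives a limit function that is measurable on the whole
    space, also where the sequence need not converge.\<close>
  have "(\<lambda>n. LINT x|?P. f n x) \<longlonglongrightarrow> (LINT x|?P. lim (\<lambda>n. f n x))"
  proof (rule integral_dominated_convergence[where w="\<lambda>_. max 0 (B ^ p)"])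
    show "(\<lambda>x. lim (\<lambda>n. f n x)) \<in> borel_measurable ?P" by (rule borel_measurable_lim_metric) simp
    show "AE x in ?P. (\<lambda>n. f n x) \<longlonglongrightarrow> lim (\<lambda>n. f n x)"
      using AE_good
    proof eventually_elim
      case (elim x)
      from f_lim[OF this] limI[OF f_lim[OF this]] show ?case by simp
    qed
    show "AE x in ?P. norm (f n x) \<le> max 0 (B ^ p)" for n
      using AE_good by eventually_elim (rule f_bound)
  qed auto
  then show ?thesis unfolding f_int by (auto simp: convergent_def)
qed

section \<open>The limit of the expected moments\<close>

abbreviation cyc_blocks :: "nat \<Rightarrow> (nat \<Rightarrow> nat) \<Rightarrow> nat set set" where
  "cyc_blocks p w \<equiv> blocks (cyc_edge p w) {..<p}"

text \<open>Each letter is replaced by the first position at which it occurs, which selects one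
  representative of the words with the same pattern of coincidences.\<close>

definition canon :: "nat \<Rightarrow> (nat \<Rightarrow> nat) \<Rightarrow> nat \<Rightarrow> nat" where
  "canon p w = (\<lambda>t\<in>{..<p}. LEAST s. s < p \<and> w s = w t)"

definition canonical_words :: "nat \<Rightarrow> (nat \<Rightarrow> nat) set" where
  "canonical_words p = {c \<in> words p p. canon p c = c}"

lemma canon_props:
  assumes "t < p"
  shows "canon p w t < p" "w (canon p w t) = w t"
proof -
  have "(LEAST s. s < p \<and> w s = w t) < p \<and> w (LEAST s. s < p \<and> w s = w t) = w t"
    by (rule LeastI[of "\<lambda>s. s < p \<and> w s = w t" t]) (use assms in simp)
  then show "canon p w t < p" "w (canon p w t) = w t" using assms by (simp_all add: canon_def)
qed

lemma canon_cong:
  assumes "\<And>s t. s < p \<Longrightarrow> t < p \<Longrightarrow> w s = w t \<longleftrightarrow> w' s = w' t"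
  shows "canon p w = canon p w'"
proof
  fix t
  show "canon p w t = canon p w' t"
  proof (cases "t < p")
    case True
    then have "(\<lambda>s. s < p \<and> w s = w t) = (\<lambda>s. s < p \<and> w' s = w' t)" using assms by (auto simp: fun_eq_iff)
    then show ?thesis using True by (simp add: canon_def)
  qed (simp add: canon_def)
qed

lemma canon_kernel:
  assumes "s < p" "t < p"
  shows "canon p w s = canon p w t \<longleftrightarrow> w s = w t"
proof
  assume "canon p w s = canon p w t"
  then show "w s = w t" using canon_props(2)[OF assms(1), of w] canon_props(2)[OF assms(2), of w] by simp
qed (use assms in \<open>simp add: canon_def\<close>)

lemma canon_in_canonical_words: "canon p w \<in> canonical_words p"
proof -
  have "canon p w \<in> words p p"
  proof (rule PiE_I)
    show "canon p w t \<in> {..<p}" if "t \<in> {..<p}" for t using that canon_props(1) by simp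
    show "canon p w t = undefined" if "t \<notin> {..<p}" for t using that by (simp add: canon_def)
  qed
  moreover have "canon p (canon p w) = canon p w" by (rule canon_cong) (simp add: canon_kernel)
  ultimately show ?thesis by (simp add: canonical_words_def)
qed

lemma finite_canonical_words [simp]: "finite (canonical_words p)"
  unfolding canonical_words_def by (rule finite_subset[of _ "words p p"]) (auto intro!: finite_PiE)

lemma canonical_idem: "c \<in> canonical_words p \<Longrightarrow> t < p \<Longrightarrow> c (c t) = c t"
  using canon_props(2)[of t p c] by (simp add: canonical_words_def)

lemma finite_words: "finite (words p n)" for p :: nat
  by (rule finite_PiE) auto

text \<open>A word splits uniquely into its pattern of coincidences and an injective labelling of
  the letters of that pattern.\<close>

lemma sum_words_by_kernel:
  fixes F :: "(nat \<Rightarrow> nat) \<Rightarrow> real"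
  shows "(\<Sum>w\<in>words p n. F w) =
    (\<Sum>c\<in>canonical_words p. \<Sum>j\<in>labellings (c ` {..<p}) n. F (\<lambda>t\<in>{..<p}. j (c t)))"
proof -
  let ?J = "\<lambda>c. labellings (c ` {..<p}) n"
  let ?S = "SIGMA c:canonical_words p. ?J c"
  let ?\<Phi> = "\<lambda>(c, j). (\<lambda>t\<in>{..<p}. j (c t)) :: nat \<Rightarrow> nat"
  \<comment> \<open>The letters of a canonical word are positions, so \<open>w\<close> itself,
    restricted to them, is the labelling.\<close>
  let ?\<Psi> = "\<lambda>w. (canon p w, restrict w (canon p w ` {..<p}))"
  have "(\<Sum>(c, j)\<in>?S. F (\<lambda>t\<in>{..<p}. j (c t))) = (\<Sum>w\<in>words p n. F w)"
  proof (rule sum.reindex_bij_witness[where i = ?\<Psi> and j = ?\<Phi>])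
    fix cj assume cj: "cj \<in> ?S"
    obtain c j where cj_eq: "cj = (c, j)" by (cases cj)
    have c: "c \<in> canonical_words p" and j: "j \<in> c ` {..<p} \<rightarrow>\<^sub>E {..<n}" "inj_on j (c ` {..<p})"
      using cj cj_eq by auto
    have "canon p (\<lambda>t\<in>{..<p}. j (c t)) = canon p c"
      by (rule canon_cong) (use j(2) in \<open>simp add: inj_on_eq_iff\<close>)
    also have "\<dots> = c" using c by (simp add: canonical_words_def)
    finally have 1: "canon p (\<lambda>t\<in>{..<p}. j (c t)) = c" .
    have "restrict (\<lambda>t\<in>{..<p}. j (c t)) (c ` {..<p}) = j"
    proof
      fix v
      show "restrict (\<lambda>t\<in>{..<p}. j (c t)) (c ` {..<p}) v = j v"
      proof (cases "v \<in> c ` {..<p}")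
        case True
        then obtain t where t: "t < p" "v = c t" by auto
        have "c t < p" using c t(1) by (auto simp: canonical_words_def dest: PiE_mem)
        then show ?thesis using True t canonical_idem[OF c t(1)] by simp
      next
        case False
        then show ?thesis using PiE_arb[OF j(1)] by simp
      qed
    qed
    with 1 show "?\<Psi> (?\<Phi> cj) = cj" by (simp add: cj_eq)
    show "?\<Phi> cj \<in> words p n" using PiE_mem[OF j(1)] by (auto simp: cj_eq)
    show "F (?\<Phi> cj) = (case cj of (c, j) \<Rightarrow> F (\<lambda>t\<in>{..<p}. j (c t)))" by (simp add: cj_eq)
  next
    fix w assume w: "w \<in> words p n"
    let ?c = "canon p w"
    have V: "?c ` {..<p} \<subseteq> {..<p}" using canon_props(1) by auto
    show "?\<Phi> (?\<Psi> w) = w"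
    proof
      fix t show "?\<Phi> (?\<Psi> w) t = w t"
        using canon_props(2)[of t p w] PiE_arb[OF w] by (cases "t < p") auto
    qed
    have "restrict w (?c ` {..<p}) \<in> ?c ` {..<p} \<rightarrow>\<^sub>E {..<n}"
      using V PiE_mem[OF w] by (intro restrict_PiE_iff[THEN iffD2] ballI) blast
    moreover have "inj_on (restrict w (?c ` {..<p})) (?c ` {..<p})"
    proof (rule inj_onI)
      fix a b assume "a \<in> ?c ` {..<p}" "b \<in> ?c ` {..<p}"
        and e: "restrict w (?c ` {..<p}) a = restrict w (?c ` {..<p}) b"
      then obtain s t where st: "s < p" "t < p" "a = ?c s" "b = ?c t" by auto
      then have "w s = w t" using e canon_props(2)[of _ p w] by simp
      then show "a = b" using st canon_kernel by simp
    qed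
    ultimately show "?\<Psi> w \<in> ?S" using canon_in_canonical_words by simp
  qed
  moreover have "finite (?J c)" for c
    by (rule finite_subset[of _ "c ` {..<p} \<rightarrow>\<^sub>E {..<n}"]) (auto intro!: finite_PiE)
  then have "(\<Sum>c\<in>canonical_words p. \<Sum>j\<in>?J c. F (\<lambda>t\<in>{..<p}. j (c t))) = (\<Sum>(c, j)\<in>?S. F (\<lambda>t\<in>{..<p}. j (c t)))"
    by (intro sum.Sigma finite_canonical_words ballI)
  ultimately show ?thesis by (simp only:)
qed

section \<open>Tree patterns and the limit moments\<close>

text \<open>The graph of a closed walk is connected, so this equation says that it is a tree.\<close>

definition is_tree :: "nat \<Rightarrow> (nat \<Rightarrow> nat) \<Rightarrow> bool" where
  "is_tree p c \<longleftrightarrow> card (c ` {..<p}) = card (cyc_edges p c) + 1"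

lemma cyc_walk_edges: "walk_edge (\<lambda>t. c (t mod p)) ` {..<p} = cyc_edges p c"
  by (intro image_cong) (simp_all add: cyc_edge_eq_walk_edge)

lemma is_tree_iff_walk_tree: "0 < p \<Longrightarrow> is_tree p c \<longleftrightarrow> walk_tree (\<lambda>t. c (t mod p)) p"
  unfolding is_tree_def walk_tree_def cyc_image cyc_walk_edges ..

lemma cyc_card_le: "0 < p \<Longrightarrow> card (c ` {..<p}) \<le> card (cyc_edges p c) + 1"
  using walk_card_le[of "\<lambda>t. c (t mod p)" p] by (simp only: cyc_image cyc_walk_edges)

lemma is_tree_no_loop:
  assumes "is_tree p c" "t < p"
  shows "c t \<noteq> c (Suc t mod p)"
proof -
  have "walk_tree (\<lambda>t. c (t mod p)) p" using assms is_tree_iff_walk_tree by auto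
  from walk_tree_no_loop[OF this assms(2)] show ?thesis using assms(2) by simp
qed

lemma tree_profile_sum_lim:
  assumes "bounded (\<sigma> ` unit_square)" "piecewise_continuous_on_square \<sigma>" "0 < p" "is_tree p c"
  shows "profile_sum \<sigma> p c \<longlonglongrightarrow> lim (profile_sum \<sigma> p c)"
proof -
  have "convergent (profile_sum \<sigma> p c)"
    by (rule profile_sum_convergent) (use assms is_tree_no_loop in auto)
  then show ?thesis by (simp only: convergent_LIMSEQ_iff)
qed

lemma is_tree_blocks_even:
  assumes "is_tree p c" "0 < p" "B \<in> cyc_blocks p c"
  shows "even (card B)"
proof -
  have w: "walk_tree (\<lambda>t. c (t mod p)) p" using assms is_tree_iff_walk_tree by auto
  obtain s where s: "s < p" "B = {t \<in> {..<p}. cyc_edge p c t = cyc_edge p c s}"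
    using assms(3) by (auto simp: blocks_def)
  have "B = {t. t < p \<and> walk_edge (\<lambda>t. c (t mod p)) t = cyc_edge p c s}"
    unfolding s(2) by (rule Collect_cong) (simp add: cyc_edge_eq_walk_edge cong: conj_cong)
  then show ?thesis using closed_walk_tree_even[OF w, of "cyc_edge p c s"] by simp
qed

lemma block_card_bounds:
  assumes "finite T" "B \<in> blocks h T"
  shows "1 \<le> card B" "card B \<le> card T"
proof -
  obtain s where "s \<in> T" "B = {t\<in>T. h t = h s}" using assms(2) by (auto simp: blocks_def)
  then have "s \<in> B" "B \<subseteq> T" by auto
  then show "1 \<le> card B" "card B \<le> card T"
    using assms(1) by (auto simp: Suc_le_eq card_gt_0_iff intro: finite_subset card_mono)
qed

text \<open>The length is the sum of the block sizes, all of them even. This makes the odd limit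
  moments vanish and the limit law symmetric.\<close>

lemma is_tree_even_length:
  assumes "is_tree p c" "0 < p"
  shows "even p"
proof -
  have "p = card (\<Union>(cyc_blocks p c))"
    using partition_onD1[OF partition_on_blocks[of "{..<p}" "cyc_edge p c"]] by simp
  also have "\<dots> = (\<Sum>B\<in>cyc_blocks p c. card B)"
    using partition_onD2[OF partition_on_blocks[of "{..<p}" "cyc_edge p c"]]
    by (intro card_Union_disjoint) (auto simp: blocks_def)
  also have "even \<dots>" using is_tree_blocks_even[OF assms] by (intro dvd_sum) auto
  finally show ?thesis .
qed

lemma is_tree_inj_blocks:
  assumes p: "0 < p"
  shows "inj_on (\<lambda>c. cyc_blocks p c) {c \<in> canonical_words p. is_tree p c}"
proof (rule inj_onI)
  fix c d assume c: "c \<in> {c \<in> canonical_words p. is_tree p c}" and d: "d \<in> {c \<in> canonical_words p. is_tree p c}"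
    and e: "cyc_blocks p c = cyc_blocks p d"
  let ?u = "\<lambda>t. c (t mod p)" and ?v = "\<lambda>t. d (t mod p)"
  have tr: "walk_tree ?u p" "walk_tree ?v p" using c d is_tree_iff_walk_tree[OF p] by auto
  have k: "?u s = ?u t \<longleftrightarrow> ?v s = ?v t" if "s \<le> p" "t \<le> p" for s t
  proof (rule walk_tree_kernel[OF tr _ that])
    fix s t assume st: "s < p" "t < p"
    show "walk_edge ?u s = walk_edge ?u t \<longleftrightarrow> walk_edge ?v s = walk_edge ?v t"
      using blocks_eqD[OF e, of s t] st
      by (simp only: cyc_edge_eq_walk_edge lessThan_iff)
  qed
  have "canon p c = canon p d"
  proof (rule canon_cong)
    fix s t assume "s < p" "t < p"
    then show "c s = c t \<longleftrightarrow> d s = d t" using k[of s t] by simp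
  qed
  then show "c = d" using c d by (simp add: canonical_words_def)
qed

text \<open>Order 0 is set by hand: the empty word has no vertices, so \<open>is_tree 0\<close>
  fails and the sum would give 0 in place of the total mass 1.\<close>

definition limit_moment :: "(real \<times> real \<Rightarrow> real) \<Rightarrow> (nat \<Rightarrow> real) \<Rightarrow> nat \<Rightarrow> real" where
  "limit_moment \<sigma> C p = (if p = 0 then 1 else \<Sum>c\<in>{c \<in> canonical_words p. is_tree p c}.
     (\<Prod>B\<in>cyc_blocks p c. C (card B)) * lim (profile_sum \<sigma> p c))"

lemma limit_moment_odd: "odd p \<Longrightarrow> limit_moment \<sigma> C p = 0"
  using is_tree_even_length[of p] by (auto simp: limit_moment_def odd_pos intro!: sum.neutral)

text \<open>The blocks of a tree pattern have even size at most p, so only constants of these orders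
  enter.\<close>

lemma limit_moment_cong:
  assumes "\<And>z. z \<in> unit_square \<Longrightarrow> \<sigma>' z = \<sigma> z" "\<And>m. 1 \<le> m \<Longrightarrow> 2 * m \<le> p \<Longrightarrow> C' (2 * m) = C (2 * m)"
  shows "limit_moment \<sigma>' C' p = limit_moment \<sigma> C p"
proof (cases "p = 0")
  case False
  have "profile_sum \<sigma>' p c = profile_sum \<sigma> p c" for c
    using profile_sum_cong[of \<sigma>' \<sigma>] assms(1) by blast
  moreover have "C' (card B) = C (card B)" if c: "is_tree p c" and B: "B \<in> cyc_blocks p c" for c B
  proof -
    obtain m where "card B = 2 * m" using is_tree_blocks_even[OF c _ B] False by (auto elim: evenE)
    then show ?thesis using assms(2)[of m] block_card_bounds[OF finite_lessThan B] by simp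
  qed
  ultimately show ?thesis using False by (auto simp: limit_moment_def intro!: sum.cong prod.cong)
qed (simp add: limit_moment_def)

text \<open>Tree patterns inject into partitions by \<open>is_tree_inj_blocks\<close>, and the
  remaining partitions have nonnegative weight, so the sum may be extended to all of them. With odd
  weights set to 0, the weights are the cumulants of the law in
  \<open>cumulant_condition\<close>.\<close>

lemma limit_moment_bound:
  assumes B: "\<And>z. z \<in> unit_square \<Longrightarrow> \<bar>\<sigma> z\<bar> \<le> B" and B0: "0 \<le> B"
    and bdd: "bounded (\<sigma> ` unit_square)" and pc: "piecewise_continuous_on_square \<sigma>"
    and C0: "\<And>k. 1 \<le> k \<Longrightarrow> 0 \<le> C (2 * k)"
  shows "\<bar>limit_moment \<sigma> C p\<bar> \<le> B ^ p * partition_sum (\<lambda>k. if even k then C k else 0) {..<p}"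
proof (cases "p = 0")
  case True
  then show ?thesis by (simp add: limit_moment_def partition_sum_empty)
next
  case False
  then have p: "0 < p" by simp
  define \<kappa> where "\<kappa> = (\<lambda>k. if even k then C k else 0)"
  let ?D = "{c \<in> canonical_words p. is_tree p c}" and ?b = "\<lambda>c. cyc_blocks p c"
  have \<kappa>0: "0 \<le> \<kappa> k" if "1 \<le> k" for k using C0[of "k div 2"] that by (auto simp: \<kappa>_def elim!: evenE)
  have "\<bar>limit_moment \<sigma> C p\<bar> \<le> (\<Sum>c\<in>?D. \<bar>(\<Prod>B\<in>?b c. C (card B)) * lim (profile_sum \<sigma> p c)\<bar>)"
    using False by (simp add: limit_moment_def)
  also have "\<dots> \<le> (\<Sum>c\<in>?D. B ^ p * (\<Prod>A\<in>?b c. \<kappa> (card A)))"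
  proof (rule sum_mono)
    fix c assume "c \<in> ?D"
    then have c: "is_tree p c" by simp
    have "(\<lambda>n. \<bar>profile_sum \<sigma> p c n\<bar>) \<longlonglongrightarrow> \<bar>lim (profile_sum \<sigma> p c)\<bar>"
      by (rule tendsto_rabs[OF tree_profile_sum_lim[OF bdd pc p c]])
    then have l: "\<bar>lim (profile_sum \<sigma> p c)\<bar> \<le> B ^ p"
      by (rule LIMSEQ_le_const2) (intro exI allI impI profile_sum_bound B B0)
    have eq: "(\<Prod>A\<in>?b c. C (card A)) = (\<Prod>A\<in>?b c. \<kappa> (card A))"
      using is_tree_blocks_even[OF c p] by (intro prod.cong) (auto simp: \<kappa>_def)
    have nn: "0 \<le> (\<Prod>A\<in>?b c. \<kappa> (card A))"
      using block_card_bounds(1)[OF finite_lessThan] \<kappa>0 by (intro prod_nonneg) blast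
    show "\<bar>(\<Prod>A\<in>?b c. C (card A)) * lim (profile_sum \<sigma> p c)\<bar> \<le> B ^ p * (\<Prod>A\<in>?b c. \<kappa> (card A))"
      unfolding eq abs_mult abs_of_nonneg[OF nn] mult.commute[of "B ^ p"] by (rule mult_left_mono[OF l nn])
  qed
  also have "\<dots> = B ^ p * (\<Sum>\<pi>\<in>?b ` ?D. \<Prod>A\<in>\<pi>. \<kappa> (card A))"
    by (simp add: sum_distrib_left sum.reindex[OF is_tree_inj_blocks[OF p]])
  also have "\<dots> \<le> B ^ p * partition_sum \<kappa> {..<p}"
    unfolding partition_sum_def
  proof (intro mult_left_mono sum_mono2 finite_partitions)
    show "?b ` ?D \<subseteq> {\<pi>. partition_on {..<p} \<pi>}" using partition_on_blocks by blast
    fix \<pi> assume "\<pi> \<in> {\<pi>. partition_on {..<p} \<pi>} - ?b ` ?D"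
    then have \<pi>: "partition_on {..<p} \<pi>" by simp
    show "0 \<le> (\<Prod>A\<in>\<pi>. \<kappa> (card A))"
    proof (rule prod_nonneg)
      fix A assume "A \<in> \<pi>"
      then have "A \<noteq> {}" "A \<subseteq> {..<p}" using \<pi> by (auto simp: partition_on_def)
      then show "0 \<le> \<kappa> (card A)" by (intro \<kappa>0) (auto simp: Suc_le_eq card_gt_0_iff intro: finite_subset)
    qed
  qed (use B0 in auto)
  finally show ?thesis by (simp add: \<kappa>_def)
qed

text \<open>If \<open>m\<close> lists the moments of one entry, this is by independence the
  expectation of the product over \<open>T\<close> of the entries with index
  \<open>h t\<close>.\<close>

definition block_moments :: "(nat \<Rightarrow> real) \<Rightarrow> ('a \<Rightarrow> 'b) \<Rightarrow> 'a set \<Rightarrow> real" where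
  "block_moments m h T = (\<Prod>B\<in>blocks h T. m (card B))"

lemma cyc_edge_relabel_kernel:
  assumes j: "inj_on j (c ` {..<p})" and st: "s < p" "t < p"
  shows "cyc_edge p (\<lambda>t\<in>{..<p}. j (c t)) s = cyc_edge p (\<lambda>t\<in>{..<p}. j (c t)) t \<longleftrightarrow> cyc_edge p c s = cyc_edge p c t"
proof -
  have m: "Suc s mod p < p" "Suc t mod p < p" using st by auto
  have "cyc_edge p (\<lambda>t\<in>{..<p}. j (c t)) s = cyc_edge p (\<lambda>t\<in>{..<p}. j (c t)) t \<longleftrightarrow>
     j ` {c s, c (Suc s mod p)} = j ` {c t, c (Suc t mod p)}"
    using st m by (simp add: cyc_edge_def edge_eq_iff)
  also have "\<dots> \<longleftrightarrow> {c s, c (Suc s mod p)} = {c t, c (Suc t mod p)}"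
    by (rule inj_on_image_eq_iff[OF j]) (use st m in auto)
  finally show ?thesis by (simp add: cyc_edge_def edge_eq_iff)
qed

lemma expected_trace_eq:
  fixes m :: "nat \<Rightarrow> real"
  shows "(\<Sum>w\<in>words p n. (\<Prod>t<p. profile_entry \<sigma> n (w t) (w (Suc t mod p))) * block_moments m (cyc_edge p w) {..<p}) =
    (\<Sum>c\<in>canonical_words p. block_moments m (cyc_edge p c) {..<p} * (real n ^ card (c ` {..<p}) * profile_sum \<sigma> p c n))"
  unfolding sum_words_by_kernel
proof (rule sum.cong[OF refl])
  fix c :: "nat \<Rightarrow> nat"
  let ?J = "labellings (c ` {..<p}) n"
  have "(\<Sum>j\<in>?J. (\<Prod>t<p. profile_entry \<sigma> n ((\<lambda>t\<in>{..<p}. j (c t)) t) ((\<lambda>t\<in>{..<p}. j (c t)) (Suc t mod p))) *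
        block_moments m (cyc_edge p (\<lambda>t\<in>{..<p}. j (c t))) {..<p}) =
     (\<Sum>j\<in>?J. (\<Prod>t<p. profile_entry \<sigma> n (j (c t)) (j (c (Suc t mod p)))) * block_moments m (cyc_edge p c) {..<p})"
  proof (rule sum.cong[OF refl])
    fix j assume "j \<in> ?J"
    then have j: "inj_on j (c ` {..<p})" by simp
    have "blocks (cyc_edge p (\<lambda>t\<in>{..<p}. j (c t))) {..<p} = cyc_blocks p c"
      using cyc_edge_relabel_kernel[OF j] by (intro blocks_cong) (simp only: lessThan_iff)
    moreover have "(\<Prod>t<p. profile_entry \<sigma> n ((\<lambda>t\<in>{..<p}. j (c t)) t) ((\<lambda>t\<in>{..<p}. j (c t)) (Suc t mod p))) =
       (\<Prod>t<p. profile_entry \<sigma> n (j (c t)) (j (c (Suc t mod p))))"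
      by (rule prod.cong) auto
    ultimately show "(\<Prod>t<p. profile_entry \<sigma> n ((\<lambda>t\<in>{..<p}. j (c t)) t) ((\<lambda>t\<in>{..<p}. j (c t)) (Suc t mod p))) *
        block_moments m (cyc_edge p (\<lambda>t\<in>{..<p}. j (c t))) {..<p} =
        (\<Prod>t<p. profile_entry \<sigma> n (j (c t)) (j (c (Suc t mod p)))) * block_moments m (cyc_edge p c) {..<p}"
      by (simp only: block_moments_def)
  qed
  also have "\<dots> = block_moments m (cyc_edge p c) {..<p} * (real n ^ card (c ` {..<p}) * profile_sum \<sigma> p c n)"
  proof (cases "real n ^ card (c ` {..<p}) = 0")
    case True
    then have "n = 0" "c ` {..<p} \<noteq> {}" by auto
    then have J: "?J = {}" by (auto simp: PiE_eq_empty_iff)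
    show ?thesis unfolding J True by simp
  next
    case False
    then show ?thesis by (simp add: profile_sum_def sum_distrib_right[symmetric])
  qed
  finally show "(\<Sum>j\<in>?J. (\<Prod>t<p. profile_entry \<sigma> n ((\<lambda>t\<in>{..<p}. j (c t)) t) ((\<lambda>t\<in>{..<p}. j (c t)) (Suc t mod p))) *
        block_moments m (cyc_edge p (\<lambda>t\<in>{..<p}. j (c t))) {..<p}) =
     block_moments m (cyc_edge p c) {..<p} * (real n ^ card (c ` {..<p}) * profile_sum \<sigma> p c n)" .
qed

text \<open>For a tree v - 1 = e, so each edge moment receives exactly one factor n and converges by
  \<open>ev\<close>. Otherwise v - 1 falls short of e by at least one, and this slack pays for the
  loss \<epsilon> in \<open>sm\<close>.\<close>

theorem expected_trace_limit:
  fixes \<mu> :: "nat \<Rightarrow> nat \<Rightarrow> real"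
  assumes bdd: "bounded (\<sigma> ` unit_square)" and pc: "piecewise_continuous_on_square \<sigma>" and p: "0 < p"
    and ev: "\<And>k. 1 \<le> k \<Longrightarrow> (\<lambda>n. real n * \<mu> n (2 * k)) \<longlonglongrightarrow> C (2 * k)"
    and sm: "\<And>k \<epsilon>. 1 \<le> k \<Longrightarrow> 0 < \<epsilon> \<Longrightarrow> (\<lambda>n. real n powr (1 - \<epsilon>) * \<mu> n k) \<longlonglongrightarrow> 0"
  shows "(\<lambda>n. (\<Sum>w\<in>words p n. (\<Prod>t<p. profile_entry \<sigma> n (w t) (w (Suc t mod p))) *
           block_moments (\<mu> n) (cyc_edge p w) {..<p}) / real n) \<longlonglongrightarrow> limit_moment \<sigma> C p"
proof -
  obtain B0 where B0: "\<And>z. z \<in> unit_square \<Longrightarrow> \<bar>\<sigma> z\<bar> \<le> B0" using bdd by (auto simp: bounded_iff)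
  define B where "B = max 0 B0"
  have B: "\<And>z. z \<in> unit_square \<Longrightarrow> \<bar>\<sigma> z\<bar> \<le> B" "0 \<le> B" using B0 by (auto simp: B_def le_max_iff_disj)
  let ?L = "\<lambda>c. if is_tree p c then (\<Prod>B\<in>cyc_blocks p c. C (card B)) * lim (profile_sum \<sigma> p c) else 0"
  have "(\<lambda>n. block_moments (\<mu> n) (cyc_edge p c) {..<p} * (real n ^ card (c ` {..<p}) * profile_sum \<sigma> p c n) / real n) \<longlonglongrightarrow> ?L c" for c
  proof -
    let ?b = "cyc_blocks p c"
    have b1: "1 \<le> card A" if "A \<in> ?b" for A using block_card_bounds(1)[OF finite_lessThan that] .
    have cb: "card ?b = card (cyc_edges p c)" by (rule card_blocks)
    show ?thesis
    proof (cases "is_tree p c")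
      case True
      have eq: "(\<Prod>A\<in>?b. real n * \<mu> n (card A)) * profile_sum \<sigma> p c n =
          block_moments (\<mu> n) (cyc_edge p c) {..<p} * (real n ^ card (c ` {..<p}) * profile_sum \<sigma> p c n) / real n" if "0 < n" for n
        using that True by (simp add: block_moments_def prod.distrib is_tree_def cb)
      have "(\<lambda>n. (\<Prod>A\<in>?b. real n * \<mu> n (card A)) * profile_sum \<sigma> p c n) \<longlonglongrightarrow>
         (\<Prod>A\<in>?b. C (card A)) * lim (profile_sum \<sigma> p c)"
      proof (intro tendsto_mult tendsto_prod)
        fix A assume A: "A \<in> ?b"
        obtain k where k: "card A = 2 * k" using is_tree_blocks_even[OF True p A] by (auto elim: evenE)
        with b1[OF A] have "1 \<le> k" by simp
        from ev[OF this] show "(\<lambda>n. real n * \<mu> n (card A)) \<longlonglongrightarrow> C (card A)" by (simp only: k)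
      next
        show "profile_sum \<sigma> p c \<longlonglongrightarrow> lim (profile_sum \<sigma> p c)"
          by (rule tree_profile_sum_lim[OF bdd pc p True])
      qed
      then have "(\<lambda>n. block_moments (\<mu> n) (cyc_edge p c) {..<p} * (real n ^ card (c ` {..<p}) * profile_sum \<sigma> p c n) / real n)
         \<longlonglongrightarrow> (\<Prod>A\<in>?b. C (card A)) * lim (profile_sum \<sigma> p c)"
        by (rule Lim_transform_eventually[OF _ eventually_mono[OF eventually_gt_at_top[of 0] eq]])
      then show ?thesis using True by simp
    next
      case False
      define q where "q = card ?b"
      have q1: "1 \<le> q" unfolding q_def cb using p by (auto simp: Suc_le_eq card_gt_0_iff)
      have V: "card (c ` {..<p}) \<le> q"
        using cyc_card_le[OF p, of c] False unfolding is_tree_def q_def cb by linarith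
      have bound: "norm (block_moments (\<mu> n) (cyc_edge p c) {..<p} * (real n ^ card (c ` {..<p}) * profile_sum \<sigma> p c n) / real n)
         \<le> (\<Prod>A\<in>?b. \<bar>real n powr (1 - 1 / real q) * \<mu> n (card A)\<bar>) * B ^ p" if n: "0 < n" for n
      proof -
        have "real n ^ card (c ` {..<p}) / real n \<le> real n ^ q / real n"
          using n V by (intro divide_right_mono power_increasing) auto
        also have "\<dots> = real n powr (real q - 1)"
          using n by (simp add: powr_diff powr_realpow)
        \<comment> \<open>The exponent q - 1 is shared equally among the q edges: each moment is
          scaled by n^(1 - 1/q) and tends to 0 by \<open>sm\<close>.\<close>
        also have "\<dots> = (real n powr (1 - 1 / real q)) ^ q"
          using n q1 by (simp add: powr_realpow[symmetric] powr_powr left_diff_distrib)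
        finally have le: "real n ^ card (c ` {..<p}) / real n \<le> (real n powr (1 - 1 / real q)) ^ q" .
        have "norm (block_moments (\<mu> n) (cyc_edge p c) {..<p} * (real n ^ card (c ` {..<p}) * profile_sum \<sigma> p c n) / real n)
          = (\<Prod>A\<in>?b. \<bar>\<mu> n (card A)\<bar>) * (real n ^ card (c ` {..<p}) / real n) * \<bar>profile_sum \<sigma> p c n\<bar>"
          by (simp add: block_moments_def abs_mult abs_prod)
        also have "\<dots> \<le> (\<Prod>A\<in>?b. \<bar>\<mu> n (card A)\<bar>) * (real n powr (1 - 1 / real q)) ^ q * B ^ p"
          by (intro mult_mono mult_left_mono le profile_sum_bound B mult_nonneg_nonneg prod_nonneg) auto
        also have "\<dots> = (\<Prod>A\<in>?b. \<bar>real n powr (1 - 1 / real q) * \<mu> n (card A)\<bar>) * B ^ p"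
          by (simp add: abs_mult prod.distrib q_def)
        finally show ?thesis .
      qed
      have "(\<lambda>n. (\<Prod>A\<in>?b. \<bar>real n powr (1 - 1 / real q) * \<mu> n (card A)\<bar>) * B ^ p) \<longlonglongrightarrow> (\<Prod>A\<in>?b. \<bar>0\<bar>) * B ^ p"
        using q1 b1 by (intro tendsto_intros sm) auto
      then have "(\<lambda>n. (\<Prod>A\<in>?b. \<bar>real n powr (1 - 1 / real q) * \<mu> n (card A)\<bar>) * B ^ p) \<longlonglongrightarrow> 0"
        using q1 by (simp add: q_def[symmetric] power_0_left)
      then show ?thesis using False
        by (simp only: if_False) (rule Lim_null_comparison[OF eventually_mono[OF eventually_gt_at_top[of 0] bound]])
    qed
  qed
  then have "(\<lambda>n. \<Sum>c\<in>canonical_words p. block_moments (\<mu> n) (cyc_edge p c) {..<p} * (real n ^ card (c ` {..<p}) * profile_sum \<sigma> p c n) / real n)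
     \<longlonglongrightarrow> (\<Sum>c\<in>canonical_words p. ?L c)" by (rule tendsto_sum)
  moreover have "(\<Sum>c\<in>canonical_words p. ?L c) = limit_moment \<sigma> C p"
    using p by (simp add: limit_moment_def sum.inter_filter)
  ultimately show ?thesis by (simp only: expected_trace_eq sum_divide_distrib)
qed

section \<open>The fourth centred moment\<close>

lemma block_moments_alt:
  "block_moments m h T = (\<Prod>e\<in>h ` T. m (card {t\<in>T. h t = e}))"
  by (simp add: block_moments_def prod_blocks)

lemma block_moments_reindex:
  assumes "inj_on \<phi> T"
  shows "block_moments m h (\<phi> ` T) = block_moments m (\<lambda>t. h (\<phi> t)) T"
proof -
  have "card {t \<in> \<phi> ` T. h t = e} = card {t \<in> T. h (\<phi> t) = e}" for e
  proof -
    have "{t \<in> \<phi> ` T. h t = e} = \<phi> ` {t \<in> T. h (\<phi> t) = e}" by auto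
    then show ?thesis using assms by (simp add: card_image inj_on_subset)
  qed
  then show ?thesis by (simp add: block_moments_alt image_image)
qed

lemma block_moments_Un:
  assumes "finite T1" "finite T2" "T1 \<inter> T2 = {}" "h ` T1 \<inter> h ` T2 = {}"
  shows "block_moments m h (T1 \<union> T2) = block_moments m h T1 * block_moments m h T2"
proof -
  have "block_moments m h (T1 \<union> T2) =
      (\<Prod>e\<in>h ` T1. m (card {t\<in>T1 \<union> T2. h t = e})) * (\<Prod>e\<in>h ` T2. m (card {t\<in>T1 \<union> T2. h t = e}))"
    unfolding block_moments_alt image_Un using assms by (intro prod.union_disjoint) auto
  also have "(\<Prod>e\<in>h ` T1. m (card {t\<in>T1 \<union> T2. h t = e})) = block_moments m h T1"
    unfolding block_moments_alt
  proof (rule prod.cong[OF refl])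
    fix e assume "e \<in> h ` T1"
    then have "e \<notin> h ` T2" using assms(4) by blast
    then have "{t\<in>T1 \<union> T2. h t = e} = {t\<in>T1. h t = e}" by blast
    then show "m (card {t\<in>T1 \<union> T2. h t = e}) = m (card {t\<in>T1. h t = e})" by (simp only:)
  qed
  also have "(\<Prod>e\<in>h ` T2. m (card {t\<in>T1 \<union> T2. h t = e})) = block_moments m h T2"
    unfolding block_moments_alt
  proof (rule prod.cong[OF refl])
    fix e assume "e \<in> h ` T2"
    then have "e \<notin> h ` T1" using assms(4) by blast
    then have "{t\<in>T1 \<union> T2. h t = e} = {t\<in>T2. h t = e}" by blast
    then show "m (card {t\<in>T1 \<union> T2. h t = e}) = m (card {t\<in>T2. h t = e})" by (simp only:)
  qed
  finally show ?thesis .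
qed

lemma abs_block_moments_le:
  assumes "finite T" and m: "\<And>k. 1 \<le> k \<Longrightarrow> k \<le> card T \<Longrightarrow> \<bar>m k\<bar> \<le> \<delta>"
  shows "\<bar>block_moments m h T\<bar> \<le> \<delta> ^ card (h ` T)"
proof -
  have "\<bar>block_moments m h T\<bar> = (\<Prod>B\<in>blocks h T. \<bar>m (card B)\<bar>)"
    by (simp add: block_moments_def abs_prod)
  also have "\<dots> \<le> (\<Prod>B\<in>blocks h T. \<delta>)"
    using block_card_bounds[OF assms(1)] by (intro prod_mono conjI m) auto
  finally show ?thesis by (simp add: card_blocks)
qed

text \<open>Indexing steps by pairs (walk, step) puts equal edges of different walks into one
  block.\<close>

definition tuple_edge :: "nat \<Rightarrow> (nat \<Rightarrow> nat \<Rightarrow> nat) \<Rightarrow> nat \<times> nat \<Rightarrow> nat \<times> nat" where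
  "tuple_edge p f = (\<lambda>(s, t). cyc_edge p (f s) t)"

lemma tuple_edge_image: "tuple_edge p f ` (A \<times> {..<p}) = (\<Union>s\<in>A. cyc_edges p (f s))"
  by (auto simp: tuple_edge_def)

lemma block_moments_single: "block_moments m (tuple_edge p f) ({s} \<times> {..<p}) = block_moments m (cyc_edge p (f s)) {..<p}"
proof -
  have "{s} \<times> {..<p} = Pair s ` {..<p}" by auto
  then show ?thesis
    using block_moments_reindex[of "Pair s" "{..<p}" m "tuple_edge p f"] by (simp add: inj_on_def tuple_edge_def)
qed

text \<open>This is the expectation of \<open>\<Prod>s<4. X (f s) - E (X (f s))\<close>, expanded over the set \<open>A\<close> of factors from
  which the variable \<open>X (f s)\<close>, a product of entries along the walk \<open>f s\<close>, is taken.\<close>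

definition centred_moment :: "(nat \<Rightarrow> real) \<Rightarrow> nat \<Rightarrow> (nat \<Rightarrow> nat \<Rightarrow> nat) \<Rightarrow> real" where
  "centred_moment m p f = (\<Sum>A\<in>Pow {..<4}. block_moments m (tuple_edge p f) (A \<times> {..<p}) *
     (\<Prod>s\<in>{..<4} - A. - block_moments m (cyc_edge p (f s)) {..<p}))"

text \<open>Walk \<open>s\<close> is independent of the others, so the terms for \<open>A\<close>
  and \<open>insert s A\<close> differ only in sign and cancel.\<close>

lemma centred_moment_zero:
  assumes s: "s < 4" and disj: "\<And>r. r < 4 \<Longrightarrow> r \<noteq> s \<Longrightarrow> cyc_edges p (f s) \<inter> cyc_edges p (f r) = {}"
  shows "centred_moment m p f = 0"
proof -
  let ?R = "{..<4::nat} - {s}"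
  let ?b = "\<lambda>s. block_moments m (cyc_edge p (f s)) {..<p}"
  let ?g = "\<lambda>A. block_moments m (tuple_edge p f) (A \<times> {..<p}) * (\<Prod>s\<in>{..<4} - A. - ?b s)"
  have R: "{..<4} = insert s ?R" using s by auto
  have "centred_moment m p f = (\<Sum>A\<in>Pow (insert s ?R). ?g A)"
    unfolding centred_moment_def R[symmetric] ..
  also have "\<dots> = (\<Sum>A\<in>Pow ?R. ?g A) + (\<Sum>A\<in>insert s ` Pow ?R. ?g A)"
    unfolding Pow_insert by (rule sum.union_disjoint) auto
  also have "(\<Sum>A\<in>insert s ` Pow ?R. ?g A) = (\<Sum>A\<in>Pow ?R. ?g (insert s A))"
    by (rule sum.reindex[unfolded comp_def]) (rule inj_onI, auto)
  also have "(\<Sum>A\<in>Pow ?R. ?g A) + (\<Sum>A\<in>Pow ?R. ?g (insert s A)) = (\<Sum>A\<in>Pow ?R. ?g A + ?g (insert s A))"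
    by (rule sum.distrib[symmetric])
  also have "\<dots> = 0"
  proof (rule sum.neutral, rule ballI)
    fix A assume A: "A \<in> Pow ?R"
    have fA: "finite A" using A by (auto intro: finite_subset)
    have sA: "s \<notin> A" using A by auto
    have "block_moments m (tuple_edge p f) (insert s A \<times> {..<p}) =
      block_moments m (tuple_edge p f) ({s} \<times> {..<p} \<union> A \<times> {..<p})"
      by (rule arg_cong[where f="block_moments m (tuple_edge p f)"]) auto
    also have "\<dots> = ?b s * block_moments m (tuple_edge p f) (A \<times> {..<p})"
      unfolding block_moments_single[symmetric]
    proof (rule block_moments_Un)
      show "tuple_edge p f ` ({s} \<times> {..<p}) \<inter> tuple_edge p f ` (A \<times> {..<p}) = {}"
        unfolding tuple_edge_image using disj A by fastforce
    qed (use fA sA in auto)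
    finally have 1: "block_moments m (tuple_edge p f) (insert s A \<times> {..<p}) = ?b s * block_moments m (tuple_edge p f) (A \<times> {..<p})" .
    have "{..<4} - A = insert s ({..<4} - insert s A)" using s sA by auto
    then have 2: "(\<Prod>r\<in>{..<4} - A. - ?b r) = - ?b s * (\<Prod>r\<in>{..<4} - insert s A. - ?b r)"
      by (metis (no_types, lifting) DiffD2 finite_Diff finite_lessThan insertI1 prod.insert)
    show "?g A + ?g (insert s A) = 0" unfolding 1 2 by simp
  qed
  finally show ?thesis .
qed

text \<open>When every walk shares an edge, \<open>four_walks_excess\<close> gives at least v - 2
  edges. Each of the 16 subsets \<open>A\<close> yields at least one factor \<delta> per edge of the
  union; edges counted on both sides of the split only add factors of at most 1.\<close>

lemma centred_moment_bound:
  assumes p: "0 < p" and m: "\<And>k. 1 \<le> k \<Longrightarrow> k \<le> 4 * p \<Longrightarrow> \<bar>m k\<bar> \<le> \<delta>" and d: "0 \<le> \<delta>" "\<delta> \<le> 1"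
  shows "\<bar>centred_moment m p f\<bar> \<le> 16 * \<delta> ^ (card (\<Union>s<4. f s ` {..<p}) - 2)"
proof (cases "\<exists>s<4. \<forall>r<4. r \<noteq> s \<longrightarrow> cyc_edges p (f s) \<inter> cyc_edges p (f r) = {}")
  case True
  then show ?thesis using centred_moment_zero[of _ p f m] d(1) by fastforce
next
  case False
  define E where "E s = cyc_edges p (f s)" for s
  let ?b = "\<lambda>s. block_moments m (cyc_edge p (f s)) {..<p}"
  have V: "card (\<Union>s<4. f s ` {..<p}) - 2 \<le> card (\<Union>s<4. E s)"
    using four_walks_excess[OF p, of f] False unfolding E_def by (simp add: le_diff_conv)
  have "\<bar>block_moments m (tuple_edge p f) (A \<times> {..<p}) * (\<Prod>s\<in>{..<4} - A. - ?b s)\<bar> \<le> \<delta> ^ (card (\<Union>s<4. f s ` {..<p}) - 2)"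
    if A: "A \<in> Pow {..<4}" for A
  proof -
    have fA: "finite A" "card A \<le> 4" using A card_mono[of "{..<4::nat}" A] by (auto intro: finite_subset)
    have cp: "card (A \<times> {..<p}) \<le> 4 * p" using fA by (simp add: card_cartesian_product)
    have b1: "\<bar>block_moments m (tuple_edge p f) (A \<times> {..<p})\<bar> \<le> \<delta> ^ card (\<Union>s\<in>A. E s)"
      unfolding E_def tuple_edge_image[symmetric]
    proof (rule abs_block_moments_le)
      fix k assume k: "1 \<le> k" "k \<le> card (A \<times> {..<p})"
      show "\<bar>m k\<bar> \<le> \<delta>" by (rule m[OF k(1) order_trans[OF k(2) cp]])
    qed (use fA in simp)
    have b2: "(\<Prod>s\<in>{..<4} - A. \<bar>?b s\<bar>) \<le> (\<Prod>s\<in>{..<4} - A. \<delta> ^ card (E s))"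
      using abs_block_moments_le[of "{..<p}" m \<delta>] m p unfolding E_def by (intro prod_mono) auto
    have U: "(\<Union>s<4. E s) = (\<Union>s\<in>A. E s) \<union> (\<Union>s\<in>{..<4} - A. E s)" using A by blast
    have "card (\<Union>s<4. E s) \<le> card (\<Union>s\<in>A. E s) + card (\<Union>s\<in>{..<4} - A. E s)"
      unfolding U by (rule card_Un_le)
    also have "card (\<Union>s\<in>{..<4} - A. E s) \<le> (\<Sum>s\<in>{..<4} - A. card (E s))"
      by (rule card_UN_le) simp
    finally have c: "card (\<Union>s<4. f s ` {..<p}) - 2 \<le> card (\<Union>s\<in>A. E s) + (\<Sum>s\<in>{..<4} - A. card (E s))"
      using V by linarith
    have "\<bar>block_moments m (tuple_edge p f) (A \<times> {..<p}) * (\<Prod>s\<in>{..<4} - A. - ?b s)\<bar> =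
       \<bar>block_moments m (tuple_edge p f) (A \<times> {..<p})\<bar> * (\<Prod>s\<in>{..<4} - A. \<bar>?b s\<bar>)"
      by (simp add: abs_mult abs_prod)
    also have "\<dots> \<le> \<delta> ^ card (\<Union>s\<in>A. E s) * (\<Prod>s\<in>{..<4} - A. \<delta> ^ card (E s))"
      using d by (intro mult_mono b1 b2 prod_nonneg) auto
    also have "\<dots> = \<delta> ^ (card (\<Union>s\<in>A. E s) + (\<Sum>s\<in>{..<4} - A. card (E s)))"
      by (simp add: power_add power_sum)
    also have "\<dots> \<le> \<delta> ^ (card (\<Union>s<4. f s ` {..<p}) - 2)"
      by (rule power_decreasing[OF c d])
    finally show ?thesis .
  qed
  then have "\<bar>centred_moment m p f\<bar> \<le> (\<Sum>A\<in>Pow {..<4::nat}. \<delta> ^ (card (\<Union>s<4. f s ` {..<p}) - 2))"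
    unfolding centred_moment_def by (intro order_trans[OF sum_abs] sum_mono)
  also have "\<dots> = 16 * \<delta> ^ (card (\<Union>s<4. f s ` {..<p}) - 2)" by (simp add: card_Pow)
  finally show ?thesis .
qed

text \<open>There are at most n^v vertex sets of size v, each carrying at most (4p)^(4p) tuples,
  because four walks visit at most 4p vertices. \<open>K\<close> absorbs n^v, and v takes 4p
  values.\<close>

lemma sum_tuples_by_support:
  fixes g :: "nat \<Rightarrow> real"
  assumes p: "0 < p" and g: "\<And>v. 1 \<le> v \<Longrightarrow> v \<le> 4 * p \<Longrightarrow> 0 \<le> g v \<and> real n ^ v * g v \<le> K"
  shows "(\<Sum>f\<in>{..<4::nat} \<rightarrow>\<^sub>E (words p n). g (card (\<Union>s<4. f s ` {..<p})))
     \<le> real ((4 * p) ^ (4 * p)) * (real (4 * p) * K)"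
proof -
  let ?V = "\<lambda>f. \<Union>s<4. f s ` {..<p}"
  let ?W = "\<lambda>U. {..<4::nat} \<rightarrow>\<^sub>E ({..<p} \<rightarrow>\<^sub>E U)"
  define \<U> where "\<U> = {U. U \<subseteq> {..<n} \<and> 1 \<le> card U \<and> card U \<le> 4 * p}"
  have fU: "finite \<U>" unfolding \<U>_def by (rule finite_subset[of _ "Pow {..<n}"]) auto
  have fW: "finite (?W U)" if "finite U" for U using that by (intro finite_PiE) auto
  have fin: "finite U" if "U \<in> \<U>" for U using that unfolding \<U>_def by (auto intro: finite_subset)
  \<comment> \<open>An overcount: each tuple is charged to its own vertex set, while on the right
    every tuple with values in U is counted at U.\<close>
  have "(\<Sum>f\<in>?W {..<n}. g (card (?V f))) \<le> (\<Sum>(U, f)\<in>(SIGMA U:\<U>. ?W U). g (card U))"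
  proof (rule sum_le_included[where i=snd])
    show "finite (?W {..<n})" by (rule fW) simp
    show "finite (SIGMA U:\<U>. ?W U)" using fU fW fin by auto
    show "\<forall>y\<in>(SIGMA U:\<U>. ?W U). 0 \<le> (case y of (U, f) \<Rightarrow> g (card U))"
      using g by (auto simp: \<U>_def)
    show "\<forall>f\<in>?W {..<n}. \<exists>y\<in>(SIGMA U:\<U>. ?W U). snd y = f \<and> g (card (?V f)) \<le> (case y of (U, f) \<Rightarrow> g (card U))"
    proof
      fix f assume f: "f \<in> ?W {..<n}"
      have fs: "f s \<in> words p n" if "s < 4" for s using f that by (auto dest: PiE_mem)
      have sub: "?V f \<subseteq> {..<n}" using fs by (fastforce dest: PiE_mem)
      have ne: "f 0 0 \<in> ?V f" using p by force
      have "card (?V f) \<le> (\<Sum>s<4. card (f s ` {..<p}))" by (rule card_UN_le) simp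
      also have "\<dots> \<le> (\<Sum>s<(4::nat). p)" by (intro sum_mono order_trans[OF card_image_le]) auto
      finally have "card (?V f) \<le> 4 * p" by simp
      moreover have "1 \<le> card (?V f)" using ne by (auto simp: Suc_le_eq card_gt_0_iff)
      ultimately have "?V f \<in> \<U>" using sub by (simp add: \<U>_def)
      moreover have "f \<in> ?W (?V f)"
      proof (rule PiE_I)
        fix s assume s: "s \<in> {..<4::nat}"
        show "f s \<in> {..<p} \<rightarrow>\<^sub>E ?V f"
        proof (rule PiE_I)
          show "f s t \<in> ?V f" if "t \<in> {..<p}" for t using s that by blast
          show "f s t = undefined" if "t \<notin> {..<p}" for t using PiE_arb[OF fs that] s by simp
        qed
      next
        show "f s = undefined" if "s \<notin> {..<4}" for s by (rule PiE_arb[OF f that])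
      qed
      ultimately show "\<exists>y\<in>(SIGMA U:\<U>. ?W U). snd y = f \<and> g (card (?V f)) \<le> (case y of (U, f) \<Rightarrow> g (card U))"
        by (intro bexI[of _ "(?V f, f)"]) auto
    qed
  qed
  also have "\<dots> = (\<Sum>U\<in>\<U>. \<Sum>f\<in>?W U. g (card U))"
    using fU fW fin by (intro sum.Sigma[symmetric]) auto
  also have "\<dots> \<le> (\<Sum>U\<in>\<U>. real ((4 * p) ^ (4 * p)) * g (card U))"
  proof (rule sum_mono)
    fix U assume U: "U \<in> \<U>"
    have "card (?W U) = card U ^ (4 * p)"
      using fin[OF U] by (simp add: card_PiE power_mult[symmetric] mult.commute)
    also have "\<dots> \<le> (4 * p) ^ (4 * p)" using U by (intro power_mono) (auto simp: \<U>_def)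
    finally have "real (card (?W U)) \<le> real ((4 * p) ^ (4 * p))" by (rule of_nat_mono)
    moreover have "0 \<le> g (card U)" using g U by (auto simp: \<U>_def)
    ultimately have "real (card (?W U)) * g (card U) \<le> real ((4 * p) ^ (4 * p)) * g (card U)" by (rule mult_right_mono)
    then show "(\<Sum>f\<in>?W U. g (card U)) \<le> real ((4 * p) ^ (4 * p)) * g (card U)" by simp
  qed
  also have "\<dots> = real ((4 * p) ^ (4 * p)) * (\<Sum>U\<in>\<U>. g (card U))" by (rule sum_distrib_left[symmetric])
  also have "(\<Sum>U\<in>\<U>. g (card U)) \<le> real (4 * p) * K"
  proof -
    have "(\<Sum>U\<in>\<U>. g (card U)) = (\<Sum>v\<in>{1..4*p}. \<Sum>U | U \<in> \<U> \<and> card U = v. g (card U))"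
      by (rule sum.group[symmetric]) (auto simp: fU \<U>_def)
    also have "\<dots> \<le> (\<Sum>v\<in>{1..4*p}. K)"
    proof (rule sum_mono)
      fix v assume v: "v \<in> {1..4*p}"
      have e: "{U. U \<in> \<U> \<and> card U = v} = {U. U \<subseteq> {..<n} \<and> card U = v}" using v by (auto simp: \<U>_def)
      have "(\<Sum>U | U \<in> \<U> \<and> card U = v. g (card U)) = real (n choose v) * g v"
        unfolding e using n_subsets[of "{..<n}" v] by simp
      also have "\<dots> \<le> real n ^ v * g v"
      proof (rule mult_right_mono)
        have "n choose v \<le> n ^ v" by (cases "v \<le> n") (simp_all add: binomial_le_pow binomial_eq_0)
        then show "real (n choose v) \<le> real n ^ v" unfolding of_nat_power[symmetric] by (rule of_nat_mono)
      qed (use g[of v] v in simp)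
      also have "\<dots> \<le> K" using g[of v] v by auto
      finally show "(\<Sum>U | U \<in> \<U> \<and> card U = v. g (card U)) \<le> K" .
    qed
    finally show ?thesis by simp
  qed
  finally show ?thesis by (simp add: mult_left_mono)
qed

section \<open>Almost sure convergence\<close>

text \<open>By monotone convergence the sum of the \<open>Y n\<close> has finite integral, hence is
  almost surely finite. Nothing about their joint law enters, which suits arrays unrelated for
  different n.\<close>

lemma AE_tendsto_zero_of_summable_integrals:
  fixes Y :: "nat \<Rightarrow> 'a \<Rightarrow> real"
  assumes nonneg: "\<And>n \<omega>. 0 \<le> Y n \<omega>"
    and bound: "\<And>n. N \<le> n \<Longrightarrow> integrable M (Y n) \<and> (LINT \<omega>|M. Y n \<omega>) \<le> c n"
    and c: "summable c"
  shows "AE \<omega> in M. (\<lambda>n. Y n \<omega>) \<longlonglongrightarrow> 0"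
proof -
  have i: "integrable M (Y (n + N))" and le: "(LINT \<omega>|M. Y (n + N) \<omega>) \<le> c (n + N)" for n
    using bound[of "n + N"] by simp_all
  have m [measurable]: "Y (n + N) \<in> borel_measurable M" for n using i by (rule borel_measurable_integrable)
  have c0: "0 \<le> c (n + N)" for n
  proof -
    have "0 \<le> (LINT \<omega>|M. Y (n + N) \<omega>)" using nonneg by (intro integral_nonneg_AE) auto
    with le[of n] show ?thesis by linarith
  qed
  have "(\<integral>\<^sup>+\<omega>. (\<Sum>n. ennreal (Y (n + N) \<omega>)) \<partial>M) = (\<Sum>n. \<integral>\<^sup>+\<omega>. ennreal (Y (n + N) \<omega>) \<partial>M)"
    by (rule nn_integral_suminf) simp
  also have "\<dots> \<le> (\<Sum>n. ennreal (c (n + N)))"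
  proof (rule suminf_le)
    show "(\<integral>\<^sup>+\<omega>. ennreal (Y (n + N) \<omega>) \<partial>M) \<le> ennreal (c (n + N))" for n
      using nn_integral_eq_integral[OF i[of n]] nonneg le[of n] by (simp add: ennreal_leI)
  qed auto
  also have "\<dots> < \<infinity>"
  proof -
    have "summable (\<lambda>n. c (n + N))" using c by (rule summable_ignore_initial_segment)
    from ennreal_suminf_neq_top[OF this c0] show ?thesis by (simp add: less_top)
  qed
  finally have "(\<integral>\<^sup>+\<omega>. (\<Sum>n. ennreal (Y (n + N) \<omega>)) \<partial>M) \<noteq> \<infinity>" by simp
  then have "AE \<omega> in M. (\<Sum>n. ennreal (Y (n + N) \<omega>)) \<noteq> \<infinity>"
    by (intro nn_integral_PInf_AE) auto
  then show ?thesis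
  proof eventually_elim
    case (elim \<omega>)
    have "summable (\<lambda>n. Y (n + N) \<omega>)"
      by (rule summable_suminf_not_top) (use nonneg elim in auto)
    from summable_LIMSEQ_zero[OF this] show ?case by (rule LIMSEQ_offset)
  qed
qed

abbreviation index_pairs :: "nat \<Rightarrow> (nat \<times> nat) set" where
  "index_pairs n \<equiv> {(i, j). 1 \<le> i \<and> i \<le> j \<and> j \<le> n}"

definition entry_moment :: "'a measure \<Rightarrow> (nat \<Rightarrow> nat \<Rightarrow> nat \<Rightarrow> 'a \<Rightarrow> real) \<Rightarrow> nat \<Rightarrow> nat \<Rightarrow> real" where
  "entry_moment M x n k = (LINT \<omega>|M. x n 1 1 \<omega> ^ k)"

text \<open>Factors with the same index are collected into a power of one entry, and independence is
  applied to these powers. Their exponents never exceed the cardinality of \<open>T\<close>, which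
  is the range of \<open>int\<close>.\<close>

lemma iid_product_moment:
  assumes M: "prob_space M" and iid: "iid_arrays M x" and n: "1 \<le> n"
    and T: "finite T" and h: "h ` T \<subseteq> index_pairs n"
    and int: "\<And>k. k \<le> card T \<Longrightarrow> integrable M (\<lambda>\<omega>. x n 1 1 \<omega> ^ k)"
  shows "integrable M (\<lambda>\<omega>. \<Prod>t\<in>T. x n (fst (h t)) (snd (h t)) \<omega>)"
    and "(LINT \<omega>|M. (\<Prod>t\<in>T. x n (fst (h t)) (snd (h t)) \<omega>)) = block_moments (entry_moment M x n) h T"
proof -
  interpret prob_space M by fact
  let ?X = "\<lambda>e \<omega>. x n (fst e) (snd e) \<omega>"
  let ?m = "\<lambda>e. card {t\<in>T. h t = e}"
  have indep: "indep_vars (\<lambda>_. borel) ?X (index_pairs n)"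
    using conjunct1[OF iid[unfolded iid_arrays_def, THEN spec, THEN mp, OF n]] by (simp only: case_prod_beta')
  have distr: "distr M borel (?X e) = distr M borel (x n 1 1)" if "e \<in> index_pairs n" for e
    using conjunct2[OF iid[unfolded iid_arrays_def, THEN spec, THEN mp, OF n], THEN spec, THEN spec, THEN mp, of "fst e" "snd e"] that
    by (simp only: case_prod_beta' mem_Collect_eq)
  have "\<forall>e\<in>index_pairs n. ?X e \<in> borel_measurable M"
    using indep unfolding indep_vars_def by (rule conjunct1)
  then have meas: "?X e \<in> borel_measurable M" if "e \<in> index_pairs n" for e
    using that by (rule bspec)
  have meas1: "x n 1 1 \<in> borel_measurable M" using meas[of "(1, 1)"] n by simp
  have pow: "integrable M (\<lambda>\<omega>. ?X e \<omega> ^ k) \<and> (LINT \<omega>|M. ?X e \<omega> ^ k) = entry_moment M x n k"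
    if e: "e \<in> index_pairs n" and k: "k \<le> card T" for e k
  proof -
    have b: "(\<lambda>y::real. y ^ k) \<in> borel_measurable borel" by simp
    have "integrable (distr M borel (x n 1 1)) (\<lambda>y. y ^ k)"
      unfolding integrable_distr_eq[OF meas1 b] by (rule int[OF k])
    then have "integrable (distr M borel (?X e)) (\<lambda>y. y ^ k)" by (simp only: distr[OF e])
    then have 1: "integrable M (\<lambda>\<omega>. ?X e \<omega> ^ k)" unfolding integrable_distr_eq[OF meas[OF e] b] .
    have "(LINT \<omega>|M. ?X e \<omega> ^ k) = (LINT y|distr M borel (?X e). y ^ k)"
      by (rule integral_distr[OF meas[OF e] b, symmetric])
    also have "\<dots> = (LINT y|distr M borel (x n 1 1). y ^ k)" by (simp only: distr[OF e])
    also have "\<dots> = entry_moment M x n k"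
      unfolding entry_moment_def by (rule integral_distr[OF meas1 b])
    finally show ?thesis using 1 by (rule conjI[rotated])
  qed
  have prod: "(\<Prod>t\<in>T. ?X (h t) \<omega>) = (\<Prod>e\<in>h ` T. ?X e \<omega> ^ ?m e)" for \<omega>
  proof -
    have "(\<Prod>t\<in>T. ?X (h t) \<omega>) = (\<Prod>e\<in>h ` T. \<Prod>t\<in>{t. t \<in> T \<and> h t = e}. ?X (h t) \<omega>)"
      by (rule prod.image_gen[OF T])
    also have "\<dots> = (\<Prod>e\<in>h ` T. ?X e \<omega> ^ ?m e)" by (intro prod.cong) auto
    finally show ?thesis .
  qed
  have fin: "finite (h ` T)" using T by simp
  have mT: "?m e \<le> card T" for e using T by (intro card_mono) auto
  have indep': "indep_vars (\<lambda>_. borel) (\<lambda>e \<omega>. ?X e \<omega> ^ ?m e) (h ` T)"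
    by (rule indep_vars_compose2[OF indep_vars_subset[OF indep h]]) auto
  have int': "integrable M (\<lambda>\<omega>. ?X e \<omega> ^ ?m e)" if "e \<in> h ` T" for e
    by (rule conjunct1[OF pow[OF subsetD[OF h that] mT]])
  show "integrable M (\<lambda>\<omega>. \<Prod>t\<in>T. ?X (h t) \<omega>)"
    unfolding prod by (rule indep_vars_integrable[OF fin indep' int'])
  have "(LINT \<omega>|M. (\<Prod>t\<in>T. ?X (h t) \<omega>)) = (\<Prod>e\<in>h ` T. LINT \<omega>|M. ?X e \<omega> ^ ?m e)"
    unfolding prod by (rule indep_vars_lebesgue_integral[OF fin indep' int'])
  also have "\<dots> = block_moments (entry_moment M x n) h T"
    unfolding block_moments_alt by (rule prod.cong[OF refl], rule conjunct2[OF pow[OF subsetD[OF h] mT]])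
  finally show "(LINT \<omega>|M. (\<Prod>t\<in>T. ?X (h t) \<omega>)) = block_moments (entry_moment M x n) h T" .
qed

text \<open>\<open>Suc\<close> passes from matrix indices counted from 0 to array indices counted
  from 1.\<close>

definition walk_weight :: "(nat \<Rightarrow> nat \<Rightarrow> nat \<Rightarrow> 'a \<Rightarrow> real) \<Rightarrow> nat \<Rightarrow> nat \<Rightarrow> (nat \<Rightarrow> nat) \<Rightarrow> 'a \<Rightarrow> real" where
  "walk_weight x n p w \<omega> = (\<Prod>t<p. x n (Suc (fst (cyc_edge p w t))) (Suc (snd (cyc_edge p w t))) \<omega>)"

definition walk_profile :: "(real \<times> real \<Rightarrow> real) \<Rightarrow> nat \<Rightarrow> nat \<Rightarrow> (nat \<Rightarrow> nat) \<Rightarrow> real" where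
  "walk_profile \<sigma> n p w = (\<Prod>t<p. profile_entry \<sigma> n (w t) (w (Suc t mod p)))"

definition expected_trace :: "'a measure \<Rightarrow> (real \<times> real \<Rightarrow> real) \<Rightarrow> (nat \<Rightarrow> nat \<Rightarrow> nat \<Rightarrow> 'a \<Rightarrow> real) \<Rightarrow> nat \<Rightarrow> nat \<Rightarrow> real" where
  "expected_trace M \<sigma> x p n =
     (\<Sum>w\<in>words p n. walk_profile \<sigma> n p w * block_moments (entry_moment M x n) (cyc_edge p w) {..<p})"

lemma profile_matrix_carrier: "profile_matrix \<sigma> x n \<omega> \<in> carrier_mat n n"
  by (simp add: profile_matrix_def)

lemma profile_matrix_entry:
  assumes "a < n" "b < n"
  shows "profile_matrix \<sigma> x n \<omega> $$ (a, b) =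
    profile_entry \<sigma> n a b * x n (Suc (fst (edge a b))) (Suc (snd (edge a b))) \<omega>"
  using assms by (simp add: profile_matrix_def profile_entry_def edge_def Let_def)

lemma profile_matrix_sym:
  "a < n \<Longrightarrow> b < n \<Longrightarrow> profile_matrix \<sigma> x n \<omega> $$ (a, b) = profile_matrix \<sigma> x n \<omega> $$ (b, a)"
  by (simp add: profile_matrix_entry profile_entry_def edge_def min.commute max.commute)

lemma esd_profile_moment:
  assumes n: "0 < n" and p: "0 < p"
  shows "moment (esd (profile_matrix \<sigma> x n \<omega>)) p =
    (\<Sum>w\<in>words p n. walk_profile \<sigma> n p w * walk_weight x n p w \<omega>) / real n"
proof -
  let ?A = "profile_matrix \<sigma> x n \<omega>"
  have "moment (esd ?A) p = trace_mat (?A ^\<^sub>m p) / real n"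
    by (rule esd_moment(1)[OF profile_matrix_carrier profile_matrix_sym n])
  also have "trace_mat (?A ^\<^sub>m p) = (\<Sum>w\<in>words p n. \<Prod>t<p. ?A $$ (w t, w (Suc t mod p)))"
    by (rule trace_pow_eq_sum_closed_walks[OF profile_matrix_carrier p])
  also have "\<dots> = (\<Sum>w\<in>words p n. walk_profile \<sigma> n p w * walk_weight x n p w \<omega>)"
  proof (rule sum.cong[OF refl])
    fix w assume w: "w \<in> words p n"
    have "(\<Prod>t<p. ?A $$ (w t, w (Suc t mod p))) = (\<Prod>t<p. profile_entry \<sigma> n (w t) (w (Suc t mod p)) *
        x n (Suc (fst (cyc_edge p w t))) (Suc (snd (cyc_edge p w t))) \<omega>)"
    proof (rule prod.cong[OF refl])
      fix t assume t: "t \<in> {..<p}"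
      then have "Suc t mod p \<in> {..<p}" by simp
      with t have "w t < n" "w (Suc t mod p) < n" using PiE_mem[OF w] by simp_all
      then show "?A $$ (w t, w (Suc t mod p)) = profile_entry \<sigma> n (w t) (w (Suc t mod p)) *
        x n (Suc (fst (cyc_edge p w t))) (Suc (snd (cyc_edge p w t))) \<omega>"
        by (simp add: profile_matrix_entry cyc_edge_def)
    qed
    also have "\<dots> = walk_profile \<sigma> n p w * walk_weight x n p w \<omega>"
      unfolding walk_profile_def walk_weight_def by (rule prod.distrib)
    finally show "(\<Prod>t<p. ?A $$ (w t, w (Suc t mod p))) = walk_profile \<sigma> n p w * walk_weight x n p w \<omega>" .
  qed
  finally show ?thesis .
qed

lemma cyc_edge_index_pairs:
  assumes "w \<in> words p n" "t < p"
  shows "(Suc (fst (cyc_edge p w t)), Suc (snd (cyc_edge p w t))) \<in> index_pairs n"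
proof -
  have "Suc t mod p \<in> {..<p}" using assms(2) by simp
  then have "w t < n" "w (Suc t mod p) < n"
    using PiE_mem[OF assms(1), of t] PiE_mem[OF assms(1), of "Suc t mod p"] assms(2) by simp_all
  then show ?thesis by (auto simp: cyc_edge_def edge_def min_def max_def)
qed

lemma fourth_moment_formula:
  fixes \<sigma> :: "real \<times> real \<Rightarrow> real" and x :: "nat \<Rightarrow> nat \<Rightarrow> nat \<Rightarrow> 'a \<Rightarrow> real"
  assumes M: "prob_space M" and iid: "iid_arrays M x" and n: "1 \<le> n"
    and int: "\<And>k. k \<le> 4 * p \<Longrightarrow> integrable M (\<lambda>\<omega>. x n 1 1 \<omega> ^ k)"
  defines "D \<equiv> \<lambda>\<omega>. (\<Sum>w\<in>words p n. walk_profile \<sigma> n p w * walk_weight x n p w \<omega>) - expected_trace M \<sigma> x p n"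
  shows "integrable M (\<lambda>\<omega>. D \<omega> ^ 4)"
    and "(LINT \<omega>|M. D \<omega> ^ 4) = (\<Sum>f\<in>{..<4::nat} \<rightarrow>\<^sub>E (words p n).
           (\<Prod>s<4. walk_profile \<sigma> n p (f s)) * centred_moment (entry_moment M x n) p f)"
proof -
  let ?\<mu> = "entry_moment M x n"
  let ?W = "words p n"
  let ?F = "{..<4::nat} \<rightarrow>\<^sub>E ?W"
  let ?b = "\<lambda>w. block_moments ?\<mu> (cyc_edge p w) {..<p}"
  let ?Y = "\<lambda>f A \<omega>. \<Prod>st\<in>A \<times> {..<p}. x n (Suc (fst (tuple_edge p f st))) (Suc (snd (tuple_edge p f st))) \<omega>"
  have Y: "integrable M (?Y f A) \<and> (LINT \<omega>|M. ?Y f A \<omega>) = block_moments ?\<mu> (tuple_edge p f) (A \<times> {..<p})"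
    if f: "f \<in> ?F" and A: "A \<in> Pow {..<4}" for f A
  proof -
    have fA: "finite A" "card A \<le> 4" using A card_mono[of "{..<4::nat}" A] by (auto intro: finite_subset)
    have cA: "card (A \<times> {..<p}) \<le> 4 * p" using fA by (simp add: card_cartesian_product)
    let ?h = "\<lambda>st. (Suc (fst (tuple_edge p f st)), Suc (snd (tuple_edge p f st)))"
    have h: "?h ` (A \<times> {..<p}) \<subseteq> index_pairs n"
    proof (rule image_subsetI)
      fix st assume "st \<in> A \<times> {..<p}"
      then obtain s t where st: "st = (s, t)" "s \<in> {..<4}" "t < p" using A by auto
      show "?h st \<in> index_pairs n"
        using cyc_edge_index_pairs[OF PiE_mem[OF f st(2)] st(3)] by (simp add: st(1) tuple_edge_def)
    qed
    \<comment> \<open>The shift of indices by one is injective, so it leaves the blocks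
      unchanged.\<close>
    have b: "block_moments ?\<mu> ?h (A \<times> {..<p}) = block_moments ?\<mu> (tuple_edge p f) (A \<times> {..<p})"
      unfolding block_moments_def
      by (rule arg_cong[where f="prod (\<lambda>B. ?\<mu> (card B))"], rule blocks_cong) (simp add: prod_eq_iff)
    have fin: "finite (A \<times> {..<p})" using fA by simp
    have int': "integrable M (\<lambda>\<omega>. x n 1 1 \<omega> ^ k)" if "k \<le> card (A \<times> {..<p})" for k
      by (rule int[OF order_trans[OF that cA]])
    show ?thesis
      using iid_product_moment[OF M iid n fin h int'] b by simp
  qed
  have expand: "D \<omega> ^ 4 = (\<Sum>f\<in>?F. \<Sum>A\<in>Pow {..<4}. (\<Prod>s<4. walk_profile \<sigma> n p (f s)) *
       (?Y f A \<omega> * (\<Prod>s\<in>{..<4} - A. - ?b (f s))))" for \<omega>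
  proof -
    have "D \<omega> = (\<Sum>w\<in>?W. walk_profile \<sigma> n p w * (walk_weight x n p w \<omega> + - ?b w))"
      unfolding D_def expected_trace_def by (simp add: sum_subtractf right_diff_distrib)
    \<comment> \<open>Four equal factors: their product expands over tuples of walks, and each
      centred factor then expands over the choice of one of its two terms.\<close>
    then have "D \<omega> ^ 4 = (\<Prod>s<(4::nat). \<Sum>w\<in>?W. walk_profile \<sigma> n p w * (walk_weight x n p w \<omega> + - ?b w))"
      by simp
    also have "\<dots> = (\<Sum>f\<in>?F. \<Prod>s<4. walk_profile \<sigma> n p (f s) * (walk_weight x n p (f s) \<omega> + - ?b (f s)))"
      by (intro prod_sum_PiE finite_lessThan finite_words)
    also have "\<dots> = (\<Sum>f\<in>?F. \<Sum>A\<in>Pow {..<4}. (\<Prod>s<4. walk_profile \<sigma> n p (f s)) *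
       (?Y f A \<omega> * (\<Prod>s\<in>{..<4} - A. - ?b (f s))))"
    proof (rule sum.cong[OF refl])
      fix f
      have "(\<Prod>s\<in>A. walk_weight x n p (f s) \<omega>) = ?Y f A \<omega>" for A
        unfolding walk_weight_def by (simp add: prod.cartesian_product tuple_edge_def case_prod_beta')
      then show "(\<Prod>s<4. walk_profile \<sigma> n p (f s) * (walk_weight x n p (f s) \<omega> + - ?b (f s))) =
        (\<Sum>A\<in>Pow {..<4}. (\<Prod>s<4. walk_profile \<sigma> n p (f s)) * (?Y f A \<omega> * (\<Prod>s\<in>{..<4} - A. - ?b (f s))))"
        by (simp only: prod.distrib prod_add[OF finite_lessThan] sum_distrib_left)
    qed
    finally show ?thesis .
  qed
  have i: "integrable M (\<lambda>\<omega>. (\<Prod>s<4. walk_profile \<sigma> n p (f s)) * (?Y f A \<omega> * (\<Prod>s\<in>{..<4} - A. - ?b (f s))))"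
    if "f \<in> ?F" "A \<in> Pow {..<4}" for f A
    by (rule integrable_mult_right, rule integrable_mult_left, rule conjunct1[OF Y[OF that]])
  show "integrable M (\<lambda>\<omega>. D \<omega> ^ 4)"
    unfolding expand by (rule Bochner_Integration.integrable_sum, rule Bochner_Integration.integrable_sum, rule i)
  have "(LINT \<omega>|M. D \<omega> ^ 4) = (\<Sum>f\<in>?F. \<Sum>A\<in>Pow {..<4}. LINT \<omega>|M. (\<Prod>s<4. walk_profile \<sigma> n p (f s)) *
       (?Y f A \<omega> * (\<Prod>s\<in>{..<4} - A. - ?b (f s))))"
    unfolding expand
  proof (subst Bochner_Integration.integral_sum)
    show "integrable M (\<lambda>\<omega>. \<Sum>A\<in>Pow {..<4}. (\<Prod>s<4. walk_profile \<sigma> n p (f s)) *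
       (?Y f A \<omega> * (\<Prod>s\<in>{..<4} - A. - ?b (f s))))" if "f \<in> ?F" for f
      by (rule Bochner_Integration.integrable_sum) (rule i[OF that])
  qed (rule sum.cong[OF refl], rule Bochner_Integration.integral_sum, rule i)
  also have "\<dots> = (\<Sum>f\<in>?F. (\<Prod>s<4. walk_profile \<sigma> n p (f s)) * centred_moment ?\<mu> p f)"
    unfolding centred_moment_def sum_distrib_left
  proof (intro sum.cong refl)
    fix f A assume "f \<in> ?F" "A \<in> Pow {..<4::nat}"
    from Y[OF this] show "(LINT \<omega>|M. (\<Prod>s<4. walk_profile \<sigma> n p (f s)) * (?Y f A \<omega> * (\<Prod>s\<in>{..<4} - A. - ?b (f s)))) =
      (\<Prod>s<4. walk_profile \<sigma> n p (f s)) * (block_moments ?\<mu> (tuple_edge p f) (A \<times> {..<p}) * (\<Prod>s\<in>{..<4} - A. - ?b (f s)))"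
      by simp
  qed
  finally show "(LINT \<omega>|M. D \<omega> ^ 4) = (\<Sum>f\<in>?F. (\<Prod>s<4. walk_profile \<sigma> n p (f s)) * centred_moment ?\<mu> p f)" .
qed

lemma entry_moment_even_limit:
  assumes "moment_condition M x C" "1 \<le> k"
  shows "(\<lambda>n. real n * entry_moment M x n (2 * k)) \<longlonglongrightarrow> C (2 * k)"
  using assms(1)[unfolded moment_condition_def, rule_format, of 1 1 k] assms(2)
  unfolding entry_moment_def by simp

lemma even_constant_nonneg:
  assumes "moment_condition M x C" "1 \<le> k"
  shows "0 \<le> C (2 * k)"
  by (rule LIMSEQ_le_const[OF entry_moment_even_limit[OF assms]])
     (auto simp: entry_moment_def intro!: mult_nonneg_nonneg integral_nonneg_AE)

text \<open>Puts both parities on the same footing: even orders lose \<epsilon> from a convergent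
  sequence, and odd orders are the hypothesis with \<alpha> = 1 - \<epsilon>.\<close>

lemma entry_moment_small:
  assumes mc: "moment_condition M x C" and k: "1 \<le> k" and e: "0 < \<epsilon>"
  shows "(\<lambda>n. real n powr (1 - \<epsilon>) * entry_moment M x n k) \<longlonglongrightarrow> 0"
proof (cases "even k")
  case True
  then obtain l where l: "k = 2 * l" by (auto elim: evenE)
  then have "1 \<le> l" using k by simp
  from entry_moment_even_limit[OF mc this]
  have L: "(\<lambda>n. real n * entry_moment M x n k) \<longlonglongrightarrow> C k" by (simp only: l)
  have "(\<lambda>n. real n powr - \<epsilon>) \<longlonglongrightarrow> 0"
    by (rule tendsto_neg_powr) (use e in \<open>auto simp: filterlim_real_sequentially\<close>)
  from tendsto_mult[OF this L] have "(\<lambda>n. real n powr - \<epsilon> * (real n * entry_moment M x n k)) \<longlonglongrightarrow> 0"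
    by simp
  moreover have "real n powr - \<epsilon> * (real n * entry_moment M x n k) = real n powr (1 - \<epsilon>) * entry_moment M x n k"
    if "0 < n" for n
    using that by (simp add: powr_diff powr_minus divide_inverse)
  ultimately show ?thesis
    by (rule Lim_transform_eventually[OF _ eventually_mono[OF eventually_gt_at_top[of 0]]])
next
  case False
  then obtain l where l: "k = 2 * l + 1" by (auto elim: oddE)
  then have "k = 2 * Suc l - 1" by simp
  then show ?thesis
    using mc[unfolded moment_condition_def, rule_format, of 1 1 "Suc l"] e
    unfolding entry_moment_def by simp
qed

lemma eventually_integrable_powers:
  assumes M: "prob_space M" and mc: "moment_condition M x C"
  shows "\<forall>\<^sub>F n in sequentially. \<forall>k\<in>{..K}. integrable M (\<lambda>\<omega>. x n 1 1 \<omega> ^ k)"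
proof (intro eventually_ball_finite ballI)
  fix k :: nat
  interpret prob_space M by fact
  show "\<forall>\<^sub>F n in sequentially. integrable M (\<lambda>\<omega>. x n 1 1 \<omega> ^ k)"
    using mc[unfolded moment_condition_def, rule_format, of 1 1 k] by (cases "k = 0") auto
qed simp

lemma abs_walk_profile_le:
  assumes "\<And>z. z \<in> unit_square \<Longrightarrow> \<bar>\<sigma> z\<bar> \<le> B" "w \<in> words p n"
  shows "\<bar>walk_profile \<sigma> n p w\<bar> \<le> B ^ p"
  unfolding walk_profile_def
  by (rule abs_profile_prod_le[OF assms(1)]) (use PiE_mem[OF assms(2)] in auto)

text \<open>Tuples with v vertices contribute n^v \<delta>^(v-2) with \<delta> = n^(-1+\<epsilon>),
  that is n^(2 + \<epsilon>(v-2)). Half a power of n is granted to \<epsilon>, which leaves n^(-3/2)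
  after division by n^4.\<close>

lemma fourth_moment_bound:
  fixes \<sigma> :: "real \<times> real \<Rightarrow> real" and x :: "nat \<Rightarrow> nat \<Rightarrow> nat \<Rightarrow> 'a \<Rightarrow> real"
  assumes M: "prob_space M" and iid: "iid_arrays M x" and mc: "moment_condition M x C"
    and bdd: "bounded (\<sigma> ` unit_square)" and p: "0 < p"
  defines "D \<equiv> \<lambda>n \<omega>. (\<Sum>w\<in>words p n. walk_profile \<sigma> n p w * walk_weight x n p w \<omega>) - expected_trace M \<sigma> x p n"
  shows "\<exists>K N. \<forall>n\<ge>N. integrable M (\<lambda>\<omega>. D n \<omega> ^ 4) \<and> (LINT \<omega>|M. D n \<omega> ^ 4) \<le> K * real n powr (5 / 2)"
proof -
  obtain B0 where B0: "\<And>z. z \<in> unit_square \<Longrightarrow> \<bar>\<sigma> z\<bar> \<le> B0" using bdd by (auto simp: bounded_iff)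
  define B where "B = max 0 B0"
  have B: "\<bar>\<sigma> z\<bar> \<le> B" if "z \<in> unit_square" for z using B0[OF that] by (simp add: B_def le_max_iff_disj)
  have Bn: "0 \<le> B" by (simp add: B_def)
  \<comment> \<open>At most 4p vertices occur, so \<epsilon> (v - 2) \<le> 4 p \<epsilon> =
    1/2.\<close>
  define \<epsilon> where "\<epsilon> = 1 / (8 * real p)"
  have e: "0 < \<epsilon>" "\<epsilon> \<le> 1" using p by (auto simp: \<epsilon>_def)
  \<comment> \<open>The 16 comes from \<open>centred_moment_bound\<close>, the powers of 4p from
    \<open>sum_tuples_by_support\<close>, the rest from the profile.\<close>
  define K where "K = (B ^ p) ^ 4 * (real ((4 * p) ^ (4 * p)) * (real (4 * p) * 16))"
  have "\<forall>\<^sub>F n in sequentially. \<forall>k\<in>{1..4*p}. \<bar>real n powr (1 - \<epsilon>) * entry_moment M x n k\<bar> < 1"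
  proof (intro eventually_ball_finite ballI)
    fix k assume "k \<in> {1..4*p}"
    then have "1 \<le> k" by simp
    from tendstoD[OF entry_moment_small[OF mc this e(1)], of 1]
    show "\<forall>\<^sub>F n in sequentially. \<bar>real n powr (1 - \<epsilon>) * entry_moment M x n k\<bar> < 1" by (simp add: dist_real_def)
  qed simp
  then have "\<forall>\<^sub>F n in sequentially. integrable M (\<lambda>\<omega>. D n \<omega> ^ 4) \<and> (LINT \<omega>|M. D n \<omega> ^ 4) \<le> K * real n powr (5 / 2)"
    using eventually_integrable_powers[OF M mc, of "4 * p"] eventually_ge_at_top[of 1]
  proof eventually_elim
    case (elim n)
    then have n: "1 \<le> n" by simp
    have int: "integrable M (\<lambda>\<omega>. x n 1 1 \<omega> ^ k)" if "k \<le> 4 * p" for k using elim(2) that by simp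
    define \<delta> where "\<delta> = real n powr - (1 - \<epsilon>)"
    have d: "0 \<le> \<delta>" "\<delta> \<le> 1"
      using n e powr_mono[of "- (1 - \<epsilon>)" 0 "real n"] by (simp_all add: \<delta>_def)
    have m: "\<bar>entry_moment M x n k\<bar> \<le> \<delta>" if "1 \<le> k" "k \<le> 4 * p" for k
    proof -
      have "real n powr (1 - \<epsilon>) * \<bar>entry_moment M x n k\<bar> < 1"
        using elim(1)[rule_format, of k] that by (simp add: abs_mult)
      moreover have "y \<le> inverse a" if "a * y < 1" "0 < a" for a y :: real using that by (simp add: field_simps)
      ultimately show ?thesis unfolding \<delta>_def powr_minus using n by simp
    qed
    have g: "0 \<le> 16 * \<delta> ^ (v - 2) \<and> real n ^ v * (16 * \<delta> ^ (v - 2)) \<le> 16 * real n powr (5 / 2)"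
      if v: "1 \<le> v" "v \<le> 4 * p" for v
    proof (cases "v = 1")
      \<comment> \<open>Truncated subtraction: v - 2 is 0 here, and n \<le> n^(5/2)
        suffices.\<close>
      case True
      then show ?thesis using n powr_mono[of 1 "5/2" "real n"] by simp
    next
      case False
      have "real n ^ v * \<delta> ^ (v - 2) = real n powr (real v - (1 - \<epsilon>) * (real v - 2))"
      proof -
        have "\<delta> ^ (v - 2) = real n powr (- (1 - \<epsilon>) * (real v - 2))"
          using n v False by (simp add: \<delta>_def powr_realpow[symmetric] powr_powr of_nat_diff)
        moreover have "real n ^ v = real n powr real v" using n by (simp add: powr_realpow)
        moreover have "real v - (1 - \<epsilon>) * (real v - 2) = real v + - (1 - \<epsilon>) * (real v - 2)"
          by (simp add: algebra_simps)
        ultimately show ?thesis by (simp only: powr_add)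
      qed
      also have "\<dots> \<le> real n powr (5 / 2)"
      proof (rule powr_mono)
        have "\<epsilon> * (real v - 2) \<le> \<epsilon> * (4 * real p)" using v e by (intro mult_left_mono) auto
        also have "\<dots> = 1 / 2" using p by (simp add: \<epsilon>_def)
        finally show "real v - (1 - \<epsilon>) * (real v - 2) \<le> 5 / 2" by (simp add: algebra_simps)
      qed (use n in simp)
      finally show ?thesis using d by simp
    qed
    let ?F = "{..<4::nat} \<rightarrow>\<^sub>E (words p n)"
    let ?V = "\<lambda>f. card (\<Union>s<4. f s ` {..<p})"
    have "(LINT \<omega>|M. D n \<omega> ^ 4) = (\<Sum>f\<in>?F. (\<Prod>s<4. walk_profile \<sigma> n p (f s)) * centred_moment (entry_moment M x n) p f)"
      unfolding D_def by (rule fourth_moment_formula(2)[OF M iid n int])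
    also have "\<dots> \<le> (\<Sum>f\<in>?F. (B ^ p) ^ 4 * (16 * \<delta> ^ (?V f - 2)))"
    proof (rule sum_mono)
      fix f assume f: "f \<in> ?F"
      have "(\<Prod>s<4. walk_profile \<sigma> n p (f s)) * centred_moment (entry_moment M x n) p f \<le>
        \<bar>\<Prod>s<4. walk_profile \<sigma> n p (f s)\<bar> * \<bar>centred_moment (entry_moment M x n) p f\<bar>"
        unfolding abs_mult[symmetric] by (rule abs_ge_self)
      also have "\<dots> \<le> (B ^ p) ^ 4 * (16 * \<delta> ^ (?V f - 2))"
      proof (rule mult_mono)
        have "(\<Prod>s<(4::nat). \<bar>walk_profile \<sigma> n p (f s)\<bar>) \<le> (\<Prod>s<(4::nat). B ^ p)"
          by (rule prod_mono) (use abs_walk_profile_le[OF B PiE_mem[OF f]] in simp)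
        then show "\<bar>\<Prod>s<4. walk_profile \<sigma> n p (f s)\<bar> \<le> (B ^ p) ^ 4" by (simp add: abs_prod)
        show "\<bar>centred_moment (entry_moment M x n) p f\<bar> \<le> 16 * \<delta> ^ (?V f - 2)"
          by (rule centred_moment_bound[OF p m d])
      qed (use Bn in auto)
      finally show "(\<Prod>s<4. walk_profile \<sigma> n p (f s)) * centred_moment (entry_moment M x n) p f \<le>
        (B ^ p) ^ 4 * (16 * \<delta> ^ (?V f - 2))" .
    qed
    also have "\<dots> = (B ^ p) ^ 4 * (\<Sum>f\<in>?F. 16 * \<delta> ^ (?V f - 2))" by (rule sum_distrib_left[symmetric])
    also have "\<dots> \<le> (B ^ p) ^ 4 * (real ((4 * p) ^ (4 * p)) * (real (4 * p) * (16 * real n powr (5 / 2))))"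
      by (intro mult_left_mono sum_tuples_by_support[OF p g]) (use Bn in auto)
    also have "\<dots> = K * real n powr (5 / 2)" by (simp add: K_def)
    finally have "(LINT \<omega>|M. D n \<omega> ^ 4) \<le> K * real n powr (5 / 2)" .
    moreover have "integrable M (\<lambda>\<omega>. D n \<omega> ^ 4)"
      unfolding D_def by (rule fourth_moment_formula(1)[OF M iid n int])
    ultimately show ?case by blast
  qed
  then show ?thesis unfolding eventually_sequentially by blast
qed

lemma esd_moment_AE_limit:
  fixes x :: "nat \<Rightarrow> nat \<Rightarrow> nat \<Rightarrow> 'a \<Rightarrow> real"
  assumes M: "prob_space M" and iid: "iid_arrays M x" and mc: "moment_condition M x C"
    and bdd: "bounded (\<sigma> ` unit_square)" and pc: "piecewise_continuous_on_square \<sigma>" and p: "0 < p"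
  shows "AE \<omega> in M. (\<lambda>n. moment (esd (profile_matrix \<sigma> x n \<omega>)) p) \<longlonglongrightarrow> limit_moment \<sigma> C p"
proof -
  define D where "D n \<omega> = (\<Sum>w\<in>words p n. walk_profile \<sigma> n p w * walk_weight x n p w \<omega>) - expected_trace M \<sigma> x p n" for n \<omega>
  have E: "(\<lambda>n. expected_trace M \<sigma> x p n / real n) \<longlonglongrightarrow> limit_moment \<sigma> C p"
    unfolding expected_trace_def walk_profile_def
    by (rule expected_trace_limit[OF bdd pc p])
       (rule entry_moment_even_limit[OF mc], assumption, rule entry_moment_small[OF mc], assumption+)
  obtain K N where KN: "\<And>n. N \<le> n \<Longrightarrow> integrable M (\<lambda>\<omega>. D n \<omega> ^ 4) \<and> (LINT \<omega>|M. D n \<omega> ^ 4) \<le> K * real n powr (5 / 2)"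
    using fourth_moment_bound[OF M iid mc bdd p] unfolding D_def by blast
  have "AE \<omega> in M. (\<lambda>n. (D n \<omega> / real n) ^ 4) \<longlonglongrightarrow> 0"
  proof (rule AE_tendsto_zero_of_summable_integrals[where N = "max 1 N" and c = "\<lambda>n. K * real n powr - (3 / 2)"])
    fix n assume n: "max 1 N \<le> n"
    have eq: "(D n \<omega> / real n) ^ 4 = D n \<omega> ^ 4 / real n ^ 4" for \<omega> by (rule power_divide)
    have n4: "real n powr (5 / 2) / real n ^ 4 = real n powr - (3 / 2)"
    proof -
      have "real n ^ 4 = real n powr 4" using n by (simp add: powr_numeral)
      then have "real n powr (5 / 2) / real n ^ 4 = real n powr (5 / 2 - 4)" by (simp only: powr_diff)
      then show ?thesis by simp
    qed
    have "(LINT \<omega>|M. D n \<omega> ^ 4 / real n ^ 4) = (LINT \<omega>|M. D n \<omega> ^ 4) / real n ^ 4" by simp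
    also have "\<dots> \<le> K * real n powr (5 / 2) / real n ^ 4"
      using KN[of n] n by (intro divide_right_mono) auto
    also have "\<dots> = K * real n powr - (3 / 2)" using n4 by (simp only: times_divide_eq_right[symmetric])
    finally show "integrable M (\<lambda>\<omega>. (D n \<omega> / real n) ^ 4) \<and> (LINT \<omega>|M. (D n \<omega> / real n) ^ 4) \<le> K * real n powr - (3 / 2)"
      unfolding eq using KN[of n] n by simp
  next
    show "summable (\<lambda>n. K * real n powr - (3 / 2))" by (intro summable_mult) (simp add: summable_real_powr_iff)
  qed simp
  then show ?thesis
  proof eventually_elim
    case (elim \<omega>)
    have "root 4 (y ^ 4) = \<bar>y\<bar>" for y :: real
      using real_root_power_cancel[of 4 "\<bar>y\<bar>"] by (simp add: power_even_abs)
    with tendsto_real_root[OF elim, of 4] have "(\<lambda>n. \<bar>D n \<omega> / real n\<bar>) \<longlonglongrightarrow> 0"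
      by (simp only: real_root_zero)
    then have "(\<lambda>n. D n \<omega> / real n) \<longlonglongrightarrow> 0" by (rule tendsto_rabs_zero_cancel)
    from tendsto_add[OF this E] have "(\<lambda>n. D n \<omega> / real n + expected_trace M \<sigma> x p n / real n) \<longlonglongrightarrow> limit_moment \<sigma> C p"
      by simp
    moreover have "D n \<omega> / real n + expected_trace M \<sigma> x p n / real n = moment (esd (profile_matrix \<sigma> x n \<omega>)) p" if "0 < n" for n
      unfolding esd_profile_moment[OF that p] D_def add_divide_distrib[symmetric] by simp
    ultimately show ?case
      by (rule Lim_transform_eventually[OF _ eventually_mono[OF eventually_gt_at_top[of 0]]])
  qed
qed

text \<open>A geometric factor B^N changes an N-th root only by the factor B. The work lies in
  absorbing the added 1, and in passing from real series to the extended reals of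
  \<open>carleman\<close>.\<close>

lemma carleman_not_summable:
  fixes m :: "nat \<Rightarrow> real"
  assumes \<mu>: "real_distribution \<mu>" "\<And>k. integrable \<mu> (\<lambda>t. t ^ k)" and car: "carleman \<mu>"
    and B: "1 \<le> B" and m: "\<And>k. m (2 * Suc k) \<le> B ^ (2 * Suc k) * moment \<mu> (2 * Suc k)" "\<And>k. 0 \<le> m (2 * Suc k)"
  shows "\<not> summable (\<lambda>k. (2 * m (2 * Suc k) + 1) powr - (1 / real (2 * Suc k)))"
proof
  define N where "N k = 2 * Suc k" for k
  define \<beta> where "\<beta> k = moment \<mu> (N k)" for k
  define s where "s k = (2 * m (N k) + 1) powr - (1 / real (N k))" for k
  assume "summable (\<lambda>k. (2 * m (2 * Suc k) + 1) powr - (1 / real (2 * Suc k)))"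
  then have s: "summable s" by (simp only: s_def[abs_def] N_def)
  have N: "1 \<le> real (N k)" "0 < N k" "even (N k)" for k by (auto simp: N_def)
  have mk: "m (N k) \<le> B ^ N k * \<beta> k" "0 \<le> m (N k)" for k using m[of k] by (simp_all only: N_def \<beta>_def)
  \<comment> \<open>If m were below 1, then s k would be at least 3^(-1/N), hence at least 1/3. So a
    summable s forces m \<ge> 1 eventually, and then 2 m + 1 \<le> 3 m.\<close>
  have "eventually (\<lambda>k. s k < 1 / 3) sequentially"
    by (rule order_tendstoD(2)[OF summable_LIMSEQ_zero[OF s]]) simp
  then obtain k0 where k0: "\<And>k. k0 \<le> k \<Longrightarrow> s k < 1 / 3" by (auto simp: eventually_sequentially)
  have c3: "1 / 3 \<le> (3::real) powr - (1 / real (N k))" for k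
  proof -
    have "(3::real) powr - 1 \<le> 3 powr - (1 / real (N k))" using N[of k] by (intro powr_mono) auto
    moreover have "(3::real) powr - 1 = 1 / 3" by (simp add: powr_minus_divide)
    ultimately show ?thesis by (simp only:)
  qed
  have m1: "1 \<le> m (N k)" if "k0 \<le> k" for k
  proof (rule ccontr)
    assume "\<not> 1 \<le> m (N k)"
    then have "2 * m (N k) + 1 \<le> 3" by simp
    then have "3 powr - (1 / real (N k)) \<le> s k"
      unfolding s_def using mk(2)[of k] by (intro powr_mono2') auto
    then show False using k0[OF that] c3[of k] by linarith
  qed
  have \<beta>k: "0 < \<beta> k \<and> inverse (root (N k) (\<beta> k)) \<le> 3 * B * s k" if k: "k0 \<le> k" for k
  proof -
    have b0: "0 < \<beta> k"
    proof (rule ccontr)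
      assume "\<not> 0 < \<beta> k"
      then have "B ^ N k * \<beta> k \<le> 0" using B by (intro mult_nonneg_nonpos) auto
      then show False using m1[OF k] mk(1)[of k] by linarith
    qed
    have "2 * m (N k) + 1 \<le> 3 * (B ^ N k * \<beta> k)" using m1[OF k] mk(1)[of k] by linarith
    then have "(3 * (B ^ N k * \<beta> k)) powr - (1 / real (N k)) \<le> s k"
      unfolding s_def using mk(2)[of k] by (intro powr_mono2') auto
    moreover have "(3 * (B ^ N k * \<beta> k)) powr - (1 / real (N k)) =
       3 powr - (1 / real (N k)) * (inverse B * inverse (root (N k) (\<beta> k)))"
    proof -
      have "(B ^ N k) powr - (1 / real (N k)) = inverse B"
        using B N(2)[of k] by (simp add: powr_realpow[symmetric] powr_powr powr_minus)
      moreover have "\<beta> k powr - (1 / real (N k)) = inverse (root (N k) (\<beta> k))"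
        using b0 N(2)[of k] by (simp add: root_powr_inverse powr_minus)
      ultimately show ?thesis using B b0 by (simp add: powr_mult)
    qed
    moreover have "1 / 3 * (inverse B * inverse (root (N k) (\<beta> k))) \<le>
        3 powr - (1 / real (N k)) * (inverse B * inverse (root (N k) (\<beta> k)))"
      by (rule mult_right_mono[OF c3]) (use B b0 N(2)[of k] in simp)
    ultimately have "1 / 3 * (inverse B * inverse (root (N k) (\<beta> k))) \<le> s k" by linarith
    then have "3 * B * (1 / 3 * (inverse B * inverse (root (N k) (\<beta> k)))) \<le> 3 * B * s k"
      by (rule mult_left_mono) (use B in simp)
    moreover have "3 * B * (1 / 3 * (inverse B * inverse (root (N k) (\<beta> k)))) = inverse (root (N k) (\<beta> k))"
      using B by simp
    ultimately show ?thesis using b0 by (simp only:)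
  qed
  \<comment> \<open>Positivity is needed at every k, as one zero would make the extended sum
    infinite. A vanishing even moment would concentrate \<mu> at 0 and so contradict positivity at
    \<open>k0\<close>.\<close>
  have pos: "0 < \<beta> k" for k
  proof (rule ccontr)
    interpret real_distribution \<mu> by fact
    assume neg: "\<not> 0 < \<beta> k"
    have nn: "AE t in \<mu>. 0 \<le> t ^ N k" by (rule AE_I2) (simp add: zero_le_even_power N(3))
    then have "0 \<le> \<beta> k" unfolding \<beta>_def moment_def by (rule integral_nonneg_AE)
    with neg have "(LINT t|\<mu>. t ^ N k) = 0" by (simp add: \<beta>_def moment_def)
    then have "AE t in \<mu>. t ^ N k = 0" using integral_nonneg_eq_0_iff_AE[OF \<mu>(2) nn] by simp
    then have "AE t in \<mu>. t ^ N k0 = 0" by eventually_elim (use N(2)[of k] N(2)[of k0] in simp)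
    then have "(LINT t|\<mu>. t ^ N k0) = (LINT t|\<mu>. 0)" by (intro integral_cong_AE) simp_all
    then have "\<beta> k0 = 0" by (simp add: \<beta>_def moment_def)
    then show False using \<beta>k[of k0] by simp
  qed
  have "summable (\<lambda>k. inverse (root (N k) (\<beta> k)))"
  proof (rule summable_comparison_test'[where N = k0])
    show "summable (\<lambda>k. 3 * B * s k)" by (intro summable_mult s)
    show "norm (inverse (root (N k) (\<beta> k))) \<le> 3 * B * s k" if "k0 \<le> k" for k
      using \<beta>k[OF that] N(2)[of k] by simp
  qed
  moreover have "0 \<le> inverse (root (N k) (\<beta> k))" for k using pos[of k] N(2)[of k] by simp
  ultimately have "(\<Sum>k. ennreal (inverse (root (N k) (\<beta> k)))) \<noteq> \<infinity>"
    unfolding infinity_ennreal_def by (rule ennreal_suminf_neq_top)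
  moreover have "ennreal (inverse (root (N k) (\<beta> k))) = inverse (ennreal (root (N k) (\<beta> k)))" for k
    using pos[of k] N(2)[of k] by (intro inverse_ennreal[symmetric]) simp
  moreover have "(\<Sum>k. inverse (ennreal (root (N k) (\<beta> k)))) = \<infinity>"
    using car unfolding carleman_def N_def \<beta>_def .
  ultimately show False by (simp only:)
qed

lemma profile_model_limit:
  fixes x :: "nat \<Rightarrow> nat \<Rightarrow> nat \<Rightarrow> 'a \<Rightarrow> real"
  assumes M: "prob_space M" and bdd: "bounded (\<sigma> ` unit_square)" and pc: "piecewise_continuous_on_square \<sigma>"
    and iid: "iid_arrays M x" and mc: "moment_condition M x C" and cc: "cumulant_condition C"
  obtains \<nu> where "real_distribution \<nu>" "\<And>k. integrable \<nu> (\<lambda>t. t ^ k)" "\<And>k. moment \<nu> k = limit_moment \<sigma> C k"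
    "esd_converges_as M \<sigma> x \<nu>"
    "\<forall>\<rho>. real_distribution \<rho> \<and> (\<forall>k. integrable \<rho> (\<lambda>t. t ^ k)) \<and> (\<forall>k. moment \<rho> k = limit_moment \<sigma> C k) \<longrightarrow> \<rho> = \<nu>"
proof -
  interpret prob_space M by fact
  obtain B0 where B0: "\<And>z. z \<in> unit_square \<Longrightarrow> \<bar>\<sigma> z\<bar> \<le> B0" using bdd by (auto simp: bounded_iff)
  \<comment> \<open>At least 1, as \<open>carleman_not_summable\<close> requires.\<close>
  define B where "B = max 1 B0"
  have B: "\<bar>\<sigma> z\<bar> \<le> B" if "z \<in> unit_square" for z using B0[OF that] by (simp add: B_def le_max_iff_disj)
  have B1: "1 \<le> B" by (simp add: B_def)
  obtain \<mu> where \<mu>: "real_distribution \<mu>" "\<And>k. integrable \<mu> (\<lambda>t. t ^ k)"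
    "\<And>k. 1 \<le> k \<Longrightarrow> cumulant \<mu> k = (if even k then C k else 0)" "carleman \<mu>"
    using cc unfolding cumulant_condition_def by blast
  have pm: "prob_space \<mu>" using \<mu>(1) by (rule real_distribution.axioms(1))
  have bound: "\<bar>limit_moment \<sigma> C k\<bar> \<le> B ^ k * moment \<mu> k" for k
  proof -
    have "partition_sum (\<lambda>k. if even k then C k else 0) {..<k} = moment \<mu> (card {..<k})"
      by (rule partition_sum_cumulant[OF pm]) (simp_all add: \<mu>(3))
    moreover have "\<bar>limit_moment \<sigma> C k\<bar> \<le> B ^ k * partition_sum (\<lambda>k. if even k then C k else 0) {..<k}"
      by (rule limit_moment_bound) (use B B1 bdd pc even_constant_nonneg[OF mc] in auto)
    ultimately show ?thesis by simp
  qed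
  have det: "\<rho> = \<rho>'" if \<rho>: "real_distribution \<rho>" "\<And>k. integrable \<rho> (\<lambda>t. t ^ k)" "\<And>k. moment \<rho> k = limit_moment \<sigma> C k"
    and \<rho>': "real_distribution \<rho>'" "\<And>k. integrable \<rho>' (\<lambda>t. t ^ k)" "\<And>k. moment \<rho>' k = limit_moment \<sigma> C k" for \<rho> \<rho>'
  proof (rule carleman_determinate[OF \<rho>(1,2) \<rho>'(1,2)])
    show "moment \<rho> k = moment \<rho>' k" for k by (simp only: \<rho>(3) \<rho>'(3))
    show "\<not> summable (\<lambda>k. (2 * moment \<rho> (2 * Suc k) + 1) powr - (1 / real (2 * Suc k)))"
    proof (rule carleman_not_summable[OF \<mu>(1,2,4) B1])
      show "moment \<rho> (2 * Suc k) \<le> B ^ (2 * Suc k) * moment \<mu> (2 * Suc k)" for k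
        unfolding \<rho>(3) by (rule order_trans[OF abs_ge_self bound])
      show "0 \<le> moment \<rho> (2 * Suc k)" for k
        unfolding moment_def power_mult by (intro integral_nonneg_AE) auto
    qed
  qed
  \<comment> \<open>The shift skips n = 0, where the matrix has no eigenvalues and the moment
    formula fails.\<close>
  let ?\<mu> = "\<lambda>\<omega> n. esd (profile_matrix \<sigma> x (Suc n) \<omega>)"
  have rd: "real_distribution (?\<mu> \<omega> n)" for \<omega> n by (rule real_distribution_esd)
  have ip: "integrable (?\<mu> \<omega> n) (\<lambda>t. t ^ k)" for \<omega> n k
    by (rule esd_moment(2)[OF profile_matrix_carrier profile_matrix_sym]) auto
  have AE: "AE \<omega> in M. \<forall>k. (\<lambda>n. moment (?\<mu> \<omega> n) k) \<longlonglongrightarrow> limit_moment \<sigma> C k"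
    unfolding AE_all_countable
  proof
    fix k
    show "AE \<omega> in M. (\<lambda>n. moment (?\<mu> \<omega> n) k) \<longlonglongrightarrow> limit_moment \<sigma> C k"
    proof (cases "k = 0")
      case True
      have "moment (?\<mu> \<omega> n) 0 = 1" for \<omega> n
      proof -
        interpret e: real_distribution "?\<mu> \<omega> n" by (rule rd)
        show ?thesis using e.prob_space by (simp add: moment_def)
      qed
      then show ?thesis using True by (simp add: limit_moment_def)
    next
      case False
      then have "0 < k" by simp
      from esd_moment_AE_limit[OF M iid mc bdd pc this] show ?thesis
        by eventually_elim (rule LIMSEQ_Suc)
    qed
  qed
  \<comment> \<open>The limits do not depend on the sample point, so a law built from one point of
    the almost sure event can be compared with all others.\<close>
  have "\<exists>\<omega>. \<forall>k. (\<lambda>n. moment (?\<mu> \<omega> n) k) \<longlonglongrightarrow> limit_moment \<sigma> C k"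
  proof (rule ccontr)
    assume no: "\<not> ?thesis"
    have "AE \<omega> in M. False" using AE by eventually_elim (use no in blast)
    then show False by simp
  qed
  then obtain \<omega>\<^sub>0 where w0: "\<And>k. (\<lambda>n. moment (?\<mu> \<omega>\<^sub>0 n) k) \<longlonglongrightarrow> limit_moment \<sigma> C k" by blast
  obtain \<nu> where \<nu>: "real_distribution \<nu>" "\<And>k. integrable \<nu> (\<lambda>t. t ^ k)" "\<And>k. moment \<nu> k = limit_moment \<sigma> C k"
    by (rule method_of_moments_exists[of "?\<mu> \<omega>\<^sub>0", OF rd ip w0], rule that)
  have "esd_converges_as M \<sigma> x \<nu>"
    unfolding esd_converges_as_def using AE
  proof eventually_elim
    case (elim \<omega>)
    have "weak_conv_m (?\<mu> \<omega>) \<nu>"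
      by (rule method_of_moments_weak_conv[OF rd ip elim[rule_format] \<nu>(1)]) (rule det[OF _ _ _ \<nu>])
    then show ?case unfolding weak_conv_m_def weak_conv_def by (auto intro: LIMSEQ_imp_Suc)
  qed
  moreover have "\<rho> = \<nu>" if "real_distribution \<rho> \<and> (\<forall>k. integrable \<rho> (\<lambda>t. t ^ k)) \<and> (\<forall>k. moment \<rho> k = limit_moment \<sigma> C k)" for \<rho>
    by (rule det[OF _ _ _ \<nu>]) (simp_all add: that)
  ultimately show thesis by (intro that[OF \<nu>] allI impI)
qed

lemma weak_limit_unique:
  assumes "\<And>n. real_distribution (\<mu> n)" "real_distribution \<nu>" "real_distribution \<nu>'"
    and "weak_conv_m \<mu> \<nu>" "weak_conv_m \<mu> \<nu>'"
  shows "\<nu> = \<nu>'"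
proof (rule Levy_uniqueness[OF assms(2,3)], rule ext)
  fix t show "char \<nu> t = char \<nu>' t"
    using levy_continuity1[OF assms(1,2,4)] levy_continuity1[OF assms(1,3,5)] by (rule LIMSEQ_unique)
qed

theorem mainTheorem5:
  fixes M :: "'a measure"
    and \<sigma> :: "real \<times> real \<Rightarrow> real"
    and x :: "nat \<Rightarrow> nat \<Rightarrow> nat \<Rightarrow> 'a \<Rightarrow> real"
    and C :: "nat \<Rightarrow> real"
  assumes "prob_space M"
    and "bounded (\<sigma> ` unit_square)"
    and "piecewise_continuous_on_square \<sigma>"
    and "iid_arrays M x"
    and "moment_condition M x C"
    and "cumulant_condition C"
  shows "\<exists>\<nu>. real_distribution \<nu> \<and>
             esd_converges_as M \<sigma> x \<nu> \<and>
             distr \<nu> borel uminus = \<nu> \<and>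
             (\<forall>k. integrable \<nu> (\<lambda>t. t ^ k)) \<and>
             even_moments_determined TYPE('b) \<sigma> C \<nu>"
proof -
  obtain \<nu> where \<nu>: "real_distribution \<nu>" "\<And>k. integrable \<nu> (\<lambda>t. t ^ k)" "\<And>k. moment \<nu> k = limit_moment \<sigma> C k"
    "esd_converges_as M \<sigma> x \<nu>"
    and unique: "\<forall>\<rho>. real_distribution \<rho> \<and> (\<forall>k. integrable \<rho> (\<lambda>t. t ^ k)) \<and> (\<forall>k. moment \<rho> k = limit_moment \<sigma> C k) \<longrightarrow> \<rho> = \<nu>"
    by (rule profile_model_limit[OF assms], rule that)
  interpret \<nu>: real_distribution \<nu> by (rule \<nu>(1))
  have um: "uminus \<in> borel_measurable \<nu>" by simp
  have pm: "(\<lambda>t::real. t ^ k) \<in> borel_measurable borel" for k by simp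
  have neg: "(\<lambda>t::real. (- t) ^ k) = (\<lambda>t. (- 1) ^ k * t ^ k)" for k by (rule ext) (rule power_minus)
  \<comment> \<open>Reflection changes the sign of odd moments only, and these vanish; determinacy
    then identifies the reflected law with \<nu>.\<close>
  have sym: "distr \<nu> borel uminus = \<nu>"
  proof (rule unique[THEN spec, THEN mp], intro conjI allI)
    show "real_distribution (distr \<nu> borel uminus)" by (rule \<nu>.real_distribution_distr[OF um])
    show "integrable (distr \<nu> borel uminus) (\<lambda>t. t ^ k)" for k
      unfolding integrable_distr_eq[OF um pm] neg by (intro integrable_mult_right \<nu>(2))
    have "moment (distr \<nu> borel uminus) k = (- 1) ^ k * moment \<nu> k" for k
      unfolding moment_def integral_distr[OF um pm] neg by simp
    then show "moment (distr \<nu> borel uminus) k = limit_moment \<sigma> C k" for k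
      using limit_moment_odd[of k \<sigma> C] by (cases "even k") (simp_all add: \<nu>(3))
  qed
  have "even_moments_determined TYPE('b) \<sigma> C \<nu>"
    unfolding even_moments_determined_def
  proof (intro allI impI)
    fix k and M' :: "'b measure" and \<sigma>' x' C' \<nu>'
    assume a: "profile_model M' \<sigma>' x' C' \<and> (\<forall>p\<in>unit_square. \<sigma>' p = \<sigma> p) \<and>
        (\<forall>m\<in>{1..2*k}. C' (2 * m) = C (2 * m)) \<and> real_distribution \<nu>' \<and> esd_converges_as M' \<sigma>' x' \<nu>'"
    then have pm: "profile_model M' \<sigma>' x' C'" and \<sigma>': "\<forall>p\<in>unit_square. \<sigma>' p = \<sigma> p"
      and C': "\<forall>m\<in>{1..2*k}. C' (2 * m) = C (2 * m)"
      and rd': "real_distribution \<nu>'" and c': "esd_converges_as M' \<sigma>' x' \<nu>'"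
      by - (elim conjE, assumption)+
    have M': "prob_space M'" "bounded (\<sigma>' ` unit_square)" "piecewise_continuous_on_square \<sigma>'"
      "iid_arrays M' x'" "moment_condition M' x' C'" "cumulant_condition C'"
      using pm unfolding profile_model_def by - (elim conjE, assumption)+
    obtain \<rho> where \<rho>: "real_distribution \<rho>" "\<And>k. moment \<rho> k = limit_moment \<sigma>' C' k" "esd_converges_as M' \<sigma>' x' \<rho>"
      by (rule profile_model_limit[OF M'], rule that)
    interpret M': prob_space M' by (rule M'(1))
    \<comment> \<open>Both laws are weak limits along almost every sample point; a probability space
      has at least one such point, so the deterministic equality follows.\<close>
    have "AE \<omega> in M'. \<nu>' = \<rho>"
      using c'[unfolded esd_converges_as_def] \<rho>(3)[unfolded esd_converges_as_def]
      by eventually_elim (rule weak_limit_unique[OF real_distribution_esd rd' \<rho>(1)])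
    then have "\<nu>' = \<rho>" by (simp add: M'.AE_const)
    then have "moment \<nu>' (2 * k) = limit_moment \<sigma>' C' (2 * k)" by (simp add: \<rho>(2))
    also have "\<dots> = limit_moment \<sigma> C (2 * k)"
    proof (rule limit_moment_cong)
      show "\<sigma>' z = \<sigma> z" if "z \<in> unit_square" for z by (rule bspec[OF \<sigma>' that])
      show "C' (2 * m) = C (2 * m)" if "1 \<le> m" "2 * m \<le> 2 * k" for m
        by (rule bspec[OF C']) (use that in simp)
    qed
    finally show "moment \<nu>' (2 * k) = moment \<nu> (2 * k)" by (simp only: \<nu>(3))
  qed
  with \<nu>(1,2,4) sym show ?thesis by (intro exI[of _ \<nu>] conjI allI)
qed

end
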